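(* Let $n\ge 3$ be an integer. There is a constant $k=k(n)>0$, depending only on $n$, such that the following holds. Let $d>\frac{2(n-1)}{2n-3}$ be a real number, let $\varepsilon>0$, and let $f\in\mathscr{H}_d^{\mathbf 0}(\mathbb{R}^{n-1})$. (a) If $\frac{2(n-1)}{2n-3}<d<n-1$, then $$\mathrm{N}_f(\delta,Q)\asymp \delta Q^n+\Big(\frac{\delta}{Q}\Big)^{\frac{n-1}{d}}Q^n\qquad\text{for any } Q\ge 1 \text{ and } \delta\in(Q^{\varepsilon-1},1/2).$$ (b) If $d\ge n-1$, then $$\delta Q^n+\Big(\frac{\delta}{Q}\Big)^{\frac{n-1}{d}}Q^n\ll \mathrm{N}_f(\delta,Q)\ll \delta Q^n+\Big(\frac{\delta}{Q}\Big)^{\frac{n-1}{d}}Q^{n+k\varepsilon}\qquad\text{for any } Q\ge 1 \text{ and } \delta\in(Q^{\varepsilon-1},1/2).$$ The implied constants depend on $\varepsilon,f,n,d$, but not on $\delta$ or $Q$.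
   Context: $\mathscr{H}_d(\mathbb{R}^{n-1})$ is the set of functions $f:\mathbb{R}^{n-1}\to\mathbb{R}$ with $f(\lambda\mathbf{x})=\lambda^d f(\mathbf{x})$ for all $\mathbf{x}\in\mathbb{R}^{n-1}$ and $\lambda\ge 0$. For $d\ne 0$, $\mathscr{H}_d^{\mathbf 0}(\mathbb{R}^{n-1})$ is the set of $f\in\mathscr{H}_d(\mathbb{R}^{n-1})$ that are smooth ($C^\infty$) on $\mathbb{R}^{n-1}\setminus\{\mathbf 0\}$ and whose Hessian matrix $H_f(\mathbf{x})=(\partial^2 f/\partial x_i\partial x_j)_{i,j\le n-1}$ satisfies $\det H_f(\mathbf{x})\ne 0$ for all $\mathbf{x}\ne\mathbf 0$. $\mathrm{N}_f(\delta,Q)$ is the number of pairs $(q,\mathbf{a})\in\mathbb{Z}\times\mathbb{Z}^{n-1}$ such that $q/Q\in[1,2)$, $\lVert \mathbf{a}/q\rVert_2<1$ and $\lVert q f(\mathbf{a}/q)\rVert\le\delta$, where $\lVert\cdot\rVert_2$ is the Euclidean norm and $\lVert x\rVert=\min_{z\in\mathbb{Z}}|x-z|$ for real $x$. $A\ll B$ means $|A|\le C|B|$ for some constant $C>0$, uniformly in the indicated parameters; $A\asymp B$ means $A\ll B$ and $B\ll A$. *)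

theory Defs
  imports "HOL-Analysis.Analysis" "HOL-Library.Landau_Symbols"
begin

text \<open>The space of dimension \<open>n - 1\<close> is \<open>real ^ 'm\<close> with \<open>CARD('m) = n - 1\<close>.\<close>

text \<open>Here \<open>0 powr d = 0\<close>, which for \<open>d > 0\<close> is the usual value of \<open>0\<close> to the power \<open>d\<close>.\<close>

definition homogeneous_funs :: "real \<Rightarrow> (real ^ 'm \<Rightarrow> real) set" where
  "homogeneous_funs d = {f. \<forall>x. \<forall>l\<ge>0. f (l *\<^sub>R x) = l powr d * f x}"

definition partial_deriv :: "'m \<Rightarrow> (real ^ 'm \<Rightarrow> real) \<Rightarrow> real ^ 'm \<Rightarrow> real" where
  "partial_deriv i f x = frechet_derivative f (at x) (axis i 1)"

text \<open>Meant for open \<open>S\<close>: all partial derivatives up to order \<open>k\<close> exist and are continuous on \<open>S\<close>.\<close>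

primrec Ck_on :: "nat \<Rightarrow> (real ^ 'm) set \<Rightarrow> (real ^ 'm \<Rightarrow> real) \<Rightarrow> bool" where
  "Ck_on 0 S f \<longleftrightarrow> continuous_on S f"
| "Ck_on (Suc k) S f \<longleftrightarrow>
     (\<forall>x\<in>S. f differentiable (at x)) \<and> (\<forall>i. Ck_on k S (partial_deriv i f))"

definition smooth_on :: "(real ^ 'm) set \<Rightarrow> (real ^ 'm \<Rightarrow> real) \<Rightarrow> bool" where
  "smooth_on S f \<longleftrightarrow> (\<forall>k. Ck_on k S f)"

definition hessian :: "(real ^ 'm \<Rightarrow> real) \<Rightarrow> real ^ 'm \<Rightarrow> real ^ 'm ^ 'm" where
  "hessian f x = (\<chi> i j. partial_deriv i (partial_deriv j f) x)"

definition nondegenerate_homogeneous_funs :: "real \<Rightarrow> (real ^ 'm \<Rightarrow> real) set" where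
  "nondegenerate_homogeneous_funs d =
     {f \<in> homogeneous_funs d. smooth_on (- {0}) f \<and> (\<forall>x. x \<noteq> 0 \<longrightarrow> det (hessian f x) \<noteq> 0)}"

definition rational_point :: "int \<Rightarrow> int ^ 'm \<Rightarrow> real ^ 'm" where
  "rational_point q a = (\<chi> i. real_of_int (a $ i) / real_of_int q)"

text \<open>\<open>infdist t \<int>\<close> is the distance from \<open>t\<close> to the nearest integer. For \<open>Q > 0\<close> the set
  counted below is finite, since \<open>Q \<le> q < 2 * Q\<close> and every entry of \<open>a\<close> is bounded by \<open>q\<close>.\<close>

definition N_count :: "(real ^ 'm \<Rightarrow> real) \<Rightarrow> real \<Rightarrow> real \<Rightarrow> nat" where
  "N_count f \<delta> Q = card {(q :: int, a :: int ^ 'm).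
     real_of_int q / Q \<in> {1..<2} \<and>
     norm (rational_point q a) < 1 \<and>
     infdist (real_of_int q * f (rational_point q a)) \<int> \<le> \<delta>}"

definition admissible :: "real \<Rightarrow> (real \<times> real) set" where
  "admissible \<epsilon> = {(\<delta>, Q). Q \<ge> 1 \<and> Q powr (\<epsilon> - 1) < \<delta> \<and> \<delta> < 1/2}"

text \<open>The main theorem uses \<open>A \<in> O[principal S](B)\<close>, which unfolds to: there is \<open>c > 0\<close> with
  \<open>\<bar>A p\<bar> \<le> c * \<bar>B p\<bar>\<close> for every \<open>p \<in> S\<close>; likewise \<open>A \<in> \<Theta>[principal S](B)\<close> is the two-sided bound.\<close>

end

theory Submission
  imports Defs
begin

text \<open>
  Triples \<open>(q, a, b)\<close> with \<open>a/q\<close> close to a point \<open>x\<close> and \<open>b\<close> close to \<open>q f(a/q)\<close> are the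
  lattice points of a convex body attached to \<open>x\<close>. A finite Fourier argument bounds their number
  by a constant times the volume of the body times the number of lattice points in the dual body,
  and the dual body at \<open>x\<close> is the body attached to the point \<open>\<nabla>f(x)\<close> for the Legendre transform
  of \<open>f\<close>. Summation over a net of points \<open>x\<close> bounds the count for \<open>f\<close> by that for its Legendre
  transform at another scale. As the hypotheses are symmetric under this duality, the inequality can be
  iterated; it improves the trivial bound to \<open>\<delta> Q^n\<close> for \<open>\<delta> \<ge> Q^(\<epsilon> - 1)\<close>.

  By homogeneity the annulus \<open>|x| \<sim> 2^(-l)\<close> is the unit annulus with the integer lattice replaced by
  \<open>\<int> \<times> \<tau>\<int>^(n-1) \<times> \<sigma>\<int>\<close>, where \<open>\<tau> = 2^l\<close> and \<open>\<sigma> = 2^(ld)\<close>, so all bounds are kept explicit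
  in \<open>\<tau>\<close> and \<open>\<sigma>\<close> and then summed over \<open>l\<close>. For the lower bound, the pigeonhole principle gives enough
  lattice points in every body, the duality shows that few of them have \<open>|q| \<le> \<eta>Q\<close>, and suitable
  multiples of the others have \<open>Q \<le> q < 2Q\<close>.
\<close>

section \<open>Lattice points and exponential sums\<close>

text \<open>Write m = n - 1, \<omega> = (Q\<delta>)^(-1/2) and J = 1/\<delta>; the dual count lives
  at scale J. One pass of duality turns a bound valid for \<delta> \<ge> Q^(-\<theta>) into an
  estimate whose error, relative to \<delta> Q^(m+1), is about \<omega>^m J^(1-\<theta>) log J. For
  m \<ge> 2 (here n \<ge> 3 enters) and \<delta> \<ge> Q^(-\<theta>') one has \<omega>^m \<le> J/Q
  \<le> J^(1-1/\<theta>'), so the error stays bounded once 1/\<theta>' > 2 - \<theta>. The map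
  \<theta> \<mapsto> 1/(2-\<theta>) increases towards its only fixed point 1, so every \<theta> < 1
  is reached in finitely many passes. The O(log Q) annuli must also be paid for: a last pass retains
  one factor \<omega> \<le> Q^(-\<epsilon>/2). Annuli inside the ball of radius about
  (\<delta>/Q)^(1/d) are out of reach of duality; the trivial count used there produces the second
  term. For d > 2m the terms \<omega> 2^(l(d/2-m)) grow towards that ball and reach the same size;
  the number of annuli then costs Q^\<epsilon>.\<close>

lemma card_vec_box:
  fixes S :: "'k::finite \<Rightarrow> 'b set"
  assumes "\<And>i. finite (S i)"
  shows "finite {a :: 'b ^ 'k. \<forall>i. a $ i \<in> S i}"
    and "card {a :: 'b ^ 'k. \<forall>i. a $ i \<in> S i} = (\<Prod>i\<in>UNIV. card (S i))"
proof -
  have bij: "bij_betw vec_lambda (Pi\<^sub>E UNIV S) {a :: 'b ^ 'k. \<forall>i. a $ i \<in> S i}"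
    by (rule bij_betw_byWitness[where f' = vec_nth]) (auto simp: PiE_def extensional_def)
  show "finite {a :: 'b ^ 'k. \<forall>i. a $ i \<in> S i}"
    using bij_betw_finite[OF bij] assms by (auto intro: finite_PiE)
  show "card {a :: 'b ^ 'k. \<forall>i. a $ i \<in> S i} = (\<Prod>i\<in>UNIV. card (S i))"
    using bij_betw_same_card[OF bij] by (simp add: card_PiE)
qed

lemma int_interval_eq: "{k::int. \<bar>real_of_int k - y\<bar> \<le> \<rho>} = {\<lceil>y - \<rho>\<rceil>..\<lfloor>y + \<rho>\<rfloor>}"
  by (auto simp: abs_le_iff ceiling_le_iff le_floor_iff)

lemma card_int_interval:
  fixes y \<rho> :: real
  assumes "\<rho> \<ge> 0"
  shows "finite {k::int. \<bar>real_of_int k - y\<bar> \<le> \<rho>}"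
    and "real (card {k::int. \<bar>real_of_int k - y\<bar> \<le> \<rho>}) \<le> 2 * \<rho> + 1"
    and "real (card {k::int. \<bar>real_of_int k - y\<bar> \<le> \<rho>}) \<ge> 2 * \<rho> - 1"
  unfolding int_interval_eq using assms by (auto; linarith)+

definition real_vec :: "int ^ 'm \<Rightarrow> real ^ 'm" where
  "real_vec a = (\<chi> i. real_of_int (a $ i))"

lemma real_vec_nth [simp]: "real_vec a $ i = real_of_int (a $ i)"
  by (simp add: real_vec_def)

lemma real_vec_diff: "real_vec (a - b) = real_vec a - real_vec b"
  by (simp add: vec_eq_iff)

lemma sum_cis_orthogonal:
  fixes c :: int and P :: nat
  assumes "P > 0"
  shows "(\<Sum>k\<in>{0..<int P}. cis (2 * pi * (real_of_int (c * k) / real P))) = (if int P dvd c then of_nat P else 0)"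
proof -
  define w where "w = cis (2 * pi * real_of_int c / real P)"
  have eq: "(\<Sum>k\<in>{0..<int P}. cis (2 * pi * (real_of_int (c * k) / real P))) = (\<Sum>k<P. w ^ k)"
  proof (rule sum.reindex_bij_witness[of _ int nat])
    fix k assume "k \<in> {0..<int P}"
    then obtain j where "k = int j" by (metis atLeastLessThan_iff zero_le_imp_eq_int)
    then show "w ^ nat k = cis (2 * pi * (real_of_int (c * k) / real P))"
      unfolding w_def Complex.DeMoivre by (simp add: mult_ac)
  qed auto
  have wP: "w ^ P = 1"
    using assms cis_multiple_2pi[of "real_of_int c"] unfolding w_def Complex.DeMoivre by simp
  show ?thesis
  proof (cases "int P dvd c")
    case True
    then obtain e where "c = int P * e" by auto
    then have "w = 1"
      using assms cis_multiple_2pi[of "real_of_int e"] by (simp add: w_def mult.assoc)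
    then show ?thesis using True eq by simp
  next
    case False
    have "w \<noteq> 1"
    proof
      assume "w = 1"
      then have "cos (2 * pi * real_of_int c / real P) = 1" 
        unfolding w_def by (simp add: complex_eq_iff)
      then obtain e :: int where "2 * pi * real_of_int c / real P = of_int e * 2 * pi"
        using cos_one_2pi_int by auto
      then have "real_of_int c = of_int e * real P" using assms by (simp add: field_simps)
      then have "c = e * int P" by (metis of_int_eq_iff of_int_mult of_int_of_nat_eq)
      then show False using False by simp
    qed
    then show ?thesis using False eq wP by (simp add: geometric_sum)
  qed
qed

lemma sum_vec_prod:
  fixes F :: "'k::finite \<Rightarrow> 'b \<Rightarrow> 'c::comm_semiring_1"
  assumes "\<And>i. finite (S i)"
  shows "(\<Sum>a\<in>{a :: 'b ^ 'k. \<forall>i. a $ i \<in> S i}. \<Prod>i\<in>UNIV. F i (a $ i)) = (\<Prod>i\<in>UNIV. \<Sum>y\<in>S i. F i y)"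
proof -
  have "(\<Sum>a\<in>{a :: 'b ^ 'k. \<forall>i. a $ i \<in> S i}. \<Prod>i\<in>UNIV. F i (a $ i)) = (\<Sum>g\<in>Pi\<^sub>E UNIV S. \<Prod>i\<in>UNIV. F i (g i))"
    by (rule sum.reindex_bij_witness[of _ vec_lambda vec_nth]) (auto simp: PiE_def extensional_def)
  then show ?thesis using assms by (simp add: prod_sum_PiE)
qed

lemma cis_sum: "finite A \<Longrightarrow> cis (\<Sum>i\<in>A. f i) = (\<Prod>i\<in>A. cis (f i))"
  by (induction rule: finite_induct) (auto simp: cis_mult[symmetric])

definition dotp :: "int ^ 'k \<Rightarrow> int ^ 'k \<Rightarrow> int" where
  "dotp p k = (\<Sum>i\<in>UNIV. p $ i * k $ i)"

lemma sum_cis_vec_orthogonal: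
  fixes p :: "int ^ 'k" and P :: nat
  assumes "P > 0"
  shows "(\<Sum>k\<in>{k :: int ^ 'k. \<forall>i. k $ i \<in> {0..<int P}}. cis (2 * pi * (real_of_int (dotp p k) / real P)))
    = (if \<forall>i. int P dvd p $ i then of_nat (P ^ CARD('k)) else 0)"
proof -
  have "cis (2 * pi * (real_of_int (dotp p k) / real P))
     = (\<Prod>i\<in>UNIV. cis (2 * pi * (real_of_int (p $ i * k $ i) / real P)))" for k
    by (simp add: dotp_def cis_sum[symmetric] sum_divide_distrib sum_distrib_left)
  then have "(\<Sum>k\<in>{k :: int ^ 'k. \<forall>i. k $ i \<in> {0..<int P}}. cis (2 * pi * (real_of_int (dotp p k) / real P)))
     = (\<Sum>k\<in>{k :: int ^ 'k. \<forall>i. k $ i \<in> {0..<int P}}. \<Prod>i\<in>UNIV. cis (2 * pi * (real_of_int (p $ i * k $ i) / real P)))"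
    by simp
  also have "\<dots> = (\<Prod>i\<in>UNIV. \<Sum>y\<in>{0..<int P}. cis (2 * pi * (real_of_int (p $ i * y) / real P)))"
    by (subst sum_vec_prod) auto
  also have "\<dots> = (\<Prod>i\<in>UNIV. if int P dvd p $ i then of_nat P else 0)"
    by (intro prod.cong sum_cis_orthogonal refl assms)
  also have "\<dots> = (if \<forall>i. int P dvd p $ i then of_nat (P ^ CARD('k)) else 0)"
  proof (cases "\<forall>i. int P dvd p $ i")
    case False
    then obtain i where "\<not> int P dvd p $ i" by auto
    then have "(\<Prod>i\<in>UNIV. if int P dvd p $ i then (of_nat P :: complex) else 0) = 0"
      by (intro prod_zero) auto
    then show ?thesis using False by auto
  qed simp
  finally show ?thesis .
qed

lemma dotp_diff_left: "dotp (p - p') k = dotp p k - dotp p' k"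
  by (simp add: dotp_def left_diff_distrib sum_subtractf)

text \<open>On \<open>V\<close> the exponential sum over \<open>S\<close> has modulus at least \<open>card S / sqrt 2\<close>, while its mean
  square over all residues modulo \<open>P\<close> is \<open>card S\<close>.\<close>

lemma large_sieve:
  fixes S V :: "(int ^ 'k) set" and P M :: nat
  assumes fin: "finite S" "finite V" and P: "P > 0"
    and inj: "\<And>p p'. p \<in> S \<Longrightarrow> p' \<in> S \<Longrightarrow> \<forall>i. int P dvd (p - p') $ i \<Longrightarrow> p = p'"
    and small: "\<And>p k. p \<in> S \<Longrightarrow> k \<in> V \<Longrightarrow> \<bar>real_of_int (dotp p k)\<bar> \<le> real P / 8"
    and fibre: "\<And>k. k \<in> V \<Longrightarrow> card {k' \<in> V. \<forall>i. int P dvd (k' - k) $ i} \<le> M"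
  shows "real (card S) * real (card V) \<le> 2 * real M * real P ^ CARD('k)"
proof -
  define E where "E p k = cis (2 * pi * (real_of_int (dotp p k) / real P))" for p k :: "int ^ 'k"
  define T where "T k = (\<Sum>p\<in>S. E p k)" for k
  define Box where "Box = {k :: int ^ 'k. \<forall>i. k $ i \<in> {0..<int P}}"
  have finBox: "finite Box"
    unfolding Box_def by (intro card_vec_box) auto
  have EE: "E p k * cnj (E p' k) = E (p - p') k" for p p' k
    by (simp add: E_def cis_cnj cis_mult dotp_diff_left diff_divide_distrib right_diff_distrib)
  have "(\<Sum>k\<in>Box. T k * cnj (T k)) = (\<Sum>k\<in>Box. \<Sum>p\<in>S. \<Sum>p'\<in>S. E (p - p') k)"
    by (simp add: T_def sum_product EE)
  also have "\<dots> = (\<Sum>p\<in>S. \<Sum>p'\<in>S. \<Sum>k\<in>Box. E (p - p') k)"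
    by (subst sum.swap, rule sum.cong[OF refl], rule sum.swap)
  also have "\<dots> = (\<Sum>p\<in>S. \<Sum>p'\<in>S. if p = p' then of_nat (P ^ CARD('k)) else 0)"
  proof (intro sum.cong refl)
    fix p p' assume pp: "p \<in> S" "p' \<in> S"
    have "(\<Sum>k\<in>Box. E (p - p') k) = (if \<forall>i. int P dvd (p - p') $ i then of_nat (P ^ CARD('k)) else 0)"
      unfolding E_def Box_def by (rule sum_cis_vec_orthogonal[OF P])
    moreover have "(\<forall>i. int P dvd (p - p') $ i) \<longleftrightarrow> p = p'"
      using inj pp by auto
    ultimately show "(\<Sum>k\<in>Box. E (p - p') k) = (if p = p' then of_nat (P ^ CARD('k)) else 0)"
      by simp
  qed
  also have "\<dots> = of_nat (card S * P ^ CARD('k))"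
    using fin by simp
  finally have orth: "(\<Sum>k\<in>Box. T k * cnj (T k)) = of_nat (card S * P ^ CARD('k))" .
  have "of_real (\<Sum>k\<in>Box. (cmod (T k))\<^sup>2) = (of_nat (card S * P ^ CARD('k)) :: complex)"
    unfolding orth[symmetric] by (simp only: of_real_sum complex_norm_square)
  then have orth': "(\<Sum>k\<in>Box. (cmod (T k))\<^sup>2) = real (card S * P ^ CARD('k))"
    by (metis of_real_eq_iff of_real_of_nat_eq)
  have low: "(real (card S))\<^sup>2 / 2 \<le> (cmod (T k))\<^sup>2" if "k \<in> V" for k
  proof -
    have "real (card S) * (sqrt 2 / 2) = (\<Sum>p\<in>S. sqrt 2 / 2)" by simp
    also have "\<dots> \<le> (\<Sum>p\<in>S. Re (E p k))"
    proof (rule sum_mono)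
      fix p assume "p \<in> S"
      from small[OF this that] P have "\<bar>real_of_int (dotp p k) / real P\<bar> \<le> 1/8"
        by (simp add: field_simps)
      then have "2 * pi * \<bar>real_of_int (dotp p k) / real P\<bar> \<le> 2 * pi * (1/8)"
        by (intro mult_left_mono) auto
      then have "\<bar>2 * pi * (real_of_int (dotp p k) / real P)\<bar> \<le> pi / 4"
        by (simp add: abs_mult)
      then have "cos (pi / 4) \<le> cos \<bar>2 * pi * (real_of_int (dotp p k) / real P)\<bar>"
        by (intro cos_monotone_0_pi_le) auto
      then show "sqrt 2 / 2 \<le> Re (E p k)"
        unfolding cos_abs_real by (simp add: E_def cos_45)
    qed
    also have "\<dots> = Re (T k)" by (simp add: T_def)
    also have "\<dots> \<le> cmod (T k)" by (rule complex_Re_le_cmod)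
    finally have "(real (card S) * (sqrt 2 / 2))\<^sup>2 \<le> (cmod (T k))\<^sup>2"
      by (intro power_mono) auto
    then show ?thesis by (simp add: power_mult_distrib power_divide)
  qed
  \<comment> \<open>\<open>V\<close> may meet a residue class several times. Since
    \<open>E p k\<close> depends only on \<open>k\<close> modulo \<open>P\<close>, the sum over
    \<open>V\<close> becomes one over residues, each with multiplicity at most
    \<open>M\<close>.\<close>
  define md where "md k = (\<chi> i. k $ i mod int P)" for k :: "int ^ 'k"
  have md_Box: "md k \<in> Box" for k using P by (simp add: md_def Box_def)
  have E_md: "E p (md k) = E p k" for p k
  proof -
    have "dotp p k = dotp p (md k) + int P * dotp p (\<chi> i. k $ i div int P)"
      unfolding dotp_def md_def sum_distrib_left sum.distrib[symmetric]
      by (intro sum.cong refl) (simp, metis distrib_left mod_mult_div_eq mult.left_commute)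
    then have "2 * pi * (real_of_int (dotp p k) / real P)
      = 2 * pi * (real_of_int (dotp p (md k)) / real P) + 2 * pi * real_of_int (dotp p (\<chi> i. k $ i div int P))"
      using P by (simp add: field_simps)
    then show ?thesis 
      by (simp add: E_def cis_mult[symmetric] cis_multiple_2pi)
  qed
  have "real (card V) * ((real (card S))\<^sup>2 / 2) = (\<Sum>k\<in>V. (real (card S))\<^sup>2 / 2)" by simp
  also have "\<dots> \<le> (\<Sum>k\<in>V. (cmod (T k))\<^sup>2)" by (intro sum_mono low)
  also have "\<dots> = (\<Sum>k\<in>V. (cmod (T (md k)))\<^sup>2)" by (simp add: T_def E_md)
  also have "\<dots> = (\<Sum>b\<in>Box. \<Sum>k\<in>{k \<in> V. md k = b}. (cmod (T (md k)))\<^sup>2)"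
    using fin finBox md_Box by (intro sum.group[symmetric]) auto
  also have "\<dots> = (\<Sum>b\<in>Box. real (card {k \<in> V. md k = b}) * (cmod (T b))\<^sup>2)"
    by (intro sum.cong refl) simp
  also have "\<dots> \<le> (\<Sum>b\<in>Box. real M * (cmod (T b))\<^sup>2)"
  proof (intro sum_mono mult_right_mono)
    fix b
    show "real (card {k \<in> V. md k = b}) \<le> real M"
    proof (cases "\<exists>k0\<in>V. md k0 = b")
      case True
      then obtain k0 where k0: "k0 \<in> V" "md k0 = b" by auto
      have "card {k \<in> V. md k = b} \<le> card {k' \<in> V. \<forall>i. int P dvd (k' - k0) $ i}"
        using fin k0 by (intro card_mono) (auto simp: md_def vec_eq_iff mod_eq_dvd_iff[symmetric])
      then show ?thesis using fibre[OF k0(1)] by linarith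
    next
      case False
      then have "{k \<in> V. md k = b} = {}" by auto
      then have "card {k \<in> V. md k = b} = 0" by (simp only: card.empty)
      then show ?thesis by linarith
    qed
  qed auto
  also have "\<dots> = real M * (real (card S) * real P ^ CARD('k))"
    by (simp add: sum_distrib_left[symmetric] orth')
  finally have "real (card S) * (real (card S) * real (card V)) \<le> real (card S) * (2 * real M * real P ^ CARD('k))"
    by (simp add: power2_eq_square field_simps)
  then show ?thesis
    by (cases "card S = 0") (auto simp: mult_le_cancel_left)
qed

section \<open>Counting lattice points in balls and in bodies\<close>

lemma card_lattice_ball:
  fixes y :: "real ^ 'm"
  assumes "\<tau> > 0" "B \<ge> 0"
  shows finite_lattice_ball: "finite {a. norm (\<tau> *\<^sub>R real_vec a - y) \<le> B}"
    and card_lattice_ball_le: "real (card {a. norm (\<tau> *\<^sub>R real_vec a - y) \<le> B}) \<le> (2 * B / \<tau> + 1) ^ CARD('m)"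
    and card_lattice_ball_ge: "B \<ge> real CARD('m) * \<tau> \<Longrightarrow>
      real (card {a. norm (\<tau> *\<^sub>R real_vec a - y) \<le> B}) \<ge> (B / (real CARD('m) * \<tau>)) ^ CARD('m)"
proof -
  let ?S = "{a. norm (\<tau> *\<^sub>R real_vec a - y) \<le> B}"
  let ?I = "\<lambda>\<rho> i. {k::int. \<bar>real_of_int k - y $ i / \<tau>\<bar> \<le> \<rho>}"
  have coord: "\<bar>(\<tau> *\<^sub>R real_vec a - y) $ i\<bar> = \<tau> * \<bar>real_of_int (a $ i) - y $ i / \<tau>\<bar>" for a i
  proof -
    have "(\<tau> *\<^sub>R real_vec a - y) $ i = \<tau> * (real_of_int (a $ i) - y $ i / \<tau>)"
      using assms by (simp add: field_simps)
    then show ?thesis using assms by (simp add: abs_mult)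
  qed
  have sub: "?S \<subseteq> {a. \<forall>i. a $ i \<in> ?I (B / \<tau>) i}"
  proof safe
    fix a i assume "norm (\<tau> *\<^sub>R real_vec a - y) \<le> B"
    then have "\<tau> * \<bar>real_of_int (a $ i) - y $ i / \<tau>\<bar> \<le> B"
      using component_le_norm_cart[of "\<tau> *\<^sub>R real_vec a - y" i] unfolding coord by linarith
    then show "\<bar>real_of_int (a $ i) - y $ i / \<tau>\<bar> \<le> B / \<tau>"
      using assms by (simp add: field_simps)
  qed
  have finI: "finite (?I \<rho> i)" if "\<rho> \<ge> 0" for \<rho> i by (rule card_int_interval[OF that])
  have cv: "finite {a :: int ^ 'm. \<forall>i. a $ i \<in> ?I \<rho> i}"
    "card {a :: int ^ 'm. \<forall>i. a $ i \<in> ?I \<rho> i} = (\<Prod>i\<in>UNIV. card (?I \<rho> i))" if "\<rho> \<ge> 0" for \<rho>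
    by (rule card_vec_box[OF finI[OF that]])+
  have B\<tau>: "B / \<tau> \<ge> 0" using assms by simp
  note fin = cv(1)[OF B\<tau>]
  show finS: "finite ?S" by (rule finite_subset[OF sub fin])
  have "card ?S \<le> (\<Prod>i\<in>UNIV. card (?I (B / \<tau>) i))"
    using card_mono[OF fin sub] unfolding cv(2)[OF B\<tau>] .
  then have "real (card ?S) \<le> (\<Prod>i\<in>UNIV. real (card (?I (B / \<tau>) i)))"
    unfolding of_nat_prod[symmetric] of_nat_le_iff .
  also have "\<dots> \<le> (\<Prod>i\<in>(UNIV::'m set). 2 * B / \<tau> + 1)"
  proof (intro prod_mono conjI)
    fix i show "real (card (?I (B / \<tau>) i)) \<le> 2 * B / \<tau> + 1"
      using card_int_interval(2)[OF B\<tau>, of "y $ i / \<tau>"] by (simp only: times_divide_eq_right)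
  qed (rule of_nat_0_le_iff)
  finally show "real (card ?S) \<le> (2 * B / \<tau> + 1) ^ CARD('m)" by simp
  assume BB: "B \<ge> real CARD('m) * \<tau>"
  \<comment> \<open>The cube of half-side \<open>\<rho> * \<tau> = B / CARD('m)\<close> lies in the
    ball because the l1 norm dominates the Euclidean one; \<open>\<rho> \<ge> 1\<close> turns the
    interval count \<open>2 * \<rho> - 1\<close> into at least \<open>\<rho>\<close>.\<close>
  define \<rho> where "\<rho> = B / (real CARD('m) * \<tau>)"
  have \<rho>: "\<rho> \<ge> 1" using BB assms by (simp add: \<rho>_def field_simps)
  have "{a. \<forall>i. a $ i \<in> ?I \<rho> i} \<subseteq> ?S"
  proof safe
    fix a assume a: "\<forall>i. a $ i \<in> ?I \<rho> i"
    have "norm (\<tau> *\<^sub>R real_vec a - y) \<le> (\<Sum>i\<in>UNIV. \<bar>(\<tau> *\<^sub>R real_vec a - y) $ i\<bar>)"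
      by (rule norm_le_l1_cart)
    also have "\<dots> \<le> (\<Sum>i\<in>(UNIV::'m set). \<tau> * \<rho>)"
      unfolding coord using a assms by (intro sum_mono mult_left_mono) auto
    also have "\<dots> = B" using assms by (simp add: \<rho>_def)
    finally show "norm (\<tau> *\<^sub>R real_vec a - y) \<le> B" .
  qed
  then have "card {a. \<forall>i. a $ i \<in> ?I \<rho> i} \<le> card ?S"
    by (rule card_mono[OF finS])
  then have le: "(\<Prod>i\<in>UNIV. real (card (?I \<rho> i))) \<le> real (card ?S)"
    using cv(2)[of \<rho>] \<rho> unfolding of_nat_prod[symmetric] of_nat_le_iff by simp
  have "(\<Prod>i\<in>(UNIV::'m set). \<rho>) \<le> (\<Prod>i\<in>UNIV. real (card (?I \<rho> i)))"
  proof (intro prod_mono conjI)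
    fix i
    show "\<rho> \<le> real (card (?I \<rho> i))"
      using card_int_interval(3)[of \<rho> "y $ i / \<tau>"] \<rho> by linarith
  qed (use \<rho> in auto)
  with le show "real (card ?S) \<ge> (B / (real CARD('m) * \<tau>)) ^ CARD('m)"
    by (simp add: \<rho>_def)
qed

text \<open>The lattice points of the body attached to a point \<open>x\<close> where \<open>f\<close> has value \<open>f\<close> and
  gradient \<open>g\<close>. Its dual is the same kind of body, for the Legendre data \<open>g\<close>, \<open>x \<bullet> g - f\<close>, \<open>x\<close>, with
  \<open>\<tau>\<close>, \<open>A\<close>, \<open>B\<close>, \<open>\<delta>\<close> replaced by \<open>\<sigma> / \<tau>\<close>, \<open>1 / \<delta>\<close>, \<open>\<sigma> / B\<close>, \<open>1 / A\<close>.\<close>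

definition pts :: "real \<Rightarrow> real \<Rightarrow> real ^ 'm \<Rightarrow> real \<Rightarrow> real ^ 'm \<Rightarrow> real \<Rightarrow> real \<Rightarrow> real \<Rightarrow> (int \<times> (int ^ 'm) \<times> int) set" where
  "pts \<tau> \<sigma> x f g A B \<delta> = {(q, a, b). \<bar>real_of_int q\<bar> \<le> A \<and>
     norm (\<tau> *\<^sub>R real_vec a - real_of_int q *\<^sub>R x) \<le> B \<and>
     \<bar>\<sigma> * real_of_int b - real_of_int q * f - g \<bullet> (\<tau> *\<^sub>R real_vec a - real_of_int q *\<^sub>R x)\<bar> \<le> \<sigma> * \<delta>}"

lemma pts_mono:
  assumes "A \<le> A'" "B \<le> B'" "\<delta> \<le> \<delta>'" "\<sigma> > 0"
  shows "pts \<tau> \<sigma> x f g A B \<delta> \<subseteq> pts \<tau> \<sigma> x f g A' B' \<delta>'"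
proof -
  have "\<sigma> * \<delta> \<le> \<sigma> * \<delta>'" using assms by (intro mult_left_mono) auto
  then show ?thesis unfolding pts_def using assms(1,2) by (auto elim: order_trans)
qed

text \<open>Fibred over \<open>q\<close>, then \<open>a\<close>, then \<open>b\<close>, every fibre
  is an integer interval or a lattice ball whose size bounds do not depend on the earlier
  coordinates, so the bounds multiply.\<close>

lemma pts_Sigma:
  assumes "\<sigma> > 0"
  shows "pts \<tau> \<sigma> x f g A B \<delta> = (SIGMA q:{q. \<bar>real_of_int q - 0\<bar> \<le> A}.
     SIGMA a:{a. norm (\<tau> *\<^sub>R real_vec a - real_of_int q *\<^sub>R x) \<le> B}.
     {b. \<bar>real_of_int b - (real_of_int q * f + g \<bullet> (\<tau> *\<^sub>R real_vec a - real_of_int q *\<^sub>R x)) / \<sigma>\<bar> \<le> \<delta>})"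
proof -
  have "\<bar>\<sigma> * b - c - e\<bar> \<le> \<sigma> * \<delta> \<longleftrightarrow> \<bar>b - (c + e) / \<sigma>\<bar> \<le> \<delta>" for b c e :: real
  proof -
    have "\<sigma> * b - c - e = \<sigma> * (b - (c + e) / \<sigma>)" using assms by (simp add: field_simps)
    then show ?thesis using assms by (simp add: abs_mult)
  qed
  then show ?thesis unfolding pts_def by auto
qed

lemma sum_real_le_card: 
  fixes K :: real
  assumes "\<And>x. x \<in> A \<Longrightarrow> f x \<le> K" shows "sum f A \<le> real (card A) * K"
  using sum_bounded_above[of A f K] assms by simp

lemma sum_real_ge_card: 
  fixes K :: real
  assumes "\<And>x. x \<in> A \<Longrightarrow> f x \<ge> K" shows "sum f A \<ge> real (card A) * K"
  using sum_bounded_below[of A K f] assms by simp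

lemma card_pts:
  fixes x :: "real ^ 'm"
  assumes "\<tau> > 0" "\<sigma> > 0" "A \<ge> 0" "B \<ge> 0" "\<delta> \<ge> 0"
  shows finite_pts: "finite (pts \<tau> \<sigma> x f g A B \<delta>)"
    and card_pts_le: "real (card (pts \<tau> \<sigma> x f g A B \<delta>)) \<le> (2 * A + 1) * ((2 * B / \<tau> + 1) ^ CARD('m) * (2 * \<delta> + 1))"
    and card_pts_ge: "A \<ge> 1 \<Longrightarrow> B \<ge> real CARD('m) * \<tau> \<Longrightarrow> \<delta> \<ge> 1 \<Longrightarrow>
      real (card (pts \<tau> \<sigma> x f g A B \<delta>)) \<ge> A * ((B / (real CARD('m) * \<tau>)) ^ CARD('m) * \<delta>)"
proof -
  define Qs where "Qs = {q. \<bar>real_of_int q - 0\<bar> \<le> A}"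
  define As where "As q = {a. norm (\<tau> *\<^sub>R real_vec a - real_of_int q *\<^sub>R x) \<le> B}" for q :: int
  define Bs where "Bs q a = {b. \<bar>real_of_int b - (real_of_int q * f + g \<bullet> (\<tau> *\<^sub>R real_vec a - real_of_int q *\<^sub>R x)) / \<sigma>\<bar> \<le> \<delta>}" for q :: int and a
  have eq: "pts \<tau> \<sigma> x f g A B \<delta> = (SIGMA q:Qs. SIGMA a:As q. Bs q a)"
    unfolding pts_Sigma[OF assms(2)] Qs_def As_def Bs_def ..
  have fQ: "finite Qs" unfolding Qs_def by (rule card_int_interval) fact
  have fA: "finite (As q)" for q unfolding As_def by (rule finite_lattice_ball) fact+
  have fB: "finite (Bs q a)" for q a unfolding Bs_def by (rule card_int_interval) fact
  show "finite (pts \<tau> \<sigma> x f g A B \<delta>)" unfolding eq by (intro finite_SigmaI fQ fA fB)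
  have card: "real (card (pts \<tau> \<sigma> x f g A B \<delta>)) = (\<Sum>q\<in>Qs. \<Sum>a\<in>As q. real (card (Bs q a)))"
  proof -
    have "card (Sigma (As q) (Bs q)) = (\<Sum>a\<in>As q. card (Bs q a))" for q
      by (rule card_SigmaI[OF fA]) (simp add: fB)
    moreover have "card (SIGMA q:Qs. SIGMA a:As q. Bs q a) = (\<Sum>q\<in>Qs. card (Sigma (As q) (Bs q)))"
      by (rule card_SigmaI[OF fQ]) (intro ballI finite_SigmaI fA fB)
    ultimately show ?thesis unfolding eq by simp
  qed
  have "real (card (pts \<tau> \<sigma> x f g A B \<delta>)) \<le> (\<Sum>q\<in>Qs. real (card (As q)) * (2 * \<delta> + 1))"
    unfolding card Bs_def by (intro sum_mono sum_real_le_card card_int_interval assms)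
  also have "\<dots> \<le> real (card Qs) * ((2 * B / \<tau> + 1) ^ CARD('m) * (2 * \<delta> + 1))"
    unfolding As_def using assms by (intro sum_real_le_card mult_right_mono card_lattice_ball_le) auto
  also have "\<dots> \<le> (2 * A + 1) * ((2 * B / \<tau> + 1) ^ CARD('m) * (2 * \<delta> + 1))"
    unfolding Qs_def using assms by (intro mult_right_mono card_int_interval) auto
  finally show "real (card (pts \<tau> \<sigma> x f g A B \<delta>)) \<le> (2 * A + 1) * ((2 * B / \<tau> + 1) ^ CARD('m) * (2 * \<delta> + 1))" .
  assume ge: "A \<ge> 1" "B \<ge> real CARD('m) * \<tau>" "\<delta> \<ge> 1"
  have cQ: "A \<le> real (card Qs)" 
    unfolding Qs_def using card_int_interval(3)[of A 0] ge by linarith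
  have cB: "\<delta> \<le> real (card (Bs q a))" for q a
    unfolding Bs_def by (rule order_trans[OF _ card_int_interval(3)]) (use ge in auto)
  have "A * ((B / (real CARD('m) * \<tau>)) ^ CARD('m) * \<delta>) \<le> real (card Qs) * ((B / (real CARD('m) * \<tau>)) ^ CARD('m) * \<delta>)"
    using cQ assms by (intro mult_right_mono) auto
  also have "\<dots> \<le> (\<Sum>q\<in>Qs. real (card (As q)) * \<delta>)"
    unfolding As_def using assms ge by (intro sum_real_ge_card mult_right_mono card_lattice_ball_ge) auto
  also have "\<dots> \<le> real (card (pts \<tau> \<sigma> x f g A B \<delta>))"
    unfolding card using cB by (intro sum_mono sum_real_ge_card)
  finally show "real (card (pts \<tau> \<sigma> x f g A B \<delta>)) \<ge> A * ((B / (real CARD('m) * \<tau>)) ^ CARD('m) * \<delta>)" .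
qed

section \<open>Transference between a box and its dual\<close>

text \<open>\<open>'m option option\<close> has \<open>CARD('m) + 2\<close> elements, so it indexes
  the triples as plain integer vectors, the form that \<open>large_sieve\<close> works with.\<close>

definition encode :: "int \<times> (int ^ 'm) \<times> int \<Rightarrow> int ^ 'm option option" where
  "encode = (\<lambda>(q, a, b). \<chi> i. case i of None \<Rightarrow> q | Some None \<Rightarrow> b | Some (Some i) \<Rightarrow> a $ i)"

lemma encode_nth [simp]:
  "encode (q, a, b) $ None = q"
  "encode (q, a, b) $ Some None = b"
  "encode (q, a, b) $ Some (Some i) = a $ i"
  by (simp_all add: encode_def)

lemma all_option2: "(\<forall>i. P i) \<longleftrightarrow> P None \<and> P (Some None) \<and> (\<forall>i. P (Some (Some i)))"
  by (metis option.exhaust)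

lemma encode_inject: "encode p = encode p' \<longleftrightarrow> p = p'"
  by (cases p, cases p') (auto simp: vec_eq_iff all_option2)

lemma encode_diff: "encode (q, a, b) - encode (q', a', b') = encode (q - q', a - a', b - b')"
  by (simp add: vec_eq_iff all_option2)

lemma sum_UNIV_option:
  fixes h :: "'a::finite option \<Rightarrow> 'b::comm_monoid_add"
  shows "(\<Sum>i\<in>UNIV. h i) = h None + (\<Sum>i\<in>UNIV. h (Some i))"
  by (simp add: UNIV_option_conv sum.reindex)

lemma dotp_encode: "dotp (encode (q, a, b)) (encode (q', a', b')) = q * q' + b * b' + dotp a a'"
  by (simp add: dotp_def sum_UNIV_option)

lemma real_dotp: "real_of_int (dotp a b) = real_vec a \<bullet> real_vec b"
  by (simp add: dotp_def inner_vec_def)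

lemma real_vec_minus: "real_vec (- a) = - real_vec a"
  by (simp add: vec_eq_iff)

text \<open>This is why the dual carries the Legendre value \<open>x \<bullet> g - f\<close>: with
  displacements \<beta>, \<beta>' and residuals \<gamma>, \<gamma>', all terms in \<open>f\<close>
  and \<open>x \<bullet> g\<close> cancel, and \<sigma> times the pairing equals
  \<open>q * \<gamma>' + j * \<gamma> - \<beta> \<bullet> \<beta>'\<close>. The sizes of the dual
  body are reciprocal so that each of these three terms is at most
  \<open>\<sigma> * c\<close>.\<close>

lemma dual_pairing_bound:
  fixes x g :: "real ^ 'm"
  assumes pos: "\<tau> > 0" "\<sigma> > 0" "A > 0" "B > 0" "\<delta> > 0" "c \<ge> 0"
    and p: "(q, a, b) \<in> pts \<tau> \<sigma> x f g A B \<delta>"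
    and k: "(j, u, v) \<in> pts (\<sigma> / \<tau>) \<sigma> g (x \<bullet> g - f) x (c / \<delta>) (c * \<sigma> / B) (c / A)"
  shows "\<bar>real_of_int (q * v + b * j + dotp a (- u))\<bar> \<le> 3 * c"
proof -
  define \<beta> where "\<beta> = \<tau> *\<^sub>R real_vec a - real_of_int q *\<^sub>R x"
  define \<beta>' where "\<beta>' = (\<sigma> / \<tau>) *\<^sub>R real_vec u - real_of_int j *\<^sub>R g"
  define \<gamma> where "\<gamma> = \<sigma> * real_of_int b - real_of_int q * f - g \<bullet> \<beta>"
  define \<gamma>' where "\<gamma>' = \<sigma> * real_of_int v - real_of_int j * (x \<bullet> g - f) - x \<bullet> \<beta>'"
  have pb: "\<bar>real_of_int q\<bar> \<le> A" "norm \<beta> \<le> B" "\<bar>\<gamma>\<bar> \<le> \<sigma> * \<delta>"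
    using p by (auto simp: pts_def \<beta>_def \<gamma>_def)
  have kb: "\<bar>real_of_int j\<bar> \<le> c / \<delta>" "norm \<beta>' \<le> c * \<sigma> / B" "\<bar>\<gamma>'\<bar> \<le> \<sigma> * (c / A)"
    using k by (auto simp: pts_def \<beta>'_def \<gamma>'_def)
  have a: "real_vec a = (1 / \<tau>) *\<^sub>R (\<beta> + real_of_int q *\<^sub>R x)"
    using pos by (simp add: \<beta>_def)
  have u: "real_vec u = (\<tau> / \<sigma>) *\<^sub>R (\<beta>' + real_of_int j *\<^sub>R g)"
    using pos by (simp add: \<beta>'_def)
  have "\<sigma> * (real_vec a \<bullet> real_vec u) = (\<beta> + real_of_int q *\<^sub>R x) \<bullet> (\<beta>' + real_of_int j *\<^sub>R g)"
    unfolding a u using pos by simp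
  also have "\<dots> = \<beta> \<bullet> \<beta>' + j * (g \<bullet> \<beta>) + q * (x \<bullet> \<beta>') + q * j * (x \<bullet> g)"
    by (simp add: inner_add_left inner_add_right inner_commute algebra_simps)
  finally have dot: "\<sigma> * (real_vec a \<bullet> real_vec u) = \<dots>" .
  have "\<sigma> * real_of_int (q * v + b * j + dotp a (- u)) =
      q * (\<sigma> * v) + j * (\<sigma> * b) - \<sigma> * (real_vec a \<bullet> real_vec u)"
    by (simp add: real_dotp real_vec_minus algebra_simps)
  also have "\<dots> = q * \<gamma>' + j * \<gamma> - \<beta> \<bullet> \<beta>'"
    unfolding dot \<gamma>_def \<gamma>'_def by (simp add: algebra_simps)
  finally have eq: "\<sigma> * real_of_int (q * v + b * j + dotp a (- u)) = q * \<gamma>' + j * \<gamma> - \<beta> \<bullet> \<beta>'" .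
  have 1: "\<bar>q * \<gamma>'\<bar> \<le> A * (\<sigma> * (c / A))"
    unfolding abs_mult using pb kb pos by (intro mult_mono) auto
  have 2: "\<bar>j * \<gamma>\<bar> \<le> (c / \<delta>) * (\<sigma> * \<delta>)"
    unfolding abs_mult using pb kb pos by (intro mult_mono) auto
  have "norm \<beta> * norm \<beta>' \<le> B * (c * \<sigma> / B)"
    using pb kb pos by (intro mult_mono) auto
  then have 3: "\<bar>\<beta> \<bullet> \<beta>'\<bar> \<le> B * (c * \<sigma> / B)"
    using Cauchy_Schwarz_ineq2[of \<beta> \<beta>'] by linarith
  have "\<bar>\<sigma> * real_of_int (q * v + b * j + dotp a (- u))\<bar> \<le> \<sigma> * (3 * c)"
  proof -
    have "A * (\<sigma> * (c / A)) = \<sigma> * c" "(c / \<delta>) * (\<sigma> * \<delta>) = \<sigma> * c" "B * (c * \<sigma> / B) = \<sigma> * c"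
      using pos by simp_all
    then show ?thesis unfolding eq using 1 2 3 by linarith
  qed
  then show ?thesis using pos by (simp add: abs_mult)
qed

lemma pts_diff:
  assumes "(q, a, b) \<in> pts \<tau> \<sigma> x f g A B \<delta>" "(q', a', b') \<in> pts \<tau> \<sigma> x f g A' B' \<delta>'"
  shows "(q - q', a - a', b - b') \<in> pts \<tau> \<sigma> x f g (A + A') (B + B') (\<delta> + \<delta>')"
proof -
  define \<beta> where "\<beta> = \<tau> *\<^sub>R real_vec a - real_of_int q *\<^sub>R x"
  define \<beta>' where "\<beta>' = \<tau> *\<^sub>R real_vec a' - real_of_int q' *\<^sub>R x"
  have eq: "\<tau> *\<^sub>R real_vec (a - a') - real_of_int (q - q') *\<^sub>R x = \<beta> - \<beta>'"
    by (simp add: \<beta>_def \<beta>'_def real_vec_diff algebra_simps)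
  have n: "norm (\<beta> - \<beta>') \<le> norm \<beta> + norm \<beta>'" by (rule norm_triangle_ineq4)
  have r: "\<sigma> * real_of_int (b - b') - real_of_int (q - q') * f - g \<bullet> (\<beta> - \<beta>') =
    (\<sigma> * real_of_int b - real_of_int q * f - g \<bullet> \<beta>) - (\<sigma> * real_of_int b' - real_of_int q' * f - g \<bullet> \<beta>')"
    by (simp add: inner_diff_right algebra_simps)
  show ?thesis
    using assms n unfolding pts_def mem_Collect_eq split eq r \<beta>_def[symmetric] \<beta>'_def[symmetric]
    by (simp add: distrib_left abs_diff_le_iff) linarith
qed

text \<open>Two points of a body that are congruent modulo \<open>P\<close> differ by a vector of
  this form. Division by \<open>P\<close> puts it into a body smaller by that factor, which controls
  the fibres in the sieve.\<close>

lemma pts_scale: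
  assumes "(int P * q, a, int P * b) \<in> pts \<tau> \<sigma> x f g A B \<delta>" "P > 0" "\<And>i. a $ i = int P * a' $ i"
  shows "(q, a', b) \<in> pts \<tau> \<sigma> x f g (A / P) (B / P) (\<delta> / P)"
proof -
  have a: "real_vec a = real P *\<^sub>R real_vec a'" using assms(3) by (simp add: vec_eq_iff)
  define \<beta> where "\<beta> = \<tau> *\<^sub>R real_vec a' - real_of_int q *\<^sub>R x"
  have 1: "\<tau> *\<^sub>R real_vec a - real_of_int (int P * q) *\<^sub>R x = real P *\<^sub>R \<beta>"
    by (simp add: a \<beta>_def algebra_simps)
  have 2: "\<sigma> * real_of_int (int P * b) - real_of_int (int P * q) * f - g \<bullet> (real P *\<^sub>R \<beta>)
     = real P * (\<sigma> * real_of_int b - real_of_int q * f - g \<bullet> \<beta>)"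
    by (simp add: algebra_simps)
  show ?thesis
    using assms(1,2) unfolding pts_def mem_Collect_eq split 1 2 \<beta>_def[symmetric]
    by (simp add: abs_mult pos_le_divide_eq mult.commute)
qed

lemma finite_int_vecs_bounded:
  fixes S :: "(int ^ 'k) set"
  assumes "finite S"
  obtains K where "\<And>p i. p \<in> S \<Longrightarrow> \<bar>p $ i\<bar> \<le> K"
proof
  fix p i assume p: "p \<in> S"
  have "\<bar>p $ i\<bar> \<le> (\<Sum>i\<in>UNIV. \<bar>p $ i\<bar>)" by (rule member_le_sum) auto
  also have "\<dots> \<le> (\<Sum>p\<in>S. \<Sum>i\<in>UNIV. \<bar>p $ i\<bar>)"
    using assms p by (intro member_le_sum) (auto intro: sum_nonneg)
  finally show "\<bar>p $ i\<bar> \<le> (\<Sum>p\<in>S. \<Sum>i\<in>UNIV. \<bar>p $ i\<bar>)" .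
qed

text \<open>\<open>large_sieve\<close> is applied with the dual body dilated by
  \<open>c = P / 24\<close> as \<open>V\<close>. The modulus is free: for large \<open>P\<close> the
  dilated body is wide in every direction and has at least a constant times its volume many points,
  whatever its shape, and the powers of \<open>P\<close> cancel at the end. Congruent points of
  \<open>V\<close> differ by \<open>P\<close> times a point of the undilated dual body, whose
  cardinality therefore serves as the multiplicity \<open>M\<close>.\<close>

lemma pts_transference:
  fixes x g :: "real ^ 'm"
  assumes pos: "\<tau> > 0" "\<sigma> > 0" "A > 0" "B > 0" "\<delta> > 0"
  shows "real (card (pts \<tau> \<sigma> x f g A B \<delta>)) \<le> 2 * 24 ^ (CARD('m) + 2) * real CARD('m) ^ CARD('m) *
    (A * B ^ CARD('m) * \<delta> / \<tau> ^ CARD('m)) *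
    real (card (pts (\<sigma> / \<tau>) \<sigma> g (x \<bullet> g - f) x (1 / \<delta>) (\<sigma> / B) (1 / A)))"
proof -
  let ?m = "real CARD('m)"
  define D where "D = pts (\<sigma> / \<tau>) \<sigma> g (x \<bullet> g - f) x (1 / \<delta>) (\<sigma> / B) (1 / A)"
  define S where "S = encode ` pts \<tau> \<sigma> x f g A B \<delta>"
  have m: "?m > 0" by simp
  have finD: "finite D" unfolding D_def using pos by (intro finite_pts) auto
  have finS: "finite S" unfolding S_def using pos by (intro finite_imageI finite_pts) auto
  obtain K where K: "\<And>p i. p \<in> S \<Longrightarrow> \<bar>p $ i\<bar> \<le> K" using finite_int_vecs_bounded[OF finS] by blast
  \<comment> \<open>Besides positivity these bounds ensure, in order:
    \<open>c \<ge> \<delta>\<close>; in the dilated dual body a radius of at least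
    \<open>CARD('m)\<close> times the mesh; \<open>c \<ge> A\<close>; and that distinct points of
    \<open>S\<close> stay distinct modulo \<open>P\<close>.\<close>
  obtain P :: nat where P': "real P > max 1 (max (24 * \<delta>) (max (24 * ?m * B / \<tau>) (max (24 * A) (real_of_int (2 * K)))))"
    using reals_Archimedean2 by blast
  then have P1: "P > 0" "real P > 24 * \<delta>" "real P > 24 * ?m * B / \<tau>" "real P > 24 * A" "real_of_int (2 * K) < real P"
    by (auto simp del: of_int_mult)
  have PK: "2 * K < int P" using P1(5) by linarith
  \<comment> \<open>24 = 3 * 8: the pairing is at most \<open>3 * c\<close> by
    \<open>dual_pairing_bound\<close>, and the sieve allows \<open>P / 8\<close>.\<close>
  define c where "c = real P / 24"
  have c0: "c > 0" using P1 by (simp add: c_def)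
  define V where "V = pts (\<sigma> / \<tau>) \<sigma> g (x \<bullet> g - f) x (c / \<delta>) (c * \<sigma> / B) (c / A)"
  \<comment> \<open>In the pairing \<open>q\<close> meets \<open>v\<close> and \<open>b\<close>
    meets \<open>j\<close>, so the outer coordinates trade places and \<open>u\<close> changes
    sign.\<close>
  define h where "h = (\<lambda>(j, u :: int ^ 'm, v). encode (v, - u, j))"
  have inj_h: "inj_on h V" by (auto simp: inj_on_def h_def encode_inject)
  have finV: "finite V" unfolding V_def using pos c0 by (intro finite_pts) auto
  have sieve: "real (card S) * real (card (h ` V)) \<le> 2 * real (card D) * real P ^ CARD('m option option)"
  proof (rule large_sieve)
    show "finite S" by fact
    show "finite (h ` V)" using finV by simp
    show "P > 0" by fact
  next
    fix p p' assume pp: "p \<in> S" "p' \<in> S" "\<forall>i. int P dvd (p - p') $ i"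
    have "p $ i = p' $ i" for i
    proof (rule ccontr)
      assume "p $ i \<noteq> p' $ i"
      then have "int P \<le> \<bar>p $ i - p' $ i\<bar>"
        using pp(3) dvd_imp_le_int[of "p $ i - p' $ i" "int P"] by simp
      then show False using K[OF pp(1), of i] K[OF pp(2), of i] PK by linarith
    qed
    then show "p = p'" by (simp add: vec_eq_iff)
  next
    fix p k assume "p \<in> S" "k \<in> h ` V"
    then obtain q a b j u v where p: "p = encode (q, a, b)" "(q, a, b) \<in> pts \<tau> \<sigma> x f g A B \<delta>"
      and k: "k = encode (v, - u, j)" "(j, u, v) \<in> V"
      by (auto simp: S_def h_def)
    show "\<bar>real_of_int (dotp p k)\<bar> \<le> real P / 8"
      using dual_pairing_bound[OF pos less_imp_le[OF c0] p(2) k(2)[unfolded V_def]]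
      unfolding p(1) k(1) dotp_encode by (simp add: c_def)
  next
    fix k assume "k \<in> h ` V"
    then obtain j u v where k: "k = encode (v, - u, j)" "(j, u, v) \<in> V" by (auto simp: h_def)
    \<comment> \<open>\<open>s\<close> rebuilds the points congruent to \<open>k\<close> from points
      of \<open>D\<close>: a difference has size \<open>2 * c\<close> relative to the dual body, and
      \<open>2 * c / P = 1 / 12 \<le> 1\<close>.\<close>
    define s where "s = (\<lambda>(j', u', v'). encode (v + int P * v', - u - (\<chi> i. int P * u' $ i), j + int P * j'))"
    have "{k' \<in> h ` V. \<forall>i. int P dvd (k' - k) $ i} \<subseteq> s ` D"
    proof
      fix k' assume "k' \<in> {k' \<in> h ` V. \<forall>i. int P dvd (k' - k) $ i}"
      then obtain j1 u1 v1 where k': "k' = encode (v1, - u1, j1)" "(j1, u1, v1) \<in> V"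
        and dvd: "\<forall>i. int P dvd (k' - k) $ i" by (auto simp: h_def)
      have d: "int P dvd v1 - v" "int P dvd j1 - j" "\<And>i. int P dvd u1 $ i - u $ i"
        using dvd unfolding k'(1) k(1) encode_diff all_option2 by (auto simp: dvd_diff_commute)
      obtain v' j' where vj: "v1 - v = int P * v'" "j1 - j = int P * j'" using d by (auto elim!: dvdE)
      obtain w where w: "\<And>i. u1 $ i - u $ i = int P * w i" using d(3) unfolding dvd_def by metis
      have "(j1 - j, u1 - u, v1 - v) \<in> pts (\<sigma> / \<tau>) \<sigma> g (x \<bullet> g - f) x (c / \<delta> + c / \<delta>) (c * \<sigma> / B + c * \<sigma> / B) (c / A + c / A)"
        using pts_diff k' k unfolding V_def by blast
      then have "(int P * j', u1 - u, int P * v') \<in> pts (\<sigma> / \<tau>) \<sigma> g (x \<bullet> g - f) x (c / \<delta> + c / \<delta>) (c * \<sigma> / B + c * \<sigma> / B) (c / A + c / A)"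
        unfolding vj .
      from pts_scale[OF this P1(1), of "\<chi> i. w i"]
      have "(j', (\<chi> i. w i), v') \<in> pts (\<sigma> / \<tau>) \<sigma> g (x \<bullet> g - f) x ((c / \<delta> + c / \<delta>) / P) ((c * \<sigma> / B + c * \<sigma> / B) / P) ((c / A + c / A) / P)"
        using w by simp
      moreover have "\<dots> \<subseteq> D"
        unfolding D_def using pos P1 by (intro pts_mono) (auto simp: c_def field_simps)
      ultimately have "(j', (\<chi> i. w i), v') \<in> D" by blast
      moreover have "k' = s (j', (\<chi> i. w i), v')"
      proof -
        have "v1 = v + int P * v'" "j1 = j + int P * j'" using vj by auto
        moreover have "- u1 = - u - (\<chi> i. int P * (\<chi> i. w i) $ i)" 
          by (simp add: vec_eq_iff w[symmetric])
        ultimately show ?thesis unfolding k'(1) s_def by simp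
      qed
      ultimately show "k' \<in> s ` D" by blast
    qed
    then have "card {k' \<in> h ` V. \<forall>i. int P dvd (k' - k) $ i} \<le> card (s ` D)"
      using finD by (intro card_mono) auto
    also have "\<dots> \<le> card D" using finD by (rule card_image_le)
    finally show "card {k' \<in> h ` V. \<forall>i. int P dvd (k' - k) $ i} \<le> card D" .
  qed
  have "real (card V) \<ge> (c / \<delta>) * (((c * \<sigma> / B) / (?m * (\<sigma> / \<tau>))) ^ CARD('m) * (c / A))"
    unfolding V_def
  proof (rule card_pts_ge)
    show "?m * (\<sigma> / \<tau>) \<le> c * \<sigma> / B" "1 \<le> c / \<delta>" "1 \<le> c / A"
      using P1 pos by (simp_all add: c_def field_simps)
  qed (use pos c0 in auto)
  also have "(c / \<delta>) * (((c * \<sigma> / B) / (?m * (\<sigma> / \<tau>))) ^ CARD('m) * (c / A)) =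
     c ^ (CARD('m) + 2) * (\<tau> ^ CARD('m) / (?m ^ CARD('m) * (A * B ^ CARD('m) * \<delta>)))"
    using pos m by (simp add: power_mult_distrib power_divide field_simps power2_eq_square)
  finally have Vge: "c ^ (CARD('m) + 2) * (\<tau> ^ CARD('m) / (?m ^ CARD('m) * (A * B ^ CARD('m) * \<delta>))) \<le> real (card V)" .
  have cS: "card S = card (pts \<tau> \<sigma> x f g A B \<delta>)"
    unfolding S_def by (rule card_image) (auto simp: inj_on_def encode_inject)
  have "real (card S) * (c ^ (CARD('m) + 2) * (\<tau> ^ CARD('m) / (?m ^ CARD('m) * (A * B ^ CARD('m) * \<delta>))))
     \<le> real (card S) * real (card V)"
    by (intro mult_left_mono Vge) auto
  also have "\<dots> \<le> 2 * real (card D) * real P ^ (CARD('m) + 2)"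
    using sieve card_image[OF inj_h] by simp
  also have "real P ^ (CARD('m) + 2) = 24 ^ (CARD('m) + 2) * c ^ (CARD('m) + 2)"
    by (simp add: c_def flip: power_mult_distrib)
  finally have "c ^ (CARD('m) + 2) * (real (card S) * (\<tau> ^ CARD('m) / (?m ^ CARD('m) * (A * B ^ CARD('m) * \<delta>))))
     \<le> c ^ (CARD('m) + 2) * (2 * real (card D) * 24 ^ (CARD('m) + 2))"
    by (simp only: mult_ac)
  then have "real (card S) * (\<tau> ^ CARD('m) / (?m ^ CARD('m) * (A * B ^ CARD('m) * \<delta>))) \<le> 2 * real (card D) * 24 ^ (CARD('m) + 2)"
    by (rule mult_left_le_imp_le) (use c0 in simp)
  then have "real (card S) \<le> 2 * real (card D) * 24 ^ (CARD('m) + 2) / (\<tau> ^ CARD('m) / (?m ^ CARD('m) * (A * B ^ CARD('m) * \<delta>)))"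
    using pos m by (subst pos_le_divide_eq) auto
  also have "\<dots> = 2 * 24 ^ (CARD('m) + 2) * ?m ^ CARD('m) * (A * B ^ CARD('m) * \<delta> / \<tau> ^ CARD('m)) * real (card D)"
    by simp
  finally show ?thesis unfolding cS D_def .
qed

text \<open>A bound of Minkowski type that holds even when the body is very thin in the last
  direction. Each \<open>(q, a)\<close> with \<open>0 \<le> q \<le> A\<close> and \<open>a\<close>
  in the ball of half the radius predicts a real number \<open>y\<close> that \<open>b\<close>
  should approximate. The fractional parts of \<open>y\<close> fall into at most
  \<open>2 / \<delta>\<close> cells of length \<delta>, and differences with one fixed pair in the
  fullest cell lie in the body.\<close>

lemma card_pts_pigeonhole:
  fixes x g :: "real ^ 'm"
  assumes pos: "\<tau> > 0" "\<sigma> > 0" "A \<ge> 1" "B \<ge> 4 * real CARD('m) * \<tau>" "0 < \<delta>" "\<delta> \<le> 1"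
  shows "real (card (pts \<tau> \<sigma> x f g A B \<delta>)) \<ge> (A / 2) * (B / (2 * real CARD('m) * \<tau>)) ^ CARD('m) * (\<delta> / 2)"
proof -
  let ?m = "real CARD('m)"
  have m: "?m \<ge> 1" using one_le_card_finite[where 'a = 'm] by linarith
  have B: "B > 0" by (rule less_le_trans[OF _ pos(4)]) (use pos m in simp)
  define As where "As q = {a. norm (\<tau> *\<^sub>R real_vec a - real_of_int q *\<^sub>R x) \<le> B / 2}" for q :: int
  define Z where "Z = (SIGMA q:{0..\<lfloor>A\<rfloor>}. As q)"
  have fA: "finite (As q)" for q unfolding As_def using pos B by (intro finite_lattice_ball) auto
  have finZ: "finite Z" unfolding Z_def by (intro finite_SigmaI fA) auto
  have "real (card Z) = (\<Sum>q\<in>{0..\<lfloor>A\<rfloor>}. real (card (As q)))"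
    unfolding Z_def using card_SigmaI[of "{0..\<lfloor>A\<rfloor>}" As] fA by simp
  also have "\<dots> \<ge> real (card {0..\<lfloor>A\<rfloor>}) * (B / 2 / (?m * \<tau>)) ^ CARD('m)"
    unfolding As_def using pos B by (intro sum_real_ge_card card_lattice_ball_ge) (auto simp: field_simps)
  also have "real (card {0..\<lfloor>A\<rfloor>}) * (B / 2 / (?m * \<tau>)) ^ CARD('m) \<ge> A * (B / 2 / (?m * \<tau>)) ^ CARD('m)"
  proof (rule mult_right_mono)
    have "real (card {0..\<lfloor>A\<rfloor>}) = real_of_int (\<lfloor>A\<rfloor> + 1)" using pos by simp
    then show "A \<le> real (card {0..\<lfloor>A\<rfloor>})" by linarith
  qed (use pos B in simp)
  finally have cZ: "A * (B / 2 / (?m * \<tau>)) ^ CARD('m) \<le> real (card Z)" .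
  define y where "y = (\<lambda>(q :: int, a). (real_of_int q * f + g \<bullet> (\<tau> *\<^sub>R real_vec a - real_of_int q *\<^sub>R x)) / \<sigma>)"
  define h where "h z = \<lfloor>frac (y z) / \<delta>\<rfloor>" for z
  define H where "H = {0..\<lfloor>1 / \<delta>\<rfloor>}"
  have hH: "h z \<in> H" for z
    using pos frac_lt_1[of "y z"] frac_ge_0[of "y z"]
    by (auto simp: h_def H_def intro!: floor_mono divide_right_mono)
  have cH: "real (card H) \<le> 2 / \<delta>" "H \<noteq> {}"
  proof -
    have "1 \<le> 1 / \<delta>" using pos by simp
    then have "real (card H) = real_of_int (\<lfloor>1 / \<delta>\<rfloor> + 1)" "H \<noteq> {}" unfolding H_def using pos by auto
    moreover have "2 / \<delta> = 1 / \<delta> + 1 / \<delta>" by simp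
    ultimately show "real (card H) \<le> 2 / \<delta>" "H \<noteq> {}" using \<open>1 \<le> 1 / \<delta>\<close> by linarith+
  qed
  have "\<exists>e\<in>H. real (card {z \<in> Z. h z = e}) \<ge> real (card Z) / real (card H)"
  proof (rule ccontr)
    assume neg: "\<not> ?thesis"
    have fH: "finite H" by (simp add: H_def)
    have "real (card Z) = (\<Sum>e\<in>H. real (card {z \<in> Z. h z = e}))"
    proof -
      have "h ` Z \<subseteq> H" using hH by blast
      from sum.group[OF finZ fH this, of "\<lambda>_. 1 :: real"] show ?thesis by simp
    qed
    also have "\<dots> < (\<Sum>e\<in>H. real (card Z) / real (card H))"
      using neg fH cH by (intro sum_strict_mono) (auto simp: not_le)
    also have "\<dots> = real (card Z)" using fH cH by simp
    finally show False by simp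
  qed
  then obtain e where e: "real (card {z \<in> Z. h z = e}) \<ge> real (card Z) / real (card H)" by blast
  define F where "F = {z \<in> Z. h z = e}"
  have "real (card Z) / real (card H) \<ge> (A * (B / 2 / (?m * \<tau>)) ^ CARD('m)) / (2 / \<delta>)"
  proof (rule frac_le)
    have "finite H" by (simp add: H_def)
    then show "0 < real (card H)" using cH(2) by (simp add: card_gt_0_iff)
  qed (use cZ cH in auto)
  then have cF: "real (card F) \<ge> (A * (B / 2 / (?m * \<tau>)) ^ CARD('m)) / (2 / \<delta>)"
    using e unfolding F_def by linarith
  have "0 < (A * (B / 2 / (?m * \<tau>)) ^ CARD('m)) / (2 / \<delta>)"
    using pos B m by simp
  then have "F \<noteq> {}" using cF by auto
  then obtain z0 where z0: "z0 \<in> F" by blast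
  \<comment> \<open>The third coordinate is the difference of the floors of \<open>y\<close>; its
    error is the difference of the fractional parts, at most \<delta> within one cell.\<close>
  define s where "s = (\<lambda>z. (fst z - fst z0, snd z - snd z0, \<lfloor>y z\<rfloor> - \<lfloor>y z0\<rfloor>))"
  have "s ` F \<subseteq> pts \<tau> \<sigma> x f g A B \<delta>"
  proof
    fix p assume "p \<in> s ` F"
    then obtain q a where z: "(q, a) \<in> F" and p: "p = s (q, a)" by auto
    obtain q0 a0 where z0e: "z0 = (q0, a0)" by (cases z0)
    have q: "0 \<le> q" "q \<le> \<lfloor>A\<rfloor>" "0 \<le> q0" "q0 \<le> \<lfloor>A\<rfloor>" and a: "a \<in> As q" "a0 \<in> As q0"
      using z z0 by (auto simp: F_def Z_def z0e)
    define \<beta> where "\<beta> = \<tau> *\<^sub>R real_vec a - real_of_int q *\<^sub>R x"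
    define \<beta>0 where "\<beta>0 = \<tau> *\<^sub>R real_vec a0 - real_of_int q0 *\<^sub>R x"
    have eq: "\<tau> *\<^sub>R real_vec (a - a0) - real_of_int (q - q0) *\<^sub>R x = \<beta> - \<beta>0"
      by (simp add: \<beta>_def \<beta>0_def real_vec_diff algebra_simps)
    have "norm (\<beta> - \<beta>0) \<le> B"
      using norm_triangle_ineq4[of \<beta> \<beta>0] a by (simp add: As_def \<beta>_def \<beta>0_def)
    moreover have "\<bar>real_of_int (q - q0)\<bar> \<le> A"
      using q by linarith
    moreover have "\<bar>frac (y (q, a)) / \<delta> - frac (y z0) / \<delta>\<bar> \<le> 1"
    proof -
      have "\<lfloor>frac (y (q, a)) / \<delta>\<rfloor> = \<lfloor>frac (y z0) / \<delta>\<rfloor>" using z z0 by (auto simp: F_def h_def)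
      then show ?thesis by linarith
    qed
    then have "\<bar>frac (y (q, a)) - frac (y z0)\<bar> \<le> \<delta>"
      using pos by (simp add: abs_le_iff field_simps)
    then have "\<bar>real_of_int (\<lfloor>y (q, a)\<rfloor> - \<lfloor>y z0\<rfloor>) - (y (q, a) - y z0)\<bar> \<le> \<delta>"
      by (simp add: frac_def abs_le_iff)
    then have "\<sigma> * \<bar>real_of_int (\<lfloor>y (q, a)\<rfloor> - \<lfloor>y z0\<rfloor>) - (y (q, a) - y z0)\<bar> \<le> \<sigma> * \<delta>"
      using pos by (intro mult_left_mono) auto
    moreover have "\<sigma> * real_of_int (\<lfloor>y (q, a)\<rfloor> - \<lfloor>y z0\<rfloor>) - real_of_int (q - q0) * f - g \<bullet> (\<beta> - \<beta>0)
       = \<sigma> * (real_of_int (\<lfloor>y (q, a)\<rfloor> - \<lfloor>y z0\<rfloor>) - (y (q, a) - y z0))"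
    proof -
      have "\<sigma> * y (q, a) = real_of_int q * f + g \<bullet> \<beta>" "\<sigma> * y z0 = real_of_int q0 * f + g \<bullet> \<beta>0"
        using pos by (simp_all add: y_def z0e \<beta>_def \<beta>0_def)
      then show ?thesis by (simp add: inner_diff_right right_diff_distrib left_diff_distrib)
    qed
    ultimately show "p \<in> pts \<tau> \<sigma> x f g A B \<delta>"
      unfolding p using pos by (simp add: s_def pts_def z0e eq[unfolded of_int_diff] abs_mult)
  qed
  moreover have "inj_on s F" by (auto simp: inj_on_def s_def prod_eq_iff)
  moreover have "finite (pts \<tau> \<sigma> x f g A B \<delta>)" using pos B by (intro finite_pts) auto
  ultimately have "card F \<le> card (pts \<tau> \<sigma> x f g A B \<delta>)" by (metis card_image card_mono)
  then show ?thesis using cF by (simp add: field_simps)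
qed

section \<open>Nondegenerate configurations\<close>

text \<open>A function on an arbitrary set of points \<open>X c\<close>, with values \<open>F c\<close> and gradients \<open>G c\<close>. Taking an
  abstract index set keeps the definition invariant under the Legendre transform.\<close>

definition nondeg :: "real \<Rightarrow> 'c set \<Rightarrow> ('c \<Rightarrow> real ^ 'm) \<Rightarrow> ('c \<Rightarrow> real) \<Rightarrow> ('c \<Rightarrow> real ^ 'm) \<Rightarrow> bool" where
  "nondeg L I X F G \<longleftrightarrow> L \<ge> 1 \<and>
     (\<forall>c\<in>I. norm (X c) \<le> L \<and> 1 \<le> L * norm (X c) \<and> norm (G c) \<le> L \<and> 1 \<le> L * norm (G c)) \<and>
     (\<forall>c\<in>I. \<forall>c'\<in>I. \<bar>F c' - F c - G c \<bullet> (X c' - X c)\<bar> \<le> L * norm (X c' - X c) * norm (G c' - G c) \<and>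
        norm (G c' - G c) \<le> L * norm (X c' - X c) \<and> norm (X c' - X c) \<le> L * norm (G c' - G c))"

lemma nondegD:
  assumes "nondeg L I X F G"
  shows "L \<ge> 1"
    and "c \<in> I \<Longrightarrow> norm (X c) \<le> L" "c \<in> I \<Longrightarrow> 1 \<le> L * norm (X c)"
    and "c \<in> I \<Longrightarrow> norm (G c) \<le> L" "c \<in> I \<Longrightarrow> 1 \<le> L * norm (G c)"
    and "c \<in> I \<Longrightarrow> c' \<in> I \<Longrightarrow> \<bar>F c' - F c - G c \<bullet> (X c' - X c)\<bar> \<le> L * norm (X c' - X c) * norm (G c' - G c)"
    and "c \<in> I \<Longrightarrow> c' \<in> I \<Longrightarrow> norm (G c' - G c) \<le> L * norm (X c' - X c)"
    and "c \<in> I \<Longrightarrow> c' \<in> I \<Longrightarrow> norm (X c' - X c) \<le> L * norm (G c' - G c)"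
  using assms unfolding nondeg_def by blast+

text \<open>The Taylor remainder of the Legendre transform from \<open>c\<close> to
  \<open>c'\<close> is the remainder of \<open>F\<close> from \<open>c'\<close> to \<open>c\<close>.
  In \<open>nondeg\<close> it is bounded by the product of the two increments, not by the square of
  one of them, so that the bound survives the exchange of \<open>X\<close> and
  \<open>G\<close>.\<close>

lemma nondeg_dual:
  assumes "nondeg L I X F G"
  shows "nondeg L I G (\<lambda>c. X c \<bullet> G c - F c) X"
proof -
  have "\<bar>(X c' \<bullet> G c' - F c') - (X c \<bullet> G c - F c) - X c \<bullet> (G c' - G c)\<bar> \<le> L * norm (G c' - G c) * norm (X c' - X c)"
    if "c \<in> I" "c' \<in> I" for c c'
  proof -
    have "(X c' \<bullet> G c' - F c') - (X c \<bullet> G c - F c) - X c \<bullet> (G c' - G c) = F c - F c' - G c' \<bullet> (X c - X c')"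
      by (simp add: inner_diff_right inner_commute)
    then show ?thesis
      using nondegD(6)[OF assms that(2,1)] by (simp add: norm_minus_commute mult_ac)
  qed
  then show ?thesis using assms unfolding nondeg_def by blast
qed

text \<open>Moving the base point costs \<open>q\<close> times a Taylor remainder plus the change of
  gradient paired with the displacement. For \<open>d\<close> of order \<open>B / Q\<close> and
  \<open>T\<close> of order \<open>Q\<close> both are of order \<open>B^2 / Q\<close>, which matches
  the tolerance \<open>\<sigma> * \<delta>\<close> when
  \<open>B^2 = Q * \<sigma> * \<delta>\<close>. This is where the size of \<open>B\<close> used
  later comes from.\<close>

lemma residual_change:
  assumes "nondeg L I X F G" "c \<in> I" "c' \<in> I" "norm (X c' - X c) \<le> d" "norm (z - q *\<^sub>R X c) \<le> B" "\<bar>q\<bar> \<le> T"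
  shows "\<bar>(w - q * F c' - G c' \<bullet> (z - q *\<^sub>R X c')) - (w - q * F c - G c \<bullet> (z - q *\<^sub>R X c))\<bar> \<le> T * L\<^sup>2 * d\<^sup>2 + L * d * B"
proof -
  note nd = nondegD[OF assms(1)]
  have L: "L \<ge> 1" by (rule nd(1))
  have d0: "0 \<le> d" "0 \<le> B" "0 \<le> T" using assms(4-6) norm_ge_zero order_trans abs_ge_zero by metis+
  have eq: "(w - q * F c' - G c' \<bullet> (z - q *\<^sub>R X c')) - (w - q * F c - G c \<bullet> (z - q *\<^sub>R X c))
      = q * (F c - F c' - G c' \<bullet> (X c - X c')) - (G c' - G c) \<bullet> (z - q *\<^sub>R X c)"
    by (simp add: inner_diff_right inner_diff_left algebra_simps)
  have g: "norm (G c' - G c) \<le> L * d"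
    using nd(7)[OF assms(2,3)] assms(4) L by (meson mult_left_mono order_trans zero_le_one)
  have "\<bar>F c - F c' - G c' \<bullet> (X c - X c')\<bar> \<le> L * norm (X c - X c') * norm (G c - G c')"
    by (rule nd(6)[OF assms(3,2)])
  also have "\<dots> \<le> L * d * (L * d)"
    using g assms(4) L d0 by (intro mult_mono) (auto simp: norm_minus_commute)
  finally have t: "\<bar>F c - F c' - G c' \<bullet> (X c - X c')\<bar> \<le> L * d * (L * d)" .
  have 1: "\<bar>q * (F c - F c' - G c' \<bullet> (X c - X c'))\<bar> \<le> T * (L * d * (L * d))"
    unfolding abs_mult using t assms(6) d0 by (intro mult_mono) auto
  have "norm (G c' - G c) * norm (z - q *\<^sub>R X c) \<le> (L * d) * B"
    using g assms(5) L d0 by (intro mult_mono) auto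
  then have 2: "\<bar>(G c' - G c) \<bullet> (z - q *\<^sub>R X c)\<bar> \<le> L * d * B"
    using Cauchy_Schwarz_ineq2[of "G c' - G c" "z - q *\<^sub>R X c"] by linarith
  have "T * (L * d * (L * d)) = T * L\<^sup>2 * d\<^sup>2" by (simp add: power2_eq_square)
  then show ?thesis unfolding eq using 1 2 by linarith
qed

text \<open>One dyadic range of \<open>|q|\<close> for all base points together; a triple seen from
  several base points is counted once. As \<open>|q| \<ge> Q\<close>, the triple locates
  \<open>X c\<close> to within \<open>B / Q\<close>.\<close>

definition near_pts :: "real \<Rightarrow> real \<Rightarrow> 'c set \<Rightarrow> ('c \<Rightarrow> real ^ 'm) \<Rightarrow> ('c \<Rightarrow> real) \<Rightarrow> ('c \<Rightarrow> real ^ 'm) \<Rightarrow>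
    real \<Rightarrow> real \<Rightarrow> real \<Rightarrow> (int \<times> (int ^ 'm) \<times> int) set" where
  "near_pts \<tau> \<sigma> I X F G Q B \<delta> = {p. Q \<le> \<bar>real_of_int (fst p)\<bar> \<and> \<bar>real_of_int (fst p)\<bar> < 2 * Q \<and>
     (\<exists>c\<in>I. p \<in> pts \<tau> \<sigma> (X c) (F c) (G c) (2 * Q) B \<delta>)}"

lemma near_pts_mono:
  assumes "B \<le> B'" "\<delta> \<le> \<delta>'" "\<sigma> > 0"
  shows "near_pts \<tau> \<sigma> I X F G Q B \<delta> \<subseteq> near_pts \<tau> \<sigma> I X F G Q B' \<delta>'"
  unfolding near_pts_def using pts_mono[OF order_refl assms] by blast

lemma card_Sigma2_le:
  fixes \<beta> \<gamma> :: real
  assumes "finite A" "\<And>q. q \<in> A \<Longrightarrow> finite (B q) \<and> real (card (B q)) \<le> \<beta>"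
    "\<And>q a. q \<in> A \<Longrightarrow> a \<in> B q \<Longrightarrow> finite (C q a) \<and> real (card (C q a)) \<le> \<gamma>" "\<gamma> \<ge> 0"
  shows "finite (SIGMA q:A. SIGMA a:B q. C q a)"
    and "real (card (SIGMA q:A. SIGMA a:B q. C q a)) \<le> real (card A) * (\<beta> * \<gamma>)"
proof -
  have fin: "finite (Sigma (B q) (C q))" if "q \<in> A" for q
    using assms that by (intro finite_SigmaI) auto
  show "finite (SIGMA q:A. SIGMA a:B q. C q a)" by (rule finite_SigmaI[OF assms(1) fin])
  have "real (card (Sigma (B q) (C q))) \<le> \<beta> * \<gamma>" if "q \<in> A" for q
  proof -
    have "real (card (Sigma (B q) (C q))) = (\<Sum>a\<in>B q. real (card (C q a)))"
      using assms that by (subst card_SigmaI) auto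
    also have "\<dots> \<le> real (card (B q)) * \<gamma>" using assms that by (intro sum_real_le_card) auto
    also have "\<dots> \<le> \<beta> * \<gamma>" using assms that by (intro mult_right_mono) auto
    finally show ?thesis .
  qed
  moreover have "real (card (SIGMA q:A. SIGMA a:B q. C q a)) = (\<Sum>q\<in>A. real (card (Sigma (B q) (C q))))"
    using assms(1) fin by (subst card_SigmaI) auto
  ultimately show "real (card (SIGMA q:A. SIGMA a:B q. C q a)) \<le> real (card A) * (\<beta> * \<gamma>)"
    using sum_real_le_card[of A "\<lambda>q. real (card (Sigma (B q) (C q)))"] by simp
qed

lemma norm_real_vec_ge_1:
  assumes "a \<noteq> 0" shows "norm (real_vec a) \<ge> 1"
proof -
  obtain i where "a $ i \<noteq> 0" using assms by (auto simp: vec_eq_iff)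
  then have "1 \<le> \<bar>real_vec a $ i\<bar>" by simp
  also have "\<dots> \<le> norm (real_vec a)" by (rule component_le_norm_cart)
  finally show ?thesis .
qed

text \<open>\<open>q\<close> and \<open>a\<close> are counted freely. Two values of \<open>b\<close>
  over the same \<open>(q, a)\<close> differ by O(L^2) by \<open>residual_change\<close>, since both
  base points are within \<open>B / |q|\<close> of the same point. The constants are
  \<open>5 * Q\<close> for \<open>q\<close>, \<open>9 * L * Q / \<tau>\<close> for each coordinate
  of \<open>a\<close>, and \<open>17 * L^2\<close> for \<open>b\<close>, with 85 = 5 * 17.\<close>

lemma near_pts_trivial:
  fixes X :: "'c \<Rightarrow> real ^ 'm"
  assumes nd: "nondeg L I X F G" and pos: "\<tau> > 0" "\<sigma> > 0" "Q \<ge> 1" "B > 0" "2 * L * B \<le> Q"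
    and B2: "B\<^sup>2 \<le> Q * \<sigma> * \<delta>" and \<delta>: "0 < \<delta>" "\<delta> \<le> 1"
  shows "finite (near_pts \<tau> \<sigma> I X F G Q B \<delta>)"
    and "real (card (near_pts \<tau> \<sigma> I X F G Q B \<delta>)) \<le> 85 * L\<^sup>2 * (9 * L) ^ CARD('m) * Q ^ (CARD('m) + 1) / \<tau> ^ CARD('m)"
proof -
  note n = nondegD[OF nd]
  have L: "L \<ge> 1" by (rule n(1))
  define S where "S = near_pts \<tau> \<sigma> I X F G Q B \<delta>"
  have mem: "\<exists>c\<in>I. Q \<le> \<bar>real_of_int q\<bar> \<and> \<bar>real_of_int q\<bar> < 2 * Q \<and> norm (\<tau> *\<^sub>R real_vec a - real_of_int q *\<^sub>R X c) \<le> B \<and>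
      \<bar>\<sigma> * real_of_int b - real_of_int q * F c - G c \<bullet> (\<tau> *\<^sub>R real_vec a - real_of_int q *\<^sub>R X c)\<bar> \<le> \<sigma> * \<delta>"
    if "(q, a, b) \<in> S" for q a b
    using that unfolding S_def near_pts_def pts_def by auto
  have BQ: "B \<le> Q" using pos(4,5) L mult_right_mono[of 1 "2 * L" B] by linarith
  have a_bound: "norm (\<tau> *\<^sub>R real_vec a) \<le> 3 * L * Q \<and> \<tau> \<le> 3 * L * Q" if p: "(q, a, b) \<in> S" for q a b
  proof -
    from mem[OF p] obtain c where c: "c \<in> I" "Q \<le> \<bar>real_of_int q\<bar>" "\<bar>real_of_int q\<bar> < 2 * Q"
      "norm (\<tau> *\<^sub>R real_vec a - real_of_int q *\<^sub>R X c) \<le> B" by blast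
    have 1: "norm (real_of_int q *\<^sub>R X c) \<le> 2 * Q * L"
      using c n(2)[OF c(1)] by (simp add: mult_mono)
    have "norm (\<tau> *\<^sub>R real_vec a) \<le> norm (real_of_int q *\<^sub>R X c) + norm (\<tau> *\<^sub>R real_vec a - real_of_int q *\<^sub>R X c)"
      by (metis add.commute diff_add_cancel norm_triangle_ineq)
    also have "\<dots> \<le> 2 * Q * L + Q" using 1 c BQ by linarith
    also have "\<dots> \<le> 3 * L * Q" using L pos(3) mult_right_mono[of 1 L Q] by (simp add: mult_ac)
    finally have 2: "norm (\<tau> *\<^sub>R real_vec a) \<le> 3 * L * Q" .
    \<comment> \<open>\<open>a = 0\<close> would give \<open>Q \<le> L * B\<close>. A nonzero
      \<open>a\<close> forces \<open>\<tau> \<le> 3 * L * Q\<close>, so the additive 1 in the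
      lattice count is absorbed.\<close>
    have "a \<noteq> 0"
    proof
      assume "a = 0"
      then have "norm (real_of_int q *\<^sub>R X c) \<le> B" using c(4) by (simp add: real_vec_def zero_vec_def[symmetric])
      then have "\<bar>real_of_int q\<bar> * norm (X c) \<le> B" by simp
      then have "\<bar>real_of_int q\<bar> * (L * norm (X c)) \<le> L * B" using L by (simp add: mult_left_mono mult.left_commute)
      moreover have "Q * 1 \<le> \<bar>real_of_int q\<bar> * (L * norm (X c))"
        using c n(3)[OF c(1)] pos by (intro mult_mono) auto
      moreover have "0 < L * B" using pos L by simp
      ultimately show False using pos(5) by linarith
    qed
    from norm_real_vec_ge_1[OF this] have "\<tau> \<le> norm (\<tau> *\<^sub>R real_vec a)" using pos by simp
    with 2 show ?thesis by linarith
  qed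
  have b_bound: "\<bar>real_of_int b - real_of_int b0\<bar> \<le> 8 * L\<^sup>2" if p: "(q, a, b) \<in> S" "(q, a, b0) \<in> S" for q a b b0
  proof -
    from mem[OF p(1)] obtain c where c: "c \<in> I" "Q \<le> \<bar>real_of_int q\<bar>" 
      "norm (\<tau> *\<^sub>R real_vec a - real_of_int q *\<^sub>R X c) \<le> B"
      "\<bar>\<sigma> * real_of_int b - real_of_int q * F c - G c \<bullet> (\<tau> *\<^sub>R real_vec a - real_of_int q *\<^sub>R X c)\<bar> \<le> \<sigma> * \<delta>" by blast
    from mem[OF p(2)] obtain c0 where c0: "c0 \<in> I"
      "norm (\<tau> *\<^sub>R real_vec a - real_of_int q *\<^sub>R X c0) \<le> B"
      "\<bar>\<sigma> * real_of_int b0 - real_of_int q * F c0 - G c0 \<bullet> (\<tau> *\<^sub>R real_vec a - real_of_int q *\<^sub>R X c0)\<bar> \<le> \<sigma> * \<delta>" by blast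
    define q' where "q' = \<bar>real_of_int q\<bar>"
    have q': "q' \<ge> Q" "q' > 0" using c pos by (auto simp: q'_def)
    have "norm (real_of_int q *\<^sub>R (X c0 - X c)) \<le> 2 * B"
    proof -
      have "real_of_int q *\<^sub>R (X c0 - X c) = (\<tau> *\<^sub>R real_vec a - real_of_int q *\<^sub>R X c) - (\<tau> *\<^sub>R real_vec a - real_of_int q *\<^sub>R X c0)"
        by (simp add: algebra_simps)
      then have "norm (real_of_int q *\<^sub>R (X c0 - X c)) \<le> norm (\<tau> *\<^sub>R real_vec a - real_of_int q *\<^sub>R X c) + norm (\<tau> *\<^sub>R real_vec a - real_of_int q *\<^sub>R X c0)"
        by (metis norm_triangle_ineq4)
      then show ?thesis using c(3) c0(2) by linarith
    qed
    then have "q' * norm (X c0 - X c) \<le> 2 * B" unfolding norm_scaleR q'_def .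
    then have d: "norm (X c0 - X c) \<le> 2 * B / q'"
      using q' by (simp add: pos_le_divide_eq mult.commute)
    have "\<bar>(\<sigma> * b - q * F c0 - G c0 \<bullet> (\<tau> *\<^sub>R real_vec a - real_of_int q *\<^sub>R X c0)) - (\<sigma> * b - q * F c - G c \<bullet> (\<tau> *\<^sub>R real_vec a - real_of_int q *\<^sub>R X c))\<bar>
      \<le> q' * L\<^sup>2 * (2 * B / q')\<^sup>2 + L * (2 * B / q') * B"
      by (rule residual_change[OF nd c(1) c0(1) d c(3)]) (simp add: q'_def)
    also have "\<dots> = (4 * L\<^sup>2 + 2 * L) * (B\<^sup>2 / q')"
      using q' by (simp add: field_simps power2_eq_square)
    also have "\<dots> \<le> (6 * L\<^sup>2) * (\<sigma> * \<delta>)"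
    proof (rule mult_mono)
      show "4 * L\<^sup>2 + 2 * L \<le> 6 * L\<^sup>2" using L by (simp add: power2_eq_square)
      have "B\<^sup>2 / q' \<le> (Q * \<sigma> * \<delta>) / Q" using B2 q' pos \<delta> by (intro frac_le) auto
      then show "B\<^sup>2 / q' \<le> \<sigma> * \<delta>" using pos by simp
    qed (use q' in auto)
    finally have "\<bar>\<sigma> * b - \<sigma> * b0\<bar> \<le> 8 * L\<^sup>2 * (\<sigma> * \<delta>)"
    proof -
      assume a1: "\<bar>(\<sigma> * b - q * F c0 - G c0 \<bullet> (\<tau> *\<^sub>R real_vec a - real_of_int q *\<^sub>R X c0)) - (\<sigma> * b - q * F c - G c \<bullet> (\<tau> *\<^sub>R real_vec a - real_of_int q *\<^sub>R X c))\<bar> \<le> (6 * L\<^sup>2) * (\<sigma> * \<delta>)"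
      have "1 \<le> L\<^sup>2" using L by simp
      then have "\<sigma> * \<delta> \<le> L\<^sup>2 * (\<sigma> * \<delta>)" using pos \<delta> by simp
      then show ?thesis using a1 c(4) c0(3) by linarith
    qed
    also have "8 * L\<^sup>2 * (\<sigma> * \<delta>) \<le> 8 * L\<^sup>2 * (\<sigma> * 1)" using \<delta> pos by (intro mult_left_mono) auto
    finally have "\<sigma> * \<bar>real_of_int b - real_of_int b0\<bar> \<le> \<sigma> * (8 * L\<^sup>2)"
      using pos by (simp add: abs_mult right_diff_distrib[symmetric] mult_ac)
    then show ?thesis using pos by simp
  qed
  define Qs where "Qs = {q. \<bar>real_of_int q - 0\<bar> \<le> 2 * Q}"
  define As where "As = {a :: int ^ 'm. norm (\<tau> *\<^sub>R real_vec a - 0) \<le> 3 * L * Q}"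
  define Bs where "Bs q a = {b. (q, a, b) \<in> S}" for q a
  have Bs: "finite (Bs q a) \<and> real (card (Bs q a)) \<le> 17 * L\<^sup>2" for q a
  proof (cases "Bs q a = {}")
    case False
    then obtain b0 where b0: "(q, a, b0) \<in> S" by (auto simp: Bs_def)
    have sub: "Bs q a \<subseteq> {b. \<bar>real_of_int b - real_of_int b0\<bar> \<le> 8 * L\<^sup>2}"
      using b_bound b0 by (auto simp: Bs_def)
    have L2: "1 \<le> L\<^sup>2" using L by simp
    have fin: "finite {b. \<bar>real_of_int b - real_of_int b0\<bar> \<le> 8 * L\<^sup>2}" by (rule card_int_interval(1)) simp
    have "real (card (Bs q a)) \<le> real (card {b. \<bar>real_of_int b - real_of_int b0\<bar> \<le> 8 * L\<^sup>2})"
      using card_mono[OF fin sub] by simp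
    also have "\<dots> \<le> 2 * (8 * L\<^sup>2) + 1" by (rule card_int_interval(2)) simp
    finally show ?thesis using L2 finite_subset[OF sub fin] by auto
  qed auto
  have sub: "S \<subseteq> (SIGMA q:Qs. SIGMA a:As. Bs q a)"
  proof
    fix p assume p: "p \<in> S"
    obtain q a b where pe: "p = (q, a, b)" by (cases p)
    have "\<bar>real_of_int q\<bar> \<le> 2 * Q" using mem[of q a b] p unfolding pe by fastforce
    then show "p \<in> (SIGMA q:Qs. SIGMA a:As. Bs q a)"
      using p a_bound[of q a b] unfolding pe by (auto simp: Qs_def As_def Bs_def)
  qed
  have finQ: "finite Qs" unfolding Qs_def using pos by (intro card_int_interval) auto
  have finA: "finite As" unfolding As_def using pos L by (intro finite_lattice_ball) auto
  note big = card_Sigma2_le[of Qs "\<lambda>_. As" "real (card As)" Bs "17 * L\<^sup>2", OF finQ conjI[OF finA order_refl] Bs]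
  have finS: "finite S" by (rule finite_subset[OF sub big(1)]) simp
  show "finite (near_pts \<tau> \<sigma> I X F G Q B \<delta>)" using finS unfolding S_def .
  have "real (card S) \<le> 85 * L\<^sup>2 * (9 * L) ^ CARD('m) * Q ^ (CARD('m) + 1) / \<tau> ^ CARD('m)"
  proof (cases "S = {}")
    case True
    then show ?thesis using pos L by simp
  next
    case False
    then obtain q a b where "(q, a, b) \<in> S" by (metis ex_in_conv surj_pair)
    from a_bound[OF this] have \<tau>: "\<tau> \<le> 3 * L * Q" by simp
    have "real (card S) \<le> real (card Qs) * (real (card As) * (17 * L\<^sup>2))"
      using card_mono[OF big(1) sub] big(2) by simp
    also have "real (card Qs) \<le> 5 * Q"
      using card_int_interval(2)[of "2 * Q" 0] pos unfolding Qs_def by linarith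
    also have "real (card As) \<le> (9 * L * Q / \<tau>) ^ CARD('m)"
    proof -
      have "real (card As) \<le> (2 * (3 * L * Q) / \<tau> + 1) ^ CARD('m)"
        unfolding As_def using pos L by (intro card_lattice_ball_le) auto
      also have "\<dots> \<le> (9 * L * Q / \<tau>) ^ CARD('m)"
        using pos L \<tau> by (intro power_mono) (auto simp: field_simps)
      finally show ?thesis .
    qed
    finally have "real (card S) \<le> (5 * Q) * ((9 * L * Q / \<tau>) ^ CARD('m) * (17 * L\<^sup>2))"
      using pos L by (simp add: mult_right_mono mult_left_mono)
    then show ?thesis by (simp add: power_divide power_mult_distrib mult_ac)
  qed
  then show "real (card (near_pts \<tau> \<sigma> I X F G Q B \<delta>)) \<le> 85 * L\<^sup>2 * (9 * L) ^ CARD('m) * Q ^ (CARD('m) + 1) / \<tau> ^ CARD('m)"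
    unfolding S_def .
qed

section \<open>Nets of base points and sums over a net\<close>

definition sparse_net :: "real \<Rightarrow> real \<Rightarrow> 'c set \<Rightarrow> ('c \<Rightarrow> real ^ 'm) \<Rightarrow> bool" where
  "sparse_net \<Lambda> r R X \<longleftrightarrow> finite R \<and> (\<forall>y \<rho>. \<rho> \<ge> r \<longrightarrow> real (card {c \<in> R. norm (X c - y) \<le> \<rho>}) \<le> \<Lambda> * (\<rho> / r) ^ CARD('m))"

text \<open>One index is kept for each occupied cell of a grid of side \<open>r / CARD('m)\<close>.
  A cell has l1 diameter \<open>r\<close>, which gives the covering; in each coordinate a ball of
  radius \<open>\<rho> \<ge> r\<close> meets at most \<open>(2 * CARD('m) + 3) * \<rho> / r\<close>
  cells, which gives sparseness. Sparseness is asked at every scale above \<open>r\<close> because a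
  triple with small \<open>q\<close> belongs to the bodies of many net points.\<close>

lemma exists_sparse_net:
  fixes X :: "'c \<Rightarrow> real ^ 'm"
  assumes r: "r > 0" and bdd: "\<And>c. c \<in> I \<Longrightarrow> norm (X c) \<le> L"
  obtains R where "R \<subseteq> I" "sparse_net ((2 * real CARD('m) + 3) ^ CARD('m)) r R X"
    "\<And>c. c \<in> I \<Longrightarrow> \<exists>c'\<in>R. norm (X c' - X c) \<le> r"
proof -
  let ?m = "real CARD('m)"
  have m: "?m \<ge> 1" using one_le_card_finite[where 'a = 'm] by linarith
  define h where "h = r / ?m"
  have h: "h > 0" using r by (simp add: h_def)
  define code where "code c = (\<chi> i. \<lfloor>X c $ i / h\<rfloor>)" for c
  define rep where "rep k = (SOME c. c \<in> I \<and> code c = k)" for k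
  define R where "R = rep ` code ` I"
  have rep: "rep (code c) \<in> I \<and> code (rep (code c)) = code c" if "c \<in> I" for c
    unfolding rep_def by (rule someI_ex) (use that in blast)
  have inj: "inj_on code R" unfolding R_def by (rule inj_onI) (use rep in fastforce)
  have sub: "R \<subseteq> I" unfolding R_def using rep by blast
  have count: "finite {c \<in> R. norm (X c - y) \<le> \<rho>} \<and>
      real (card {c \<in> R. norm (X c - y) \<le> \<rho>}) \<le> (2 * ?m + 3) ^ CARD('m) * (\<rho> / r) ^ CARD('m)" if \<rho>: "\<rho> \<ge> r" for y \<rho>
  proof -
    define S where "S = {c \<in> R. norm (X c - y) \<le> \<rho>}"
    define J where "J i = {k :: int. \<bar>real_of_int k - y $ i / h\<bar> \<le> \<rho> / h + 1}" for i
    have pos: "\<rho> / h + 1 \<ge> 0" using \<rho> r h by simp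
    have finJ: "finite (J i)" for i unfolding J_def using pos by (rule card_int_interval(1))
    have "code ` S \<subseteq> {k. \<forall>i. k $ i \<in> J i}"
    proof safe
      fix c i assume "c \<in> S"
      then have "norm (X c - y) \<le> \<rho>" by (simp add: S_def)
      then have "\<bar>X c $ i - y $ i\<bar> \<le> \<rho>"
        using component_le_norm_cart[of "X c - y" i] by simp
      then have "\<bar>X c $ i / h - y $ i / h\<bar> \<le> \<rho> / h"
        using h by (simp add: divide_right_mono flip: diff_divide_distrib)
      then have "\<bar>real_of_int \<lfloor>X c $ i / h\<rfloor> - y $ i / h\<bar> \<le> \<rho> / h + 1" by linarith
      then show "code c $ i \<in> J i" by (simp add: code_def J_def)
    qed
    moreover have fin: "finite {k. \<forall>i. k $ i \<in> J i}" by (rule card_vec_box(1)[OF finJ])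
    ultimately have "finite (code ` S)" "card (code ` S) \<le> card {k. \<forall>i. k $ i \<in> J i}"
      by (auto intro: finite_subset card_mono)
    moreover have injS: "inj_on code S" by (rule inj_on_subset[OF inj]) (auto simp: S_def)
    ultimately have finS: "finite S" and "card S \<le> (\<Prod>i\<in>UNIV. card (J i))"
      using card_vec_box(2)[of J, OF finJ] by (simp_all add: finite_image_iff card_image)
    then have "real (card S) \<le> (\<Prod>i\<in>UNIV. real (card (J i)))"
      unfolding of_nat_prod[symmetric] of_nat_le_iff by simp
    also have "\<dots> \<le> (\<Prod>i\<in>(UNIV :: 'm set). (2 * ?m + 3) * (\<rho> / r))"
    proof (intro prod_mono conjI)
      fix i
      have "real (card (J i)) \<le> 2 * (\<rho> / h + 1) + 1" unfolding J_def by (rule card_int_interval(2)[OF pos])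
      also have "\<dots> = 2 * ?m * (\<rho> / r) + 3" by (simp add: h_def)
      also have "\<dots> \<le> (2 * ?m + 3) * (\<rho> / r)" using \<rho> r by (simp add: field_simps)
      finally show "real (card (J i)) \<le> (2 * ?m + 3) * (\<rho> / r)" .
    qed simp
    finally show ?thesis using finS unfolding S_def by (simp flip: power_mult_distrib)
  qed
  have "finite {c \<in> R. norm (X c - 0) \<le> max L r}" using count[of "max L r" 0] by simp
  moreover have "{c \<in> R. norm (X c - 0) \<le> max L r} = R" using bdd sub by fastforce
  ultimately have finR: "finite R" by simp
  have "sparse_net ((2 * ?m + 3) ^ CARD('m)) r R X"
    unfolding sparse_net_def using finR count by blast
  moreover have "\<exists>c'\<in>R. norm (X c' - X c) \<le> r" if c: "c \<in> I" for c
  proof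
    show "rep (code c) \<in> R" using c by (auto simp: R_def)
    have "norm (X (rep (code c)) - X c) \<le> (\<Sum>i\<in>UNIV. \<bar>(X (rep (code c)) - X c) $ i\<bar>)"
      by (rule norm_le_l1_cart)
    also have "\<dots> \<le> (\<Sum>i\<in>(UNIV :: 'm set). h)"
    proof (rule sum_mono)
      fix i
      have "code (rep (code c)) $ i = code c $ i" using rep[OF c] by simp
      then have "\<lfloor>X (rep (code c)) $ i / h\<rfloor> = \<lfloor>X c $ i / h\<rfloor>" by (simp add: code_def)
      then have "\<bar>X (rep (code c)) $ i / h - X c $ i / h\<bar> \<le> 1" by linarith
      then show "\<bar>(X (rep (code c)) - X c) $ i\<bar> \<le> h"
        using h by (simp flip: diff_divide_distrib)
    qed
    also have "\<dots> = r" by (simp add: h_def)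
    finally show "norm (X (rep (code c)) - X c) \<le> r" .
  qed
  ultimately show ?thesis using that sub by blast
qed

lemma sum_card_swap:
  assumes "finite R" "finite S"
  shows "(\<Sum>c\<in>R. card {p \<in> S. P c p}) = (\<Sum>p\<in>S. card {c \<in> R. P c p})"
proof -
  have "(\<Sum>c\<in>R. card {p \<in> S. P c p}) = (\<Sum>c\<in>R. \<Sum>p\<in>S. if P c p then 1 else 0)"
    using assms by (intro sum.cong refl) (simp add: sum.If_cases Int_def)
  also have "\<dots> = (\<Sum>p\<in>S. \<Sum>c\<in>R. if P c p then 1 else 0)" by (rule sum.swap)
  also have "\<dots> = (\<Sum>p\<in>S. card {c \<in> R. P c p})"
    using assms by (intro sum.cong refl) (simp add: sum.If_cases Int_def)
  finally show ?thesis .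
qed

lemma exists_dyadic:
  fixes x :: real
  assumes "x \<ge> 1"
  obtains i :: nat where "2 ^ i \<le> x" "x < 2 ^ (i + 1)"
proof -
  obtain n :: nat where n: "x < 2 ^ n" using real_arch_pow[of 2 x] by auto
  define i where "i = (LEAST n. x < 2 ^ n)"
  have i: "x < 2 ^ i" unfolding i_def using n by (rule LeastI)
  have "i \<noteq> 0" using i assms by (intro notI) simp
  then obtain j where j: "i = Suc j" by (cases i) auto
  have "\<not> x < 2 ^ j" using not_less_Least[of j "\<lambda>n. x < 2 ^ n"] j unfolding i_def by simp
  then show ?thesis using that[of j] i j by simp
qed

lemma card_dyadic_le:
  fixes A k0 :: real
  assumes "A \<ge> 1" "k0 \<ge> 1"
  shows "finite {i :: nat. 2 ^ i * k0 \<le> A}" "real (card {i :: nat. 2 ^ i * k0 \<le> A}) \<le> 1 + log 2 A"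
proof -
  have "{i :: nat. 2 ^ i * k0 \<le> A} \<subseteq> {..nat \<lfloor>log 2 A\<rfloor>}"
  proof
    fix i :: nat assume "i \<in> {i. 2 ^ i * k0 \<le> A}"
    then have "2 ^ i * k0 \<le> A" by simp
    moreover have "(2 :: real) ^ i * 1 \<le> 2 ^ i * k0" using assms by (intro mult_left_mono) auto
    ultimately have "2 ^ i \<le> A" by linarith
    then have "real i \<le> log 2 A" using assms by (subst le_log_iff) (auto simp: powr_realpow)
    then show "i \<in> {..nat \<lfloor>log 2 A\<rfloor>}" by (simp add: le_nat_iff le_floor_iff)
  qed
  then have sub: "finite {i :: nat. 2 ^ i * k0 \<le> A} \<and> card {i :: nat. 2 ^ i * k0 \<le> A} \<le> card {..nat \<lfloor>log 2 A\<rfloor>}"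
    by (meson card_mono finite_atMost finite_subset)
  then show "finite {i :: nat. 2 ^ i * k0 \<le> A}" by simp
  have "0 \<le> log 2 A" using assms by simp
  then have "real (nat \<lfloor>log 2 A\<rfloor>) \<le> log 2 A" by simp
  then show "real (card {i :: nat. 2 ^ i * k0 \<le> A}) \<le> 1 + log 2 A" using sub by simp
qed

text \<open>Triples with \<open>|q| < k0\<close> are bounded trivially for each \<open>c\<close>; a triple with larger \<open>q\<close> determines
  \<open>X c\<close>, hence \<open>G c\<close>, up to \<open>O(B / |q|)\<close> and so occurs for few \<open>c\<close>.\<close>

lemma sum_pts_le_dyadic:
  fixes X :: "'c \<Rightarrow> real ^ 'm"
  assumes nd: "nondeg L I X F G" and R: "R \<subseteq> I" "sparse_net \<Lambda> r R G" and r: "r > 0"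
    and pos: "\<tau> > 0" "\<sigma> > 0" "A \<ge> 1" "B = r * A" "\<delta> > 0"
  defines "k0 \<equiv> max 1 (2 * L * B)"
  assumes fin: "\<And>Q. Q \<ge> k0 \<Longrightarrow> finite (near_pts \<tau> \<sigma> I X F G Q B \<delta>)"
  shows "(\<Sum>c\<in>R. real (card (pts \<tau> \<sigma> (X c) (F c) (G c) A B \<delta>))) \<le>
     real (card R) * ((4 * L * B + 1) * ((2 * B / \<tau> + 1) ^ CARD('m) * (2 * \<delta> + 1))) +
     (\<Sum>i\<in>{i :: nat. 2 ^ i * k0 \<le> A}. real (card (near_pts \<tau> \<sigma> I X F G (2 ^ i * k0) B \<delta>)) * (\<Lambda> * (2 * L * A / (2 ^ i * k0)) ^ CARD('m)))"
proof -
  note n = nondegD[OF nd]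
  have L: "L \<ge> 1" by (rule n(1))
  have B: "B > 0" using pos r by simp
  have finR: "finite R" using R(2) by (simp add: sparse_net_def)
  have k0: "k0 \<ge> 1" "k0 \<ge> 2 * L * B" by (auto simp: k0_def)
  define J where "J = {i :: nat. 2 ^ i * k0 \<le> A}"
  have finJ: "finite J" unfolding J_def by (rule card_dyadic_le[OF pos(3) k0(1)])
  define P where "P c = pts \<tau> \<sigma> (X c) (F c) (G c) A B \<delta>" for c
  define P0 where "P0 c = pts \<tau> \<sigma> (X c) (F c) (G c) (2 * L * B) B \<delta>" for c
  define N where "N i = near_pts \<tau> \<sigma> I X F G (2 ^ i * k0) B \<delta>" for i :: nat
  have ik0: "k0 \<le> 2 ^ i * k0" for i :: nat using k0 mult_right_mono[of 1 "2 ^ i" k0] by simp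
  have finN: "finite (N i)" for i unfolding N_def by (rule fin[OF ik0])
  have finP0: "finite (P0 c)" for c unfolding P0_def using pos L B by (intro finite_pts) auto
  have cover: "P c \<subseteq> P0 c \<union> (\<Union>i\<in>J. {p \<in> N i. p \<in> P c})" if c: "c \<in> R" for c
  proof
    fix p assume p: "p \<in> P c"
    obtain q a b where pe: "p = (q, a, b)" by (cases p)
    show "p \<in> P0 c \<union> (\<Union>i\<in>J. {p \<in> N i. p \<in> P c})"
    proof (cases "\<bar>real_of_int q\<bar> < k0")
      case True
      \<comment> \<open>If \<open>2 * L * B < 1\<close> then \<open>k0 = 1\<close> and only
        \<open>q = 0\<close> remains.\<close>
      have "\<bar>real_of_int q\<bar> \<le> 2 * L * B"
      proof (cases "q = 0")
        case False
        then have "\<bar>real_of_int q\<bar> \<ge> 1" by linarith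
        then show ?thesis using True by (auto simp: k0_def)
      qed (use L B in simp)
      then have "p \<in> P0 c" using p unfolding pe P_def P0_def pts_def by simp
      then show ?thesis by simp
    next
      case False
      have qA: "\<bar>real_of_int q\<bar> \<le> A" using p unfolding pe P_def pts_def by simp
      have "\<bar>real_of_int q\<bar> / k0 \<ge> 1" using False k0 by simp
      then obtain i :: nat where i: "2 ^ i \<le> \<bar>real_of_int q\<bar> / k0" "\<bar>real_of_int q\<bar> / k0 < 2 ^ (i + 1)"
        by (rule exists_dyadic)
      then have i': "2 ^ i * k0 \<le> \<bar>real_of_int q\<bar>" "\<bar>real_of_int q\<bar> < 2 * (2 ^ i * k0)"
        using k0 by (simp_all add: field_simps)
      then have "i \<in> J" using qA by (simp add: J_def)
      moreover have "p \<in> N i"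
        using p i' c R(1) unfolding pe N_def near_pts_def P_def pts_def by auto
      ultimately show ?thesis using p by blast
    qed
  qed
  have "(\<Sum>c\<in>R. real (card (P c))) \<le> (\<Sum>c\<in>R. real (card (P0 c)) + (\<Sum>i\<in>J. real (card {p \<in> N i. p \<in> P c})))"
  proof (rule sum_mono)
    fix c assume c: "c \<in> R"
    have "card (P c) \<le> card (P0 c \<union> (\<Union>i\<in>J. {p \<in> N i. p \<in> P c}))"
      using finP0 finJ finN by (intro card_mono cover[OF c]) auto
    also have "\<dots> \<le> card (P0 c) + card (\<Union>i\<in>J. {p \<in> N i. p \<in> P c})" by (rule card_Un_le)
    also have "card (\<Union>i\<in>J. {p \<in> N i. p \<in> P c}) \<le> (\<Sum>i\<in>J. card {p \<in> N i. p \<in> P c})"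
      using finJ by (rule card_UN_le)
    finally show "real (card (P c)) \<le> real (card (P0 c)) + (\<Sum>i\<in>J. real (card {p \<in> N i. p \<in> P c}))"
      by (simp flip: of_nat_sum of_nat_add)
  qed
  also have "\<dots> = (\<Sum>c\<in>R. real (card (P0 c))) + (\<Sum>i\<in>J. \<Sum>c\<in>R. real (card {p \<in> N i. p \<in> P c}))"
    unfolding sum.distrib by (subst sum.swap) rule
  finally have split: "(\<Sum>c\<in>R. real (card (P c))) \<le> (\<Sum>c\<in>R. real (card (P0 c))) + (\<Sum>i\<in>J. \<Sum>c\<in>R. real (card {p \<in> N i. p \<in> P c}))" .
  have "(\<Sum>c\<in>R. real (card (P0 c))) \<le> real (card R) * ((2 * (2 * L * B) + 1) * ((2 * B / \<tau> + 1) ^ CARD('m) * (2 * \<delta> + 1)))"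
    unfolding P0_def using pos L B by (intro sum_real_le_card card_pts_le) auto
  moreover have "2 * (2 * L * B) = 4 * L * B" by simp
  ultimately have small: "(\<Sum>c\<in>R. real (card (P0 c))) \<le> real (card R) * ((4 * L * B + 1) * ((2 * B / \<tau> + 1) ^ CARD('m) * (2 * \<delta> + 1)))"
    by (simp only:)
  have large: "(\<Sum>i\<in>J. \<Sum>c\<in>R. real (card {p \<in> N i. p \<in> P c})) \<le> (\<Sum>i\<in>J. real (card (N i)) * (\<Lambda> * (2 * L * A / (2 ^ i * k0)) ^ CARD('m)))"
  proof (rule sum_mono)
    fix i assume i: "i \<in> J"
    define A' where "A' = 2 ^ i * k0"
    have A': "A' > 0" "A' \<le> A" using i k0 by (auto simp: A'_def J_def)
    have "(\<Sum>c\<in>R. real (card {p \<in> N i. p \<in> P c})) = (\<Sum>p\<in>N i. real (card {c \<in> R. p \<in> P c}))"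
      using sum_card_swap[OF finR finN[of i], of "\<lambda>c p. p \<in> P c"] by (simp flip: of_nat_sum)
    also have "\<dots> \<le> real (card (N i)) * (\<Lambda> * (2 * L * A / A') ^ CARD('m))"
    proof (rule sum_real_le_card)
      fix p assume p: "p \<in> N i"
      obtain q a b where pe: "p = (q, a, b)" by (cases p)
      have q: "A' \<le> \<bar>real_of_int q\<bar>" using p unfolding pe N_def near_pts_def A'_def by simp
      \<comment> \<open>Two indices whose bodies share a triple have values of \<open>X\<close>
        within \<open>2 * B / A'\<close>, hence gradients within \<open>L\<close> times that, which
        is \<rho> because \<open>B = r * A\<close>.\<close>
      define \<rho> where "\<rho> = 2 * L * A / A' * r"
      have \<rho>: "\<rho> \<ge> r"
      proof -
        have "A' \<le> 2 * L * A" using A' L pos mult_right_mono[of 1 "2 * L" A] by linarith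
        then have "1 \<le> 2 * L * A / A'" using A' by simp
        then have "1 * r \<le> \<rho>" unfolding \<rho>_def using r by (intro mult_right_mono) auto
        then show ?thesis by simp
      qed
      have \<rho>': "\<rho> / r = 2 * L * A / A'" using r by (simp add: \<rho>_def)
      show "real (card {c \<in> R. p \<in> P c}) \<le> \<Lambda> * (2 * L * A / A') ^ CARD('m)"
      proof (cases "{c \<in> R. p \<in> P c} = {}")
        case True
        have "0 \<le> \<Lambda> * (\<rho> / r) ^ CARD('m)"
          using R(2) \<rho> unfolding sparse_net_def by (meson of_nat_0_le_iff order_trans)
        then show ?thesis unfolding True \<rho>' by simp
      next
        case False
        then obtain c0 where c0: "c0 \<in> R" "p \<in> P c0" by blast
        have "norm (G c - G c0) \<le> \<rho>" if c: "c \<in> R" "p \<in> P c" for c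
        proof -
          have "real_of_int q *\<^sub>R (X c - X c0) = (\<tau> *\<^sub>R real_vec a - real_of_int q *\<^sub>R X c0) - (\<tau> *\<^sub>R real_vec a - real_of_int q *\<^sub>R X c)"
            by (simp add: algebra_simps)
          then have "norm (real_of_int q *\<^sub>R (X c - X c0)) \<le> norm (\<tau> *\<^sub>R real_vec a - real_of_int q *\<^sub>R X c0) + norm (\<tau> *\<^sub>R real_vec a - real_of_int q *\<^sub>R X c)"
            by (metis norm_triangle_ineq4)
          also have "\<dots> \<le> 2 * B" using c(2) c0(2) unfolding pe P_def pts_def by simp
          finally have "\<bar>real_of_int q\<bar> * norm (X c - X c0) \<le> 2 * B" by simp
          moreover have "A' * norm (X c - X c0) \<le> \<bar>real_of_int q\<bar> * norm (X c - X c0)"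
            using q by (intro mult_right_mono) auto
          ultimately have x: "norm (X c - X c0) \<le> 2 * B / A'" using A' by (simp add: pos_le_divide_eq mult.commute)
          have "norm (G c - G c0) \<le> L * norm (X c - X c0)" using n(7) c c0 R(1) by blast
          also have "\<dots> \<le> L * (2 * B / A')" using x L by (intro mult_left_mono) auto
          also have "\<dots> = \<rho>" by (simp add: \<rho>_def pos)
          finally show ?thesis .
        qed
        then have "card {c \<in> R. p \<in> P c} \<le> card {c \<in> R. norm (G c - G c0) \<le> \<rho>}"
          using finR by (intro card_mono) auto
        moreover have "real (card {c \<in> R. norm (G c - G c0) \<le> \<rho>}) \<le> \<Lambda> * (\<rho> / r) ^ CARD('m)"
          using R(2) \<rho> unfolding sparse_net_def by blast
        ultimately show ?thesis unfolding \<rho>' by linarith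
      qed
    qed
    finally show "(\<Sum>c\<in>R. real (card {p \<in> N i. p \<in> P c})) \<le> real (card (N i)) * (\<Lambda> * (2 * L * A / (2 ^ i * k0)) ^ CARD('m))"
      unfolding A'_def .
  qed
  show ?thesis using add_mono[OF small large] split unfolding P_def N_def J_def by (rule order_trans[rotated])
qed

text \<open>The shape of \<open>weight\<close> is forced by the iteration: it is, up to the factor in \<open>weight_dual\<close>
  below, invariant under \<open>\<tau> \<mapsto> \<sigma> / \<tau>\<close>.\<close>

definition weight :: "nat \<Rightarrow> real \<Rightarrow> real \<Rightarrow> real" where
  "weight m \<tau> \<sigma> = sqrt \<sigma> * (1 / \<tau> ^ m + 1 / sqrt \<sigma> ^ m)"

text \<open>The hypothesis of the iteration. It is uniform over all configurations and over \<tau>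
  and \<sigma>, so that it can be applied to the dual; the two upper bounds on \<open>B\<close> are
  those of the trivial count. The \<open>itself\<close> argument carries the dimension, and the
  index type is fixed because it cannot be quantified.\<close>

definition near_bound :: "'m::finite itself \<Rightarrow> real \<Rightarrow> real \<Rightarrow> real \<Rightarrow> bool" where
  "near_bound _ L \<theta> K \<longleftrightarrow> (\<forall>(I :: (real ^ 'm) set) X F (G :: real ^ 'm \<Rightarrow> real ^ 'm) \<tau> \<sigma> Q B \<delta>.
     nondeg L I X F G \<longrightarrow> \<tau> > 0 \<longrightarrow> \<sigma> \<ge> 1 \<longrightarrow> Q \<ge> 1 \<longrightarrow> B > 0 \<longrightarrow> 2 * L * B \<le> Q \<longrightarrow> B\<^sup>2 \<le> Q * \<sigma> * \<delta> \<longrightarrow>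
     Q powr - \<theta> \<le> \<delta> \<longrightarrow> \<delta> \<le> 1 \<longrightarrow>
     real (card (near_pts \<tau> \<sigma> I X F G Q B \<delta>)) \<le> K * \<delta> * Q ^ (CARD('m) + 1) * weight CARD('m) \<tau> \<sigma>)"

lemma weight_nonneg: "\<tau> > 0 \<Longrightarrow> \<sigma> \<ge> 1 \<Longrightarrow> weight m \<tau> \<sigma> \<ge> 0"
  by (simp add: weight_def)

text \<open>The induction hypothesis enters the dyadic sum here. At scale \<open>Q\<close> the
  overlap factor \<open>(A / Q)^m\<close>, m = \<open>CARD('m)\<close>, meets a count of order
  \<open>\<delta>' * Q^(m+1)\<close>, so each scale contributes \<open>A^m\<close> times
  \<open>\<delta>' * Q\<close>, which is at most \<open>\<Omega> + A powr (1 - \<theta>)\<close>;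
  the number of scales gives the logarithm.\<close>

lemma sum_pts_le:
  fixes X :: "real ^ 'm \<Rightarrow> real ^ 'm"
  assumes nd: "nondeg L I X F G" and R: "R \<subseteq> I" "sparse_net \<Lambda> r R G" and r: "r > 0" and \<Lambda>: "\<Lambda> \<ge> 0"
    and pos: "\<tau> > 0" "\<sigma> \<ge> 1" "A \<ge> 1" "B = r * A" "\<delta> > 0"
    and hyp: "near_bound TYPE('m) L \<theta> K" "K \<ge> 0" "0 \<le> \<theta>" "\<theta> \<le> 1"
    and \<Omega>: "B\<^sup>2 \<le> \<Omega> * \<sigma>" "\<delta> \<le> \<Omega> / A" "\<Omega> \<le> 1"
  shows "(\<Sum>c\<in>R. real (card (pts \<tau> \<sigma> (X c) (F c) (G c) A B \<delta>))) \<le>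
     real (card R) * ((4 * L * B + 1) * ((2 * B / \<tau> + 1) ^ CARD('m) * (2 * \<delta> + 1))) +
     \<Lambda> * (2 * L) ^ CARD('m) * A ^ CARD('m) * K * weight CARD('m) \<tau> \<sigma> * (\<Omega> + A powr (1 - \<theta>)) * (1 + log 2 A)"
proof -
  have L: "L \<ge> 1" by (rule nondegD(1)[OF nd])
  have B: "B > 0" using pos r by simp
  define k0 where "k0 = max 1 (2 * L * B)"
  have k0: "k0 \<ge> 1" "k0 \<ge> 2 * L * B" by (auto simp: k0_def)
  have \<Omega>0: "\<Omega> > 0"
  proof -
    have "0 < \<Omega> / A" using \<Omega> pos by linarith
    then show ?thesis using pos by (simp add: zero_less_divide_iff)
  qed
  \<comment> \<open>An enlarged tolerance for which the hypothesis is available at scale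
    \<open>Q\<close>: the first entry secures \<open>B^2 \<le> Q * \<sigma> * \<delta>'\<close>, the
    second the range of \<theta>.\<close>
  define \<delta>' where "\<delta>' Q = max (\<Omega> / Q) (Q powr - \<theta>)" for Q
  have \<delta>'1: "\<delta>' Q > 0" "\<delta>' Q \<le> 1" "B\<^sup>2 \<le> Q * \<sigma> * \<delta>' Q" if "Q \<ge> 1" for Q
  proof -
    show "\<delta>' Q > 0" using that \<Omega>0 by (simp add: \<delta>'_def less_max_iff_disj)
    have "Q powr - \<theta> \<le> Q powr 0" using that hyp by (intro powr_mono) auto
    then show "\<delta>' Q \<le> 1" using that \<Omega> by (simp add: \<delta>'_def)
    have "\<Omega> * \<sigma> = Q * \<sigma> * (\<Omega> / Q)" using that by simp
    also have "\<dots> \<le> Q * \<sigma> * \<delta>' Q" using that pos by (intro mult_left_mono) (auto simp: \<delta>'_def)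
    finally show "B\<^sup>2 \<le> Q * \<sigma> * \<delta>' Q" using \<Omega>(1) by linarith
  qed
  have fin': "finite (near_pts \<tau> \<sigma> I X F G Q B (\<delta>' Q))" if "Q \<ge> k0" for Q
    using that k0 pos B \<delta>'1[of Q] by (intro near_pts_trivial(1)[OF nd]) auto
  have fin: "finite (near_pts \<tau> \<sigma> I X F G Q B \<delta>)" if Q: "Q \<ge> k0" for Q
  proof -
    have d1: "\<delta> \<le> 1"
    proof -
      have "\<Omega> / A \<le> 1" using \<Omega> pos by simp
      then show ?thesis using \<Omega> by linarith
    qed
    have Q1: "Q \<ge> 1" using k0 Q by linarith
    have 1: "B\<^sup>2 \<le> Q * \<sigma> * max \<delta> (\<delta>' Q)"
    proof -
      have "Q * \<sigma> * \<delta>' Q \<le> Q * \<sigma> * max \<delta> (\<delta>' Q)" using Q1 pos by (intro mult_left_mono) auto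
      then show ?thesis using \<delta>'1(3)[OF Q1] by linarith
    qed
    have "finite (near_pts \<tau> \<sigma> I X F G Q B (max \<delta> (\<delta>' Q)))"
      using Q Q1 k0 pos B \<delta>'1[of Q] 1 d1 by (intro near_pts_trivial(1)[OF nd]) auto
    moreover have "\<sigma> > 0" using pos by simp
    ultimately show ?thesis by (rule finite_subset[OF near_pts_mono[OF order_refl max.cobounded1], rotated])
  qed
  define J where "J = {i :: nat. 2 ^ i * k0 \<le> A}"
  have W: "weight CARD('m) \<tau> \<sigma> \<ge> 0" using pos by (intro weight_nonneg) auto
  define T where "T = \<Lambda> * (2 * L) ^ CARD('m) * A ^ CARD('m) * K * weight CARD('m) \<tau> \<sigma> * (\<Omega> + A powr (1 - \<theta>))"
  have T0: "T \<ge> 0" unfolding T_def using \<Lambda> L pos hyp W \<Omega>0 by (intro mult_nonneg_nonneg) auto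
  have "(\<Sum>i\<in>J. real (card (near_pts \<tau> \<sigma> I X F G (2 ^ i * k0) B \<delta>)) * (\<Lambda> * (2 * L * A / (2 ^ i * k0)) ^ CARD('m))) \<le> real (card J) * T"
  proof (rule sum_real_le_card)
    fix i assume i: "i \<in> J"
    define Q where "Q = 2 ^ i * k0"
    have QA: "Q \<le> A" using i by (simp add: J_def Q_def)
    have Qk: "k0 \<le> Q" using k0 mult_right_mono[of 1 "2 ^ i" k0] by (simp add: Q_def)
    have Q1: "Q \<ge> 1" using Qk k0 by linarith
    have dd: "\<delta> \<le> \<delta>' Q"
    proof -
      have "\<Omega> / A \<le> \<Omega> / Q" using \<Omega>0 Q1 QA by (intro divide_left_mono) auto
      then show ?thesis using \<Omega> by (simp add: \<delta>'_def le_max_iff_disj)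
    qed
    have "real (card (near_pts \<tau> \<sigma> I X F G Q B \<delta>)) \<le> real (card (near_pts \<tau> \<sigma> I X F G Q B (\<delta>' Q)))"
      using near_pts_mono[OF order_refl dd, of \<sigma> \<tau> I X F G Q B] fin'[OF Qk] pos by (simp add: card_mono)
    also have "\<dots> \<le> K * \<delta>' Q * Q ^ (CARD('m) + 1) * weight CARD('m) \<tau> \<sigma>"
      using hyp(1) nd pos Q1 B k0 Qk \<delta>'1[OF Q1] unfolding near_bound_def by (simp add: \<delta>'_def)
    finally have 0: "real (card (near_pts \<tau> \<sigma> I X F G Q B \<delta>)) \<le> K * \<delta>' Q * Q ^ (CARD('m) + 1) * weight CARD('m) \<tau> \<sigma>" .
    have dQ: "\<delta>' Q * Q \<le> \<Omega> + A powr (1 - \<theta>)"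
    proof -
      have "\<delta>' Q \<le> \<Omega> / Q + Q powr - \<theta>" using Q1 \<Omega>0 by (simp add: \<delta>'_def)
      then have "\<delta>' Q * Q \<le> (\<Omega> / Q + Q powr - \<theta>) * Q" using Q1 by (intro mult_right_mono) auto
      also have "\<dots> = \<Omega> + Q powr (1 - \<theta>)" using Q1 by (simp add: distrib_right powr_diff powr_minus field_simps)
      also have "\<dots> \<le> \<Omega> + A powr (1 - \<theta>)" using Q1 QA hyp by (intro add_left_mono powr_mono2) auto
      finally show ?thesis .
    qed
    have "K * \<delta>' Q * Q ^ (CARD('m) + 1) * weight CARD('m) \<tau> \<sigma> = (\<delta>' Q * Q) * (K * Q ^ CARD('m) * weight CARD('m) \<tau> \<sigma>)"
      by simp
    also have "\<dots> \<le> (\<Omega> + A powr (1 - \<theta>)) * (K * Q ^ CARD('m) * weight CARD('m) \<tau> \<sigma>)"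
      using dQ hyp W Q1 by (intro mult_right_mono) auto
    finally have 1: "real (card (near_pts \<tau> \<sigma> I X F G Q B \<delta>)) \<le> K * (\<Omega> + A powr (1 - \<theta>)) * Q ^ CARD('m) * weight CARD('m) \<tau> \<sigma>"
      using 0 by (simp add: mult_ac)
    have "real (card (near_pts \<tau> \<sigma> I X F G Q B \<delta>)) * (\<Lambda> * (2 * L * A / Q) ^ CARD('m))
       \<le> K * (\<Omega> + A powr (1 - \<theta>)) * Q ^ CARD('m) * weight CARD('m) \<tau> \<sigma> * (\<Lambda> * (2 * L * A / Q) ^ CARD('m))"
      using 1 \<Lambda> L pos Q1 by (intro mult_right_mono) auto
    also have "\<dots> = T" using Q1 by (simp add: T_def power_divide power_mult_distrib)
    finally show "real (card (near_pts \<tau> \<sigma> I X F G (2 ^ i * k0) B \<delta>)) * (\<Lambda> * (2 * L * A / (2 ^ i * k0)) ^ CARD('m)) \<le> T"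
      unfolding Q_def .
  qed
  also have "\<dots> \<le> (1 + log 2 A) * T"
    using card_dyadic_le(2)[OF pos(3) k0(1)] T0 unfolding J_def by (intro mult_right_mono)
  also have "\<dots> = T * (1 + log 2 A)" by simp
  finally have main: "(\<Sum>i\<in>J. real (card (near_pts \<tau> \<sigma> I X F G (2 ^ i * k0) B \<delta>)) * (\<Lambda> * (2 * L * A / (2 ^ i * k0)) ^ CARD('m))) \<le> T * (1 + log 2 A)" .
  have "\<sigma> > 0" using pos by simp
  from sum_pts_le_dyadic[OF nd R r pos(1) this pos(3-5), folded k0_def, OF fin] main
  show ?thesis unfolding J_def T_def by linarith
qed

section \<open>The recursion between a configuration and its dual\<close>

lemma one_plus_power_le:
  fixes x :: real
  assumes "x \<ge> 0"
  shows "(1 + x) ^ m \<le> 2 ^ m * (1 + x ^ m)"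
proof (cases "x \<le> 1")
  case True
  then have "(1 + x) ^ m \<le> 2 ^ m" using assms by (intro power_mono) auto
  also have "\<dots> \<le> 2 ^ m * (1 + x ^ m)" using assms by simp
  finally show ?thesis .
next
  case False
  then have "(1 + x) ^ m \<le> (2 * x) ^ m" using assms by (intro power_mono) auto
  also have "\<dots> \<le> 2 ^ m * (1 + x ^ m)" using assms by (simp add: power_mult_distrib)
  finally show ?thesis .
qed

text \<open>The factor on the left is what transference leaves over once the powers of
  \<open>Q\<close>, \<delta> and \<omega> are taken out. Multiplication by it swaps the two summands
  of \<open>weight\<close>.\<close>

lemma weight_dual:
  assumes "\<tau> > 0" "\<sigma> > 0"
  shows "sqrt \<sigma> ^ m / \<tau> ^ m * weight m (\<sigma> / \<tau>) \<sigma> = weight m \<tau> \<sigma>"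
proof -
  define s where "s = sqrt \<sigma>"
  have s: "s > 0" "\<sigma> = s * s" using assms by (simp_all add: s_def)
  show ?thesis
    unfolding weight_def s_def[symmetric] using s(1) assms
    by (simp add: s(2) power_divide power_mult_distrib field_simps)
qed

text \<open>The net has spacing \<open>r = B / Q\<close>, and by \<open>residual_change\<close>
  every triple passes to the body of a net point at the cost of constants. Transference is applied
  at each net point, then \<open>sum_pts_le\<close> to the dual configuration with
  \<open>A = 1 / \<delta>\<close> and \<open>\<Omega> = 1 / (Q * \<delta>)\<close>. The first
  summand stems from the small \<open>q\<close> in the dual count and is the main term; the second
  carries the hypothesis.\<close>

lemma near_pts_recursion:
  fixes X :: "real ^ 'm \<Rightarrow> real ^ 'm"
  assumes hyp: "near_bound TYPE('m) L \<theta> K" "K \<ge> 0" "0 \<le> \<theta>" "\<theta> \<le> 1"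
    and nd: "nondeg L I X F G" and pos: "\<tau> > 0" "\<sigma> \<ge> 1" "Q \<ge> 1" "0 < \<delta>" "\<delta> \<le> 1" "1 \<le> Q * \<delta>"
    and B: "B = sqrt (Q * \<sigma> * \<delta>)" "2 * L * B \<le> Q"
  defines "\<omega> \<equiv> sqrt (1 / (Q * \<delta>))"
  defines "\<Lambda> \<equiv> (2 * real CARD('m) + 3) ^ CARD('m)"
  shows "real (card (near_pts \<tau> \<sigma> I X F G Q B \<delta>)) \<le>
    2 * 24 ^ (CARD('m) + 2) * real CARD('m) ^ CARD('m) * (8 * L\<^sup>2 * 3 ^ CARD('m)) * \<Lambda> * (12 * L * (4 * L) ^ CARD('m) + (2 * L) ^ CARD('m)) *
    (\<delta> * Q ^ (CARD('m) + 1)) *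
    ((1 + sqrt \<sigma> * \<omega>) * (1 / \<tau> ^ CARD('m) + \<omega> ^ CARD('m) / sqrt \<sigma> ^ CARD('m)) +
      K * \<omega> ^ CARD('m) * weight CARD('m) \<tau> \<sigma> * (1 / (Q * \<delta>) + (1 / \<delta>) powr (1 - \<theta>)) * (1 + log 2 (1 / \<delta>)))"
proof -
  let ?m = "CARD('m)"
  define s where "s = sqrt \<sigma>"
  have s: "s \<ge> 1" "s * s = \<sigma>" using pos by (simp_all add: s_def)
  have L: "L \<ge> 1" by (rule nondegD(1)[OF nd])
  have \<omega>: "\<omega> > 0" "\<omega> * \<omega> = 1 / (Q * \<delta>)" "\<omega> \<le> 1"
    using pos by (simp_all add: \<omega>_def)
  have B0: "B > 0" using pos by (simp add: B)
  have BB: "B * B = Q * \<sigma> * \<delta>" using pos by (simp add: B)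
  have B\<omega>: "B * \<omega> = s"
  proof -
    have "B * \<omega> = sqrt (Q * \<sigma> * \<delta> * (1 / (Q * \<delta>)))" unfolding B \<omega>_def by (rule real_sqrt_mult[symmetric])
    also have "Q * \<sigma> * \<delta> * (1 / (Q * \<delta>)) = \<sigma>" using pos by simp
    finally show ?thesis by (simp add: s_def)
  qed
  have Bs: "\<sigma> / B = s * \<omega>"
  proof -
    have "\<sigma> = s * (B * \<omega>)" unfolding B\<omega> using s by simp
    then show ?thesis using B0 by simp
  qed
  have Binv: "1 / B = \<omega> / s" using B\<omega> B0 s \<omega> by (simp add: field_simps)
  define r where "r = B / Q"
  have r: "r > 0" using B0 pos by (simp add: r_def)
  have rL: "r \<le> L"
  proof -
    have "1 * B \<le> 2 * L * B" using L B0 by (intro mult_right_mono) auto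
    then have "B \<le> Q" using B(2) by simp
    then have "r \<le> 1" using pos by (simp add: r_def)
    then show ?thesis using L by simp
  qed
  \<comment> \<open>The choice of \<open>B\<close> makes one net serve both sides: the dual radius
    is \<open>r\<close> times the dual height \<open>1 / \<delta>\<close>, as
    \<open>sum_pts_le\<close> demands.\<close>
  have rJ: "\<sigma> / B = r * (1 / \<delta>)"
    using BB B0 pos by (simp add: r_def field_simps)
  have "\<exists>R. R \<subseteq> I \<and> sparse_net \<Lambda> r R X \<and> (\<forall>c\<in>I. \<exists>c'\<in>R. norm (X c' - X c) \<le> r)"
  proof (rule exists_sparse_net[OF r nondegD(2)[OF nd]])
    fix R assume "R \<subseteq> I" "sparse_net ((2 * real ?m + 3) ^ ?m) r R X" "\<And>c. c \<in> I \<Longrightarrow> \<exists>c'\<in>R. norm (X c' - X c) \<le> r"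
    then show ?thesis unfolding \<Lambda>_def by (intro exI[of _ R]) simp
  qed
  then obtain R where "R \<subseteq> I \<and> sparse_net \<Lambda> r R X \<and> (\<forall>c\<in>I. \<exists>c'\<in>R. norm (X c' - X c) \<le> r)" ..
  then have R: "R \<subseteq> I" "sparse_net \<Lambda> r R X" "\<And>c. c \<in> I \<Longrightarrow> \<exists>c'\<in>R. norm (X c' - X c) \<le> r"
    by auto
  have finR: "finite R" using R(2) by (simp add: sparse_net_def)
  have \<Lambda>: "\<Lambda> \<ge> 0" by (simp add: \<Lambda>_def)
  have cR: "real (card R) \<le> \<Lambda> * (L / r) ^ ?m"
  proof -
    have "real (card {c \<in> R. norm (X c - 0) \<le> L}) \<le> \<Lambda> * (L / r) ^ ?m"
      using R(2) rL unfolding sparse_net_def by blast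
    moreover have "{c \<in> R. norm (X c - 0) \<le> L} = R" using nondegD(2)[OF nd] R(1) by auto
    ultimately show ?thesis by (simp only:)
  qed
  define F' where "F' c = X c \<bullet> G c - F c" for c
  define P where "P c = pts \<tau> \<sigma> (X c) (F c) (G c) (2 * Q) (3 * B) (4 * L\<^sup>2 * \<delta>)" for c
  define D where "D c = pts (\<sigma> / \<tau>) \<sigma> (G c) (F' c) (X c) (1 / \<delta>) (\<sigma> / B) (1 / Q)" for c
  define C0 where "C0 = 2 * 24 ^ (?m + 2) * real ?m ^ ?m"
  have C0: "C0 \<ge> 0" by (simp add: C0_def)
  have finP: "finite (P c)" for c unfolding P_def using pos B0 L by (intro finite_pts) auto
  have finD: "finite (D c)" for c unfolding D_def using pos B0 L by (intro finite_pts) auto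
  have "near_pts \<tau> \<sigma> I X F G Q B \<delta> \<subseteq> (\<Union>c\<in>R. P c)"
  proof
    fix p assume p: "p \<in> near_pts \<tau> \<sigma> I X F G Q B \<delta>"
    obtain q a b where pe: "p = (q, a, b)" by (cases p)
    define z where "z = \<tau> *\<^sub>R real_vec a"
    from p obtain c where c: "c \<in> I" "\<bar>real_of_int q\<bar> \<le> 2 * Q" "norm (z - real_of_int q *\<^sub>R X c) \<le> B"
      "\<bar>\<sigma> * real_of_int b - real_of_int q * F c - G c \<bullet> (z - real_of_int q *\<^sub>R X c)\<bar> \<le> \<sigma> * \<delta>"
      unfolding near_pts_def pts_def pe z_def by auto
    obtain c' where c': "c' \<in> R" "norm (X c' - X c) \<le> r" using R(3)[OF c(1)] by blast
    have c'I: "c' \<in> I" using c' R by blast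
    have "\<bar>(\<sigma> * real_of_int b - real_of_int q * F c' - G c' \<bullet> (z - real_of_int q *\<^sub>R X c')) - (\<sigma> * real_of_int b - real_of_int q * F c - G c \<bullet> (z - real_of_int q *\<^sub>R X c))\<bar>
       \<le> 2 * Q * L\<^sup>2 * r\<^sup>2 + L * r * B"
      by (rule residual_change[OF nd c(1) c'I c'(2) c(3) c(2)])
    also have "\<dots> = (2 * L\<^sup>2 + L) * (\<sigma> * \<delta>)"
      using BB pos by (simp add: r_def power2_eq_square field_simps)
    also have "\<dots> \<le> (3 * L\<^sup>2) * (\<sigma> * \<delta>)"
      using L pos by (intro mult_right_mono) (auto simp: power2_eq_square)
    finally have 1: "\<bar>\<sigma> * real_of_int b - real_of_int q * F c' - G c' \<bullet> (z - real_of_int q *\<^sub>R X c')\<bar> \<le> 3 * L\<^sup>2 * (\<sigma> * \<delta>) + \<sigma> * \<delta>"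
      using c(4) by linarith
    have "1 * (\<sigma> * \<delta>) \<le> L\<^sup>2 * (\<sigma> * \<delta>)" using L pos by (intro mult_right_mono) auto
    then have 2: "\<bar>\<sigma> * real_of_int b - real_of_int q * F c' - G c' \<bullet> (z - real_of_int q *\<^sub>R X c')\<bar> \<le> \<sigma> * (4 * L\<^sup>2 * \<delta>)"
      using 1 by (simp add: mult_ac)
    have "z - real_of_int q *\<^sub>R X c' = (z - real_of_int q *\<^sub>R X c) - real_of_int q *\<^sub>R (X c' - X c)"
      by (simp add: algebra_simps)
    then have "norm (z - real_of_int q *\<^sub>R X c') \<le> norm (z - real_of_int q *\<^sub>R X c) + \<bar>real_of_int q\<bar> * norm (X c' - X c)"
      by (metis norm_scaleR norm_triangle_ineq4)
    also have "\<dots> \<le> B + 2 * Q * r"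
      using c c' pos by (intro add_mono mult_mono) auto
    also have "\<dots> = 3 * B" using pos by (simp add: r_def)
    finally have 3: "norm (z - real_of_int q *\<^sub>R X c') \<le> 3 * B" .
    have "p \<in> P c'" unfolding P_def pts_def pe using c(2) 2 3 unfolding z_def by simp
    then show "p \<in> (\<Union>c\<in>R. P c)" using c'(1) by blast
  qed
  then have "card (near_pts \<tau> \<sigma> I X F G Q B \<delta>) \<le> card (\<Union>c\<in>R. P c)"
    using finR finP by (intro card_mono) auto
  also have "\<dots> \<le> (\<Sum>c\<in>R. card (P c))" by (rule card_UN_le[OF finR])
  finally have "real (card (near_pts \<tau> \<sigma> I X F G Q B \<delta>)) \<le> (\<Sum>c\<in>R. real (card (P c)))"
    by (simp flip: of_nat_sum)
  also have "\<dots> \<le> (\<Sum>c\<in>R. C0 * (8 * L\<^sup>2 * 3 ^ ?m) * (Q * B ^ ?m * \<delta> / \<tau> ^ ?m) * real (card (D c)))"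
  proof (rule sum_mono)
    fix c
    have "real (card (P c)) \<le> C0 * (2 * Q * (3 * B) ^ ?m * (4 * L\<^sup>2 * \<delta>) / \<tau> ^ ?m) *
       real (card (pts (\<sigma> / \<tau>) \<sigma> (G c) (X c \<bullet> G c - F c) (X c) (1 / (4 * L\<^sup>2 * \<delta>)) (\<sigma> / (3 * B)) (1 / (2 * Q))))"
      unfolding P_def C0_def using pos L B0 by (intro pts_transference) auto
    \<comment> \<open>Enlarging a body shrinks its dual, so the duals of the enlarged bodies still
      lie in \<open>D c\<close>.\<close>
    also have "\<dots> \<le> C0 * (2 * Q * (3 * B) ^ ?m * (4 * L\<^sup>2 * \<delta>) / \<tau> ^ ?m) * real (card (D c))"
    proof (intro mult_left_mono)
      have "1 \<le> 4 * L\<^sup>2" using L one_le_power[of L 2] by linarith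
      then have "1 * \<delta> \<le> 4 * L\<^sup>2 * \<delta>" using pos by (intro mult_right_mono) auto
      then have "pts (\<sigma> / \<tau>) \<sigma> (G c) (X c \<bullet> G c - F c) (X c) (1 / (4 * L\<^sup>2 * \<delta>)) (\<sigma> / (3 * B)) (1 / (2 * Q)) \<subseteq> D c"
        unfolding D_def F'_def using pos B0 L by (intro pts_mono) (auto intro!: divide_left_mono mult_pos_pos)
      then show "real (card (pts (\<sigma> / \<tau>) \<sigma> (G c) (X c \<bullet> G c - F c) (X c) (1 / (4 * L\<^sup>2 * \<delta>)) (\<sigma> / (3 * B)) (1 / (2 * Q)))) \<le> real (card (D c))"
        using card_mono[OF finD] by simp
      show "0 \<le> C0 * (2 * Q * (3 * B) ^ ?m * (4 * L\<^sup>2 * \<delta>) / \<tau> ^ ?m)" using C0 pos B0 by simp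
    qed
    also have "\<dots> = C0 * (8 * L\<^sup>2 * 3 ^ ?m) * (Q * B ^ ?m * \<delta> / \<tau> ^ ?m) * real (card (D c))"
      by (simp add: power_mult_distrib)
    finally show "real (card (P c)) \<le> C0 * (8 * L\<^sup>2 * 3 ^ ?m) * (Q * B ^ ?m * \<delta> / \<tau> ^ ?m) * real (card (D c))" .
  qed
  also have "\<dots> = C0 * (8 * L\<^sup>2 * 3 ^ ?m) * (Q * B ^ ?m * \<delta> / \<tau> ^ ?m) * (\<Sum>c\<in>R. real (card (D c)))"
    by (simp add: sum_distrib_left)
  finally have step1: "real (card (near_pts \<tau> \<sigma> I X F G Q B \<delta>)) \<le> C0 * (8 * L\<^sup>2 * 3 ^ ?m) * ((Q * B ^ ?m * \<delta> / \<tau> ^ ?m) * (\<Sum>c\<in>R. real (card (D c))))"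
    by (simp only: mult.assoc)
  define S where "S = (1 / (Q * \<delta>) + (1 / \<delta>) powr (1 - \<theta>)) * (1 + log 2 (1 / \<delta>))"
  have S0: "S \<ge> 0" unfolding S_def using pos by (intro mult_nonneg_nonneg add_nonneg_nonneg) auto
  have "(\<Sum>c\<in>R. real (card (D c))) \<le>
     real (card R) * ((4 * L * (\<sigma> / B) + 1) * ((2 * (\<sigma> / B) / (\<sigma> / \<tau>) + 1) ^ ?m * (2 * (1 / Q) + 1))) +
     \<Lambda> * (2 * L) ^ ?m * (1 / \<delta>) ^ ?m * K * weight ?m (\<sigma> / \<tau>) \<sigma> * (1 / (Q * \<delta>) + (1 / \<delta>) powr (1 - \<theta>)) * (1 + log 2 (1 / \<delta>))"
    unfolding D_def
  proof (rule sum_pts_le[OF _ R(1,2) r \<Lambda> _ _ _ _ _ hyp])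
    show "nondeg L I G F' X" using nondeg_dual[OF nd] unfolding F'_def .
    show "(\<sigma> / B)\<^sup>2 \<le> 1 / (Q * \<delta>) * \<sigma>" using BB B0 pos by (simp add: power2_eq_square field_simps)
    show "\<sigma> / B = r * (1 / \<delta>)" by (rule rJ)
  qed (use pos in auto)
  also have "\<dots> = real (card R) * ((4 * L * (s * \<omega>) + 1) * ((2 * \<tau> / B + 1) ^ ?m * (2 * (1 / Q) + 1))) +
     \<Lambda> * (2 * L) ^ ?m * (1 / \<delta>) ^ ?m * K * weight ?m (\<sigma> / \<tau>) \<sigma> * S"
  proof -
    have "2 * (\<sigma> / B) / (\<sigma> / \<tau>) = 2 * \<tau> / B" using pos by simp
    then show ?thesis unfolding Bs[symmetric] S_def by (simp add: mult.assoc)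
  qed
  finally have step2: "(\<Sum>c\<in>R. real (card (D c))) \<le> real (card R) * ((4 * L * (s * \<omega>) + 1) * ((2 * \<tau> / B + 1) ^ ?m * (2 * (1 / Q) + 1))) +
     \<Lambda> * (2 * L) ^ ?m * (1 / \<delta>) ^ ?m * K * weight ?m (\<sigma> / \<tau>) \<sigma> * S" .
  have factor: "0 \<le> Q * B ^ ?m * \<delta> / \<tau> ^ ?m" using pos B0 by simp
  \<comment> \<open>The number of net points is of order \<open>(Q / B)^m\<close>, which cancels the
    \<open>B^m\<close> from transference and leaves the expected
    \<open>\<delta> * Q^(m+1)\<close>.\<close>
  have part1: "(Q * B ^ ?m * \<delta> / \<tau> ^ ?m) * (real (card R) * ((4 * L * (s * \<omega>) + 1) * ((2 * \<tau> / B + 1) ^ ?m * (2 * (1 / Q) + 1))))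
     \<le> \<Lambda> * (12 * L * (4 * L) ^ ?m) * (\<delta> * Q ^ (?m + 1)) * ((1 + s * \<omega>) * (1 / \<tau> ^ ?m + \<omega> ^ ?m / s ^ ?m))"
  proof -
    have 1: "4 * L * (s * \<omega>) + 1 \<le> 4 * L * (1 + s * \<omega>)" using L by (simp add: distrib_left)
    have "(2 * \<tau> / B + 1) ^ ?m \<le> (2 * (1 + \<tau> / B)) ^ ?m" using pos B0 by (intro power_mono) auto
    also have "\<dots> = 2 ^ ?m * (1 + \<tau> / B) ^ ?m" by (rule power_mult_distrib)
    also have "\<dots> \<le> 2 ^ ?m * (2 ^ ?m * (1 + (\<tau> / B) ^ ?m))"
      using pos B0 by (intro mult_left_mono one_plus_power_le) auto
    also have "\<dots> = 4 ^ ?m * (1 + (\<tau> / B) ^ ?m)" by (simp flip: power_mult_distrib mult.assoc)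
    finally have 2: "(2 * \<tau> / B + 1) ^ ?m \<le> 4 ^ ?m * (1 + (\<tau> / B) ^ ?m)" .
    have "1 / Q \<le> 1" using pos by simp
    then have 3: "2 * (1 / Q) + 1 \<le> 3" by linarith
    have "real (card R) * ((4 * L * (s * \<omega>) + 1) * ((2 * \<tau> / B + 1) ^ ?m * (2 * (1 / Q) + 1)))
       \<le> (\<Lambda> * (L / r) ^ ?m) * ((4 * L * (1 + s * \<omega>)) * ((4 ^ ?m * (1 + (\<tau> / B) ^ ?m)) * 3))"
      using cR 1 2 3 \<Lambda> L r s \<omega> pos B0 by (intro mult_mono) auto
    then have "(Q * B ^ ?m * \<delta> / \<tau> ^ ?m) * (real (card R) * ((4 * L * (s * \<omega>) + 1) * ((2 * \<tau> / B + 1) ^ ?m * (2 * (1 / Q) + 1))))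
      \<le> (Q * B ^ ?m * \<delta> / \<tau> ^ ?m) * ((\<Lambda> * (L / r) ^ ?m) * ((4 * L * (1 + s * \<omega>)) * ((4 ^ ?m * (1 + (\<tau> / B) ^ ?m)) * 3)))"
      by (intro mult_left_mono factor)
    also have "\<dots> = \<Lambda> * (12 * L * (4 * L) ^ ?m) * (\<delta> * Q ^ (?m + 1)) * ((1 + s * \<omega>) * (1 / \<tau> ^ ?m * (1 + (\<tau> / B) ^ ?m)))"
      using B0 pos by (simp add: r_def power_divide power_mult_distrib)
    also have "1 / \<tau> ^ ?m * (1 + (\<tau> / B) ^ ?m) = 1 / \<tau> ^ ?m + (1 / B) ^ ?m"
      using pos by (simp add: distrib_left power_divide)
    also have "(1 / B) ^ ?m = \<omega> ^ ?m / s ^ ?m" unfolding Binv by (rule power_divide)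
    finally show ?thesis .
  qed
  \<comment> \<open>\<open>B / \<delta> = Q * sqrt \<sigma> * \<omega>\<close> brings out
    \<open>Q^m * \<omega>^m\<close>; the factor that remains turns the dual weight back into the
    original one.\<close>
  have part2: "(Q * B ^ ?m * \<delta> / \<tau> ^ ?m) * (\<Lambda> * (2 * L) ^ ?m * (1 / \<delta>) ^ ?m * K * weight ?m (\<sigma> / \<tau>) \<sigma> * S)
     = \<Lambda> * (2 * L) ^ ?m * (\<delta> * Q ^ (?m + 1)) * (K * \<omega> ^ ?m * weight ?m \<tau> \<sigma> * S)"
  proof -
    have BQ: "B * (1 / \<delta>) = Q * (s * \<omega>)" unfolding Bs[symmetric] rJ r_def using pos by simp
    have "B ^ ?m * (1 / \<delta>) ^ ?m = Q ^ ?m * (s ^ ?m * \<omega> ^ ?m)"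
      unfolding power_mult_distrib[symmetric] BQ ..
    then have "(Q * B ^ ?m * \<delta> / \<tau> ^ ?m) * (\<Lambda> * (2 * L) ^ ?m * (1 / \<delta>) ^ ?m * K * weight ?m (\<sigma> / \<tau>) \<sigma> * S)
      = \<Lambda> * (2 * L) ^ ?m * (Q * (Q ^ ?m * (s ^ ?m * \<omega> ^ ?m)) * \<delta> / \<tau> ^ ?m) * (K * weight ?m (\<sigma> / \<tau>) \<sigma> * S)"
      by (simp add: mult_ac)
    also have "\<dots> = \<Lambda> * (2 * L) ^ ?m * (\<delta> * Q ^ (?m + 1)) * (K * \<omega> ^ ?m * (s ^ ?m / \<tau> ^ ?m * weight ?m (\<sigma> / \<tau>) \<sigma>) * S)"
      by (simp add: mult_ac)
    also have "s ^ ?m / \<tau> ^ ?m * weight ?m (\<sigma> / \<tau>) \<sigma> = weight ?m \<tau> \<sigma>"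
      unfolding s_def using pos by (intro weight_dual) auto
    finally show ?thesis .
  qed
  define Y1 where "Y1 = (1 + s * \<omega>) * (1 / \<tau> ^ ?m + \<omega> ^ ?m / s ^ ?m)"
  define Y2 where "Y2 = K * \<omega> ^ ?m * weight ?m \<tau> \<sigma> * S"
  have Y: "Y1 \<ge> 0" "Y2 \<ge> 0" unfolding Y1_def Y2_def
    using s \<omega> pos S0 hyp weight_nonneg[OF pos(1,2)] by auto
  have "(Q * B ^ ?m * \<delta> / \<tau> ^ ?m) * (\<Sum>c\<in>R. real (card (D c)))
     \<le> \<Lambda> * (12 * L * (4 * L) ^ ?m) * (\<delta> * Q ^ (?m + 1)) * Y1 + \<Lambda> * (2 * L) ^ ?m * (\<delta> * Q ^ (?m + 1)) * Y2"
    using mult_left_mono[OF step2 factor] part1 part2 unfolding distrib_left Y1_def Y2_def by linarith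
  also have "\<dots> \<le> \<Lambda> * (12 * L * (4 * L) ^ ?m + (2 * L) ^ ?m) * (\<delta> * Q ^ (?m + 1)) * (Y1 + Y2)"
  proof -
    have "0 \<le> \<Lambda> * (12 * L * (4 * L) ^ ?m) * (\<delta> * Q ^ (?m + 1)) * Y2" "0 \<le> \<Lambda> * (2 * L) ^ ?m * (\<delta> * Q ^ (?m + 1)) * Y1"
      using \<Lambda> L pos Y by (auto intro!: mult_nonneg_nonneg)
    then show ?thesis by (simp add: distrib_left distrib_right)
  qed
  finally have step3: "(Q * B ^ ?m * \<delta> / \<tau> ^ ?m) * (\<Sum>c\<in>R. real (card (D c))) \<le> \<Lambda> * (12 * L * (4 * L) ^ ?m + (2 * L) ^ ?m) * (\<delta> * Q ^ (?m + 1)) * (Y1 + Y2)" .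
  have "real (card (near_pts \<tau> \<sigma> I X F G Q B \<delta>)) \<le> C0 * (8 * L\<^sup>2 * 3 ^ ?m) * (\<Lambda> * (12 * L * (4 * L) ^ ?m + (2 * L) ^ ?m) * (\<delta> * Q ^ (?m + 1)) * (Y1 + Y2))"
    using step1 mult_left_mono[OF step3, of "C0 * (8 * L\<^sup>2 * 3 ^ ?m)"] C0 by auto
  then show ?thesis unfolding C0_def Y1_def Y2_def S_def s_def[symmetric] by (simp only: mult.assoc)
qed

lemma powr_neg_log_bound:
  assumes "J \<ge> 1" "e > 0"
  shows "J powr - e * (1 + log 2 J) \<le> 1 + 1 / (e * ln 2)"
proof -
  have "ln J \<le> J powr e / e" by (rule ln_powr_bound[OF assms])
  then have "log 2 J \<le> J powr e / e / ln 2" unfolding log_def by (intro divide_right_mono) auto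
  moreover have "1 \<le> J powr e" using assms by (simp add: ge_one_powr_ge_zero)
  ultimately have "1 + log 2 J \<le> J powr e * (1 + 1 / (e * ln 2))"
    by (simp add: distrib_left)
  then have "J powr - e * (1 + log 2 J) \<le> J powr - e * (J powr e * (1 + 1 / (e * ln 2)))"
    by (intro mult_left_mono) auto
  also have "\<dots> = 1 + 1 / (e * ln 2)" using assms by (simp add: powr_minus)
  finally show ?thesis .
qed

lemma weight_ge:
  assumes "\<tau> > 0" "\<sigma> \<ge> 1"
  shows "sqrt \<sigma> / \<tau> ^ m \<le> weight m \<tau> \<sigma>"
  using assms by (simp add: weight_def distrib_left)

text \<open>Start of the iteration: \<theta> = 0 forces \<open>\<delta> = 1\<close>, where the
  trivial count already has the right order.\<close>

lemma near_bound_zero: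
  assumes "L \<ge> 1"
  shows "near_bound TYPE('m::finite) L 0 (85 * L\<^sup>2 * (9 * L) ^ CARD('m))"
  unfolding near_bound_def
proof (intro allI impI)
  fix I :: "(real ^ 'm) set" and X F and G :: "real ^ 'm \<Rightarrow> real ^ 'm" and \<tau> \<sigma> Q B \<delta> :: real
  assume a: "nondeg L I X F G" "0 < \<tau>" "1 \<le> \<sigma>" "1 \<le> Q" "0 < B" "2 * L * B \<le> Q" "B\<^sup>2 \<le> Q * \<sigma> * \<delta>"
    "Q powr - 0 \<le> \<delta>" "\<delta> \<le> 1"
  then have \<delta>: "\<delta> = 1" by simp
  have C: "85 * L\<^sup>2 * (9 * L) ^ CARD('m) \<ge> 0" using assms by simp
  have "real (card (near_pts \<tau> \<sigma> I X F G Q B \<delta>)) \<le> 85 * L\<^sup>2 * (9 * L) ^ CARD('m) * Q ^ (CARD('m) + 1) / \<tau> ^ CARD('m)"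
    using a \<delta> by (intro near_pts_trivial(2)[OF a(1)]) auto
  also have "\<dots> = 85 * L\<^sup>2 * (9 * L) ^ CARD('m) * \<delta> * Q ^ (CARD('m) + 1) * (1 / \<tau> ^ CARD('m))" by (simp add: \<delta>)
  also have "\<dots> \<le> 85 * L\<^sup>2 * (9 * L) ^ CARD('m) * \<delta> * Q ^ (CARD('m) + 1) * weight CARD('m) \<tau> \<sigma>"
  proof (intro mult_left_mono)
    have "1 / \<tau> ^ CARD('m) \<le> sqrt \<sigma> / \<tau> ^ CARD('m)" using a by (intro divide_right_mono) auto
    then show "1 / \<tau> ^ CARD('m) \<le> weight CARD('m) \<tau> \<sigma>" using weight_ge[OF a(2,3), of "CARD('m)"] by linarith
  qed (use C \<delta> a in auto)
  finally show "real (card (near_pts \<tau> \<sigma> I X F G Q B \<delta>)) \<le> 85 * L\<^sup>2 * (9 * L) ^ CARD('m) * \<delta> * Q ^ (CARD('m) + 1) * weight CARD('m) \<tau> \<sigma>" .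
qed

text \<open>If \<open>sqrt (Q * \<sigma> * \<delta>)\<close> is still an allowed radius,
  \<open>B\<close> is enlarged to it and the recursion applies. Otherwise \<sigma> is so large that
  \<open>1 \<le> 2 * L * \<delta> * sqrt \<sigma>\<close>, and the trivial count suffices because
  the weight contains \<open>sqrt \<sigma> / \<tau> ^ m\<close>. The margin \<open>e\<close> absorbs
  the logarithm of the recursion.\<close>

lemma near_bound_step:
  assumes m: "CARD('m::finite) \<ge> 2" and L: "L \<ge> 1"
    and hyp: "near_bound TYPE('m) L \<theta> K" "K \<ge> 0" "0 \<le> \<theta>" "\<theta> \<le> 1"
    and \<theta>': "0 < \<theta>'" "\<theta>' \<le> 1" and e: "e > 0" "2 - \<theta> - 1 / \<theta>' \<le> - e"
  shows "\<exists>K'\<ge>0. near_bound TYPE('m) L \<theta>' K'"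
proof -
  let ?m = "CARD('m)"
  define C where "C = 2 * 24 ^ (?m + 2) * real ?m ^ ?m * (8 * L\<^sup>2 * 3 ^ ?m) * (2 * real ?m + 3) ^ ?m * (12 * L * (4 * L) ^ ?m + (2 * L) ^ ?m)"
  define C1 where "C1 = 85 * L\<^sup>2 * (9 * L) ^ ?m"
  define E where "E = 1 + 1 / (e * ln 2)"
  define K1 where "K1 = C * (2 + K * (2 * E))"
  define K2 where "K2 = 2 * L * C1"
  have pos: "C \<ge> 0" "C1 \<ge> 0" "E \<ge> 0" "K1 \<ge> 0" "K2 \<ge> 0"
    using L e hyp by (auto simp: C_def C1_def E_def K1_def K2_def intro!: mult_nonneg_nonneg add_nonneg_nonneg)
  have "near_bound TYPE('m) L \<theta>' (K1 + K2)"
    unfolding near_bound_def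
  proof (intro allI impI)
    fix I :: "(real ^ 'm) set" and X F and G :: "real ^ 'm \<Rightarrow> real ^ 'm" and \<tau> \<sigma> Q B \<delta> :: real
    assume nd: "nondeg L I X F G" and a: "0 < \<tau>" "1 \<le> \<sigma>" "1 \<le> Q" "0 < B" "2 * L * B \<le> Q" "B\<^sup>2 \<le> Q * \<sigma> * \<delta>"
      "Q powr - \<theta>' \<le> \<delta>" "\<delta> \<le> 1"
    define W where "W = weight ?m \<tau> \<sigma>"
    have W0: "W \<ge> 0" unfolding W_def by (rule weight_nonneg[OF a(1,2)])
    have "0 < Q powr - \<theta>'" using a by simp
    then have \<delta>: "\<delta> > 0" using a by linarith
    have "Q powr - 1 \<le> Q powr - \<theta>'" using a \<theta>' by (intro powr_mono) auto
    then have "Q powr - 1 \<le> \<delta>" using a by linarith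
    then have "1 / Q \<le> \<delta>" using a by (simp add: powr_minus divide_inverse)
    then have Q\<delta>: "1 \<le> Q * \<delta>" using a by (simp add: field_simps)
    have main: "real (card (near_pts \<tau> \<sigma> I X F G Q B \<delta>)) \<le> K1 * (\<delta> * Q ^ (?m + 1)) * W \<or>
       real (card (near_pts \<tau> \<sigma> I X F G Q B \<delta>)) \<le> K2 * (\<delta> * Q ^ (?m + 1)) * W"
    proof (cases "2 * L * sqrt (Q * \<sigma> * \<delta>) \<le> Q")
      case True
      define B' where "B' = sqrt (Q * \<sigma> * \<delta>)"
      have B': "B \<le> B'" "B' > 0" "B'\<^sup>2 = Q * \<sigma> * \<delta>" using a \<delta> by (auto simp: B'_def intro: real_le_rsqrt)
      define s where "s = sqrt \<sigma>"
      have s: "s \<ge> 1" using a by (simp add: s_def)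
      define \<omega> where "\<omega> = sqrt (1 / (Q * \<delta>))"
      define J where "J = 1 / \<delta>"
      have J: "J \<ge> 1" using \<delta> a by (simp add: J_def)
      have \<omega>: "0 < \<omega>" "\<omega> \<le> 1" "\<omega>\<^sup>2 = 1 / (Q * \<delta>)" using a \<delta> Q\<delta> by (auto simp: \<omega>_def)
      have \<sigma>0: "\<sigma> > 0" using a by simp
      have fin: "finite (near_pts \<tau> \<sigma> I X F G Q B' \<delta>)"
        using a \<delta> \<sigma>0 B' True by (intro near_pts_trivial(1)[OF nd]) (auto simp: B'_def)
      have "real (card (near_pts \<tau> \<sigma> I X F G Q B \<delta>)) \<le> real (card (near_pts \<tau> \<sigma> I X F G Q B' \<delta>))"
        using card_mono[OF fin near_pts_mono[OF B'(1) order_refl \<sigma>0]] by simp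
      also have "\<dots> \<le> C * (\<delta> * Q ^ (?m + 1)) * ((1 + s * \<omega>) * (1 / \<tau> ^ ?m + \<omega> ^ ?m / s ^ ?m) +
          K * \<omega> ^ ?m * W * (1 / (Q * \<delta>) + J powr (1 - \<theta>)) * (1 + log 2 J))"
        unfolding C_def W_def J_def s_def \<omega>_def
        by (rule near_pts_recursion[OF hyp nd a(1-3) \<delta> a(8) Q\<delta> B'_def]) (use True in \<open>simp add: B'_def\<close>)
      also have "\<dots> \<le> C * (\<delta> * Q ^ (?m + 1)) * (2 * W + K * (2 * E) * W)"
      proof (intro mult_left_mono add_mono)
        have "s * \<omega> \<le> s" using s \<omega> by (simp add: mult_left_le)
        then have 1: "1 + s * \<omega> \<le> 2 * s" using s by linarith
        have "\<omega> ^ ?m \<le> 1" using \<omega> by (simp add: power_le_one)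
        then have 2: "\<omega> ^ ?m / s ^ ?m \<le> 1 / s ^ ?m" using s by (intro divide_right_mono) auto
        have "(1 + s * \<omega>) * (1 / \<tau> ^ ?m + \<omega> ^ ?m / s ^ ?m) \<le> (2 * s) * (1 / \<tau> ^ ?m + 1 / s ^ ?m)"
          using 1 2 s \<omega> a by (intro mult_mono add_mono add_nonneg_nonneg) auto
        then show "(1 + s * \<omega>) * (1 / \<tau> ^ ?m + \<omega> ^ ?m / s ^ ?m) \<le> 2 * W"
          by (simp add: W_def weight_def s_def)
        \<comment> \<open>The dimension enters here: two factors \<omega> give \<open>J / Q\<close>,
          and \<open>Q \<ge> J powr (1 / \<theta>')\<close> converts that into a power of
          \<open>J\<close>.\<close>
        have "\<omega> ^ ?m \<le> \<omega>\<^sup>2" using \<omega> m by (intro power_decreasing) auto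
        also have "\<omega>\<^sup>2 = J / Q" by (simp add: \<omega>(3) J_def)
        also have "\<dots> \<le> J powr (1 - 1 / \<theta>')"
        proof -
          have "J \<le> Q powr \<theta>'"
          proof -
            have "1 / \<delta> \<le> 1 / (Q powr - \<theta>')" using a \<delta> by (intro divide_left_mono) auto
            then show ?thesis using a by (simp add: J_def powr_minus divide_inverse)
          qed
          then have "J powr (1 / \<theta>') \<le> (Q powr \<theta>') powr (1 / \<theta>')"
            using J \<theta>' by (intro powr_mono2) auto
          also have "\<dots> = Q" using a \<theta>' by (simp add: powr_powr)
          finally have "J powr (1 / \<theta>') \<le> Q" .
          then have "J / Q \<le> J / J powr (1 / \<theta>')" using J a by (intro divide_left_mono) auto
          also have "\<dots> = J powr (1 - 1 / \<theta>')" using J by (simp add: powr_diff)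
          finally show ?thesis .
        qed
        finally have 3: "\<omega> ^ ?m \<le> J powr (1 - 1 / \<theta>')" .
        have "1 / (Q * \<delta>) \<le> 1" using Q\<delta> by simp
        moreover have "1 \<le> J powr (1 - \<theta>)" using J hyp by (simp add: ge_one_powr_ge_zero)
        ultimately have 4: "1 / (Q * \<delta>) + J powr (1 - \<theta>) \<le> 2 * J powr (1 - \<theta>)" by linarith
        have lg: "0 \<le> 1 + log 2 J" using J by simp
        have "\<omega> ^ ?m * (1 / (Q * \<delta>) + J powr (1 - \<theta>)) * (1 + log 2 J)
          \<le> J powr (1 - 1 / \<theta>') * (2 * J powr (1 - \<theta>)) * (1 + log 2 J)"
          using 3 4 \<omega> Q\<delta> lg by (intro mult_right_mono mult_mono) auto
        also have "\<dots> = 2 * (J powr (2 - \<theta> - 1 / \<theta>') * (1 + log 2 J))"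
          using J by (simp add: powr_add[symmetric] algebra_simps)
        also have "\<dots> \<le> 2 * (J powr - e * (1 + log 2 J))"
          using J e lg by (intro mult_left_mono mult_right_mono powr_mono) auto
        also have "\<dots> \<le> 2 * E" using powr_neg_log_bound[OF J e(1)] by (simp add: E_def)
        finally have "(K * W) * (\<omega> ^ ?m * (1 / (Q * \<delta>) + J powr (1 - \<theta>)) * (1 + log 2 J)) \<le> (K * W) * (2 * E)"
          using W0 hyp by (intro mult_left_mono) auto
        then show "K * \<omega> ^ ?m * W * (1 / (Q * \<delta>) + J powr (1 - \<theta>)) * (1 + log 2 J) \<le> K * (2 * E) * W"
          by (simp add: mult_ac)
      qed (use pos a \<delta> in auto)
      also have "\<dots> = K1 * (\<delta> * Q ^ (?m + 1)) * W" by (simp add: K1_def algebra_simps)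
      finally show ?thesis by blast
    next
      case False
      define s where "s = sqrt \<sigma>"
      have s: "s > 0" using a by (simp add: s_def)
      have "Q \<le> 2 * L * (sqrt (Q * \<delta>) * s)"
        using False by (simp add: s_def real_sqrt_mult mult_ac)
      moreover have "Q \<ge> sqrt Q * sqrt Q" using a by simp
      ultimately have "sqrt Q * sqrt Q \<le> 2 * L * (sqrt Q * sqrt \<delta> * s)" by (simp add: real_sqrt_mult)
      then have "sqrt Q * sqrt Q \<le> sqrt Q * (2 * L * (sqrt \<delta> * s))" by (simp only: mult_ac)
      then have "sqrt Q \<le> 2 * L * (sqrt \<delta> * s)" by (rule mult_left_le_imp_le) (use a in simp)
      then have "sqrt \<delta> * sqrt Q \<le> sqrt \<delta> * (2 * L * (sqrt \<delta> * s))" using \<delta> by (intro mult_left_mono) auto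
      also have "\<dots> = 2 * L * (\<delta> * s)" using \<delta> by simp
      also have "sqrt \<delta> * sqrt Q \<ge> 1" using Q\<delta> by (simp add: real_sqrt_mult[symmetric] mult.commute)
      finally have key: "1 \<le> 2 * L * (\<delta> * s)" by simp
      have "real (card (near_pts \<tau> \<sigma> I X F G Q B \<delta>)) \<le> C1 * Q ^ (?m + 1) / \<tau> ^ ?m"
        unfolding C1_def using a \<delta> by (intro near_pts_trivial(2)[OF nd]) auto
      also have "\<dots> = C1 * Q ^ (?m + 1) / \<tau> ^ ?m * 1" by simp
      also have "\<dots> \<le> C1 * Q ^ (?m + 1) / \<tau> ^ ?m * (2 * L * (\<delta> * s))"
        using key pos a by (intro mult_left_mono) auto
      also have "\<dots> = K2 * (\<delta> * Q ^ (?m + 1)) * (s / \<tau> ^ ?m)" by (simp add: K2_def)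
      also have "\<dots> \<le> K2 * (\<delta> * Q ^ (?m + 1)) * W"
        using pos a \<delta> weight_ge[OF a(1,2)] unfolding W_def s_def by (intro mult_left_mono) auto
      finally show ?thesis by blast
    qed
    have "0 \<le> K1 * (\<delta> * Q ^ (?m + 1)) * W" "0 \<le> K2 * (\<delta> * Q ^ (?m + 1)) * W"
      using pos \<delta> a W0 by auto
    moreover have "(K1 + K2) * \<delta> * Q ^ (?m + 1) * W = K1 * (\<delta> * Q ^ (?m + 1)) * W + K2 * (\<delta> * Q ^ (?m + 1)) * W"
      by (simp add: algebra_simps)
    ultimately show "real (card (near_pts \<tau> \<sigma> I X F G Q B \<delta>)) \<le> (K1 + K2) * \<delta> * Q ^ (?m + 1) * weight ?m \<tau> \<sigma>"
      using main unfolding W_def by linarith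
  qed
  moreover have "K1 + K2 \<ge> 0" using pos by simp
  ultimately show ?thesis by blast
qed

lemma near_bound_mono:
  assumes "near_bound TYPE('m::finite) L \<theta> K" "\<theta>' \<le> \<theta>"
  shows "near_bound TYPE('m) L \<theta>' K"
  unfolding near_bound_def
proof (intro allI impI)
  fix I :: "(real ^ 'm) set" and X F and G :: "real ^ 'm \<Rightarrow> real ^ 'm" and \<tau> \<sigma> Q B \<delta> :: real
  assume a: "nondeg L I X F G" "0 < \<tau>" "1 \<le> \<sigma>" "1 \<le> Q" "0 < B" "2 * L * B \<le> Q" "B\<^sup>2 \<le> Q * \<sigma> * \<delta>"
    "Q powr - \<theta>' \<le> \<delta>" "\<delta> \<le> 1"
  have "Q powr - \<theta> \<le> Q powr - \<theta>'" using a assms by (intro powr_mono) auto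
  then have "Q powr - \<theta> \<le> \<delta>" using a by linarith
  then show "real (card (near_pts \<tau> \<sigma> I X F G Q B \<delta>)) \<le> K * \<delta> * Q ^ (CARD('m) + 1) * weight CARD('m) \<tau> \<sigma>"
    using assms(1) a unfolding near_bound_def by blast
qed

text \<open>The exponents \<open>\<theta> = k / (k + 2)\<close> satisfy the condition of \<open>near_bound_step\<close> with a small margin,
  which absorbs the logarithm, and they tend to \<open>1\<close>.\<close>

lemma near_bound_iterate:
  assumes m: "CARD('m::finite) \<ge> 2" and L: "L \<ge> 1"
  shows "\<exists>K\<ge>0. near_bound TYPE('m) L (real k / real (k + 2)) K"
proof (induction k)
  case 0
  show ?case using near_bound_zero[OF L] L by (auto intro!: exI[of _ "85 * L\<^sup>2 * (9 * L) ^ CARD('m)"])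
next
  case (Suc k)
  then obtain K where K: "K \<ge> 0" "near_bound TYPE('m) L (real k / real (k + 2)) K" by blast
  show ?case
  \<comment> \<open>The margin is \<open>2 / (k + 1) - 2 / (k + 2)\<close>, visible once both
    exponents are written as 1 plus or minus a small fraction.\<close>
  proof (rule near_bound_step[OF m L K(2,1), where e = "2 / ((real k + 1) * (real k + 2))"])
    have 1: "real k / real (k + 2) = 1 - 2 / (real k + 2)" by (simp add: field_simps)
    have 2: "1 / (real (Suc k) / real (Suc k + 2)) = 1 + 2 / (real k + 1)" by (simp add: field_simps)
    show "2 - real k / real (k + 2) - 1 / (real (Suc k) / real (Suc k + 2)) \<le> - (2 / ((real k + 1) * (real k + 2)))"
      unfolding 1 2 by (simp add: field_simps)
  qed auto
qed

lemma near_bound_exists: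
  assumes "CARD('m::finite) \<ge> 2" "L \<ge> 1" "\<theta> < 1"
  shows "\<exists>K\<ge>0. near_bound TYPE('m) L \<theta> K"
proof -
  obtain k :: nat where k: "2 / (1 - \<theta>) < real k" using reals_Archimedean2 by blast
  have "\<theta> \<le> real k / real (k + 2)"
  proof -
    have "2 < real k * (1 - \<theta>)" using k assms by (simp add: field_simps)
    then have "2 \<le> (real k + 2) * (1 - \<theta>)" using assms by (simp add: distrib_right)
    then show ?thesis by (simp add: field_simps)
  qed
  then show ?thesis using near_bound_iterate[OF assms(1,2)] near_bound_mono by blast
qed

text \<open>A last pass of the recursion that keeps one factor \<omega> in front of the weight. The
  weight contains \<open>sqrt \<sigma> / \<tau> ^ m\<close>, which for \<tau> = 2^l, \<sigma> =
  2^(ld) and d > 2m grows with l; only together with \<omega> does it match the second term of the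
  theorem.\<close>

lemma near_pts_bound:
  assumes m: "CARD('m::finite) \<ge> 2" and L: "L \<ge> 1" and \<epsilon>: "\<epsilon> > 0"
  obtains C where "C \<ge> 0" 
    "\<And>(I :: (real ^ 'm) set) X F (G :: real ^ 'm \<Rightarrow> real ^ 'm) \<tau> \<sigma> Q \<delta>.
      nondeg L I X F G \<Longrightarrow> \<tau> > 0 \<Longrightarrow> \<sigma> \<ge> 1 \<Longrightarrow> Q \<ge> 1 \<Longrightarrow> Q powr (\<epsilon> - 1) \<le> \<delta> \<Longrightarrow> \<delta> \<le> 1 \<Longrightarrow>
      2 * L * sqrt (Q * \<sigma> * \<delta>) \<le> Q \<Longrightarrow>
      real (card (near_pts \<tau> \<sigma> I X F G Q (sqrt (Q * \<sigma> * \<delta>)) \<delta>)) \<le>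
        C * (\<delta> * Q ^ (CARD('m) + 1)) * (1 / \<tau> ^ CARD('m) + 1 / sqrt \<sigma> ^ CARD('m) + sqrt (1 / (Q * \<delta>)) * weight CARD('m) \<tau> \<sigma>)"
proof -
  let ?m = "CARD('m)"
  define e where "e = min \<epsilon> (1 / 2)"
  have e: "0 < e" "e \<le> 1 / 2" "e \<le> \<epsilon>" using \<epsilon> by (auto simp: e_def)
  \<comment> \<open>\<open>J powr (1 - \<theta>)\<close> is then \<open>J powr (e / 4)\<close>. The
    second factor \<omega> is at most \<open>J powr - (e / 2)\<close>, so
    \<open>J powr - (e / 4)\<close> is left for the logarithm.\<close>
  define \<theta> where "\<theta> = 1 - e / 4"
  have \<theta>: "0 \<le> \<theta>" "\<theta> < 1" "\<theta> \<le> 1" using e by (auto simp: \<theta>_def)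
  obtain K where K: "K \<ge> 0" "near_bound TYPE('m) L \<theta> K" using near_bound_exists[OF m L \<theta>(2)] by blast
  define C where "C = 2 * 24 ^ (?m + 2) * real ?m ^ ?m * (8 * L\<^sup>2 * 3 ^ ?m) * (2 * real ?m + 3) ^ ?m * (12 * L * (4 * L) ^ ?m + (2 * L) ^ ?m)"
  define E where "E = 1 + 1 / (e / 4 * ln 2)"
  have pos: "C \<ge> 0" "E \<ge> 0" using L e by (auto simp: C_def E_def intro!: mult_nonneg_nonneg add_nonneg_nonneg)
  show ?thesis
  proof (rule that[of "C * (1 + K * (2 * E))"])
    show "0 \<le> C * (1 + K * (2 * E))" using pos K by auto
    fix I :: "(real ^ 'm) set" and X F and G :: "real ^ 'm \<Rightarrow> real ^ 'm" and \<tau> \<sigma> Q \<delta> :: real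
    assume nd: "nondeg L I X F G" and a: "0 < \<tau>" "1 \<le> \<sigma>" "1 \<le> Q" "Q powr (\<epsilon> - 1) \<le> \<delta>" "\<delta> \<le> 1"
      "2 * L * sqrt (Q * \<sigma> * \<delta>) \<le> Q"
    have "Q powr (e - 1) \<le> Q powr (\<epsilon> - 1)" using a e by (intro powr_mono) auto
    then have Qe: "Q powr (e - 1) \<le> \<delta>" using a by linarith
    have "0 < Q powr (e - 1)" using a by simp
    then have \<delta>: "\<delta> > 0" using Qe by linarith
    have "Q powr - 1 \<le> Q powr (e - 1)" using a e by (intro powr_mono) auto
    then have "Q powr - 1 \<le> \<delta>" using Qe by linarith
    then have "1 / Q \<le> \<delta>" using a by (simp add: powr_minus divide_inverse)
    then have Q\<delta>: "1 \<le> Q * \<delta>" using a by (simp add: field_simps)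
    define W where "W = weight ?m \<tau> \<sigma>"
    have W0: "W \<ge> 0" unfolding W_def by (rule weight_nonneg[OF a(1,2)])
    define s where "s = sqrt \<sigma>"
    have s: "s \<ge> 1" using a by (simp add: s_def)
    define \<omega> where "\<omega> = sqrt (1 / (Q * \<delta>))"
    define J where "J = 1 / \<delta>"
    have J: "J \<ge> 1" using \<delta> a by (simp add: J_def)
    have \<omega>: "0 < \<omega>" "\<omega> \<le> 1" "\<omega> = sqrt (J / Q)" using a \<delta> Q\<delta> by (auto simp: \<omega>_def J_def)
    have \<omega>J: "\<omega> \<le> J powr - (e / 2)"
    proof -
      have "J \<le> Q powr (1 - e)"
      proof -
        have "1 / \<delta> \<le> 1 / (Q powr (e - 1))" using Qe a \<delta> by (intro divide_left_mono) auto
        also have "\<dots> = Q powr (1 - e)" by (simp add: powr_minus_divide[symmetric])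
        finally show ?thesis by (simp add: J_def)
      qed
      \<comment> \<open>From \<open>J \<le> Q powr (1 - e)\<close>, since (1 - e)(1 + e) \<le> 1;
        hence \<open>J / Q \<le> J powr - e\<close>.\<close>
      then have "J powr (1 + e) \<le> (Q powr (1 - e)) powr (1 + e)" using J e by (intro powr_mono2) auto
      also have "\<dots> = Q powr ((1 - e) * (1 + e))" by (simp add: powr_powr)
      also have "\<dots> \<le> Q powr 1" using a e by (intro powr_mono) (auto simp: algebra_simps)
      finally have "J powr (1 + e) \<le> Q" using a by simp
      then have "J / Q \<le> J / J powr (1 + e)" using J a by (intro divide_left_mono) auto
      also have "\<dots> = J powr - e" using J by (simp add: powr_add powr_minus divide_inverse)
      finally have "\<omega> \<le> sqrt (J powr - e)" unfolding \<omega>(3) by (rule real_sqrt_le_mono)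
      also have "\<dots> = J powr - (e / 2)" using J by (simp add: powr_half_sqrt[symmetric] powr_powr)
      finally show ?thesis .
    qed
    have "real (card (near_pts \<tau> \<sigma> I X F G Q (sqrt (Q * \<sigma> * \<delta>)) \<delta>)) \<le> C * (\<delta> * Q ^ (?m + 1)) * ((1 + s * \<omega>) * (1 / \<tau> ^ ?m + \<omega> ^ ?m / s ^ ?m) +
          K * \<omega> ^ ?m * W * (1 / (Q * \<delta>) + J powr (1 - \<theta>)) * (1 + log 2 J))"
      unfolding C_def W_def J_def s_def \<omega>_def
      by (rule near_pts_recursion[OF K(2,1) \<theta>(1,3) nd a(1-3) \<delta> a(5) Q\<delta> refl a(6)])
    also have "\<dots> \<le> C * (\<delta> * Q ^ (?m + 1)) * ((1 / \<tau> ^ ?m + 1 / s ^ ?m + \<omega> * W) + K * (2 * E) * (\<omega> * W))"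
    proof (intro mult_left_mono add_mono)
      have "\<omega> ^ ?m \<le> 1" using \<omega> by (simp add: power_le_one)
      then have 2: "\<omega> ^ ?m / s ^ ?m \<le> 1 / s ^ ?m" using s by (intro divide_right_mono) auto
      have "(1 + s * \<omega>) * (1 / \<tau> ^ ?m + \<omega> ^ ?m / s ^ ?m) \<le> (1 + s * \<omega>) * (1 / \<tau> ^ ?m + 1 / s ^ ?m)"
        using 2 s \<omega> a by (intro mult_left_mono add_left_mono) auto
      also have "\<dots> = 1 / \<tau> ^ ?m + 1 / s ^ ?m + \<omega> * W"
        by (simp add: W_def weight_def s_def algebra_simps add_divide_distrib)
      finally show "(1 + s * \<omega>) * (1 / \<tau> ^ ?m + \<omega> ^ ?m / s ^ ?m) \<le> 1 / \<tau> ^ ?m + 1 / s ^ ?m + \<omega> * W" .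
      have "\<omega> ^ ?m \<le> \<omega>\<^sup>2" using \<omega> m by (intro power_decreasing) auto
      also have "\<omega>\<^sup>2 \<le> \<omega> * J powr - (e / 2)" unfolding power2_eq_square using \<omega> \<omega>J by (intro mult_left_mono) auto
      finally have 3: "\<omega> ^ ?m \<le> \<omega> * J powr - (e / 2)" .
      have "1 / (Q * \<delta>) \<le> 1" using Q\<delta> by simp
      moreover have "1 \<le> J powr (1 - \<theta>)" using J \<theta> by (simp add: ge_one_powr_ge_zero)
      ultimately have 4: "1 / (Q * \<delta>) + J powr (1 - \<theta>) \<le> 2 * J powr (1 - \<theta>)" by linarith
      have lg: "0 \<le> 1 + log 2 J" using J by simp
      have "\<omega> ^ ?m * (1 / (Q * \<delta>) + J powr (1 - \<theta>)) * (1 + log 2 J)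
        \<le> (\<omega> * J powr - (e / 2)) * (2 * J powr (1 - \<theta>)) * (1 + log 2 J)"
        using 3 4 \<omega> Q\<delta> lg by (intro mult_right_mono mult_mono) auto
      also have "\<dots> = 2 * \<omega> * ((J powr - (e / 2) * J powr (e / 4)) * (1 + log 2 J))"
        by (simp add: \<theta>_def)
      also have "J powr - (e / 2) * J powr (e / 4) = J powr - (e / 4)"
        by (simp add: powr_add[symmetric])
      also have "2 * \<omega> * (J powr - (e / 4) * (1 + log 2 J)) \<le> 2 * \<omega> * E"
        using powr_neg_log_bound[OF J, of "e / 4"] e \<omega> unfolding E_def by (intro mult_left_mono) auto
      finally have "(K * W) * (\<omega> ^ ?m * (1 / (Q * \<delta>) + J powr (1 - \<theta>)) * (1 + log 2 J)) \<le> (K * W) * (2 * \<omega> * E)"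
        using W0 K by (intro mult_left_mono) auto
      then show "K * \<omega> ^ ?m * W * (1 / (Q * \<delta>) + J powr (1 - \<theta>)) * (1 + log 2 J) \<le> K * (2 * E) * (\<omega> * W)"
        by (simp add: mult_ac)
    qed (use pos a \<delta> in auto)
    also have "\<dots> \<le> C * (\<delta> * Q ^ (?m + 1)) * ((1 + K * (2 * E)) * (1 / \<tau> ^ ?m + 1 / s ^ ?m + \<omega> * W))"
    proof (intro mult_left_mono)
      have "K * (2 * E) * (\<omega> * W) \<le> K * (2 * E) * (1 / \<tau> ^ ?m + 1 / s ^ ?m + \<omega> * W)"
        using K pos s a by (intro mult_left_mono) auto
      then show "1 / \<tau> ^ ?m + 1 / s ^ ?m + \<omega> * W + K * (2 * E) * (\<omega> * W) \<le> (1 + K * (2 * E)) * (1 / \<tau> ^ ?m + 1 / s ^ ?m + \<omega> * W)"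
        unfolding distrib_right by simp
    qed (use pos a \<delta> in auto)
    finally show "real (card (near_pts \<tau> \<sigma> I X F G Q (sqrt (Q * \<sigma> * \<delta>)) \<delta>)) \<le>
       C * (1 + K * (2 * E)) * (\<delta> * Q ^ (?m + 1)) * (1 / \<tau> ^ ?m + 1 / sqrt \<sigma> ^ ?m + sqrt (1 / (Q * \<delta>)) * weight ?m \<tau> \<sigma>)"
      unfolding s_def \<omega>_def W_def by (simp only: mult_ac)
  qed
qed

section \<open>Gradients of homogeneous functions\<close>

definition grad :: "(real ^ 'm \<Rightarrow> real) \<Rightarrow> real ^ 'm \<Rightarrow> real ^ 'm" where
  "grad f x = (\<chi> i. partial_deriv i f x)"

lemma has_derivative_grad:
  assumes "f differentiable (at x)"
  shows "(f has_derivative (\<lambda>h. grad f x \<bullet> h)) (at x)"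
proof -
  define D where "D = frechet_derivative f (at x)"
  have D: "(f has_derivative D) (at x)" using assms unfolding D_def by (rule frechet_derivative_works[THEN iffD1])
  then have lin: "linear D" by (rule has_derivative_linear)
  have "D h = grad f x \<bullet> h" for h
  proof -
    have "D h = D (\<Sum>i\<in>UNIV. h $ i *\<^sub>R axis i 1)"
      using basis_expansion[of h] by (simp add: scalar_mult_eq_scaleR)
    also have "\<dots> = (\<Sum>i\<in>UNIV. h $ i * D (axis i 1))"
      by (simp add: linear_sum[OF lin] linear_cmul[OF lin])
    also have "\<dots> = grad f x \<bullet> h"
      by (simp add: grad_def inner_vec_def partial_deriv_def D_def mult.commute)
    finally show ?thesis .
  qed
  then have "D = (\<lambda>h. grad f x \<bullet> h)" by (rule ext)
  then show ?thesis using D by (simp only:)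
qed

text \<open>Entry (i, j) of the Jacobian of \<open>grad f\<close> is the derivative in direction j
  of partial derivative i, which \<open>hessian\<close> stores at (j, i). The transpose has the same
  determinant.\<close>

lemma grad_has_derivative_hessian:
  fixes f :: "real ^ 'm \<Rightarrow> real"
  assumes "\<And>i. partial_deriv i f differentiable (at x)"
  shows "(grad f has_derivative (\<lambda>h. transpose (hessian f x) *v h)) (at x)"
proof -
  have "((\<lambda>y. \<chi> i. partial_deriv i f y) has_derivative (\<lambda>h. \<chi> i. grad (partial_deriv i f) x \<bullet> h)) (at x)"
  proof (rule has_derivative_componentwise_within[THEN iffD2], rule ballI)
    fix b :: "real ^ 'm" assume "b \<in> Basis"
    then obtain i where b: "b = axis i 1" by (auto simp: Basis_vec_def)
    show "((\<lambda>y. (\<chi> i. partial_deriv i f y) \<bullet> b) has_derivative (\<lambda>h. (\<chi> i. grad (partial_deriv i f) x \<bullet> h) \<bullet> b)) (at x)"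
      using has_derivative_grad[OF assms[of i]] unfolding b inner_axis by simp
  qed
  moreover have "(\<lambda>h. \<chi> i. grad (partial_deriv i f) x \<bullet> h) = (\<lambda>h. transpose (hessian f x) *v h)"
    by (rule ext) (simp add: vec_eq_iff grad_def inner_vec_def hessian_def transpose_def matrix_vector_mult_def)
  moreover have "(\<lambda>y. \<chi> i. partial_deriv i f y) = grad f" by (rule ext) (simp add: grad_def)
  ultimately show ?thesis by simp
qed

context
  fixes d :: real and f :: "real ^ 'm \<Rightarrow> real"
  assumes f: "f \<in> nondegenerate_homogeneous_funs d"
begin

lemma homogeneous_scaleR: "l \<ge> 0 \<Longrightarrow> f (l *\<^sub>R x) = l powr d * f x"
  using f by (simp add: nondegenerate_homogeneous_funs_def homogeneous_funs_def)

lemma nondegenerate_C2: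
  shows "x \<noteq> 0 \<Longrightarrow> f differentiable (at x)"
    and "x \<noteq> 0 \<Longrightarrow> partial_deriv i f differentiable (at x)"
    and "continuous_on (- {0}) (partial_deriv j (partial_deriv i f))"
proof -
  have "smooth_on (- {0}) f" using f by (simp add: nondegenerate_homogeneous_funs_def)
  then have "Ck_on (Suc (Suc 0)) (- {0}) f" unfolding smooth_on_def by blast
  then show "x \<noteq> 0 \<Longrightarrow> f differentiable (at x)"
    and "x \<noteq> 0 \<Longrightarrow> partial_deriv i f differentiable (at x)"
    and "continuous_on (- {0}) (partial_deriv j (partial_deriv i f))" by auto
qed

lemma nondegenerate_has_derivative: "x \<noteq> 0 \<Longrightarrow> (f has_derivative (\<lambda>h. grad f x \<bullet> h)) (at x)"
  by (intro has_derivative_grad nondegenerate_C2)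

lemma nondegenerate_grad_has_derivative: "x \<noteq> 0 \<Longrightarrow> (grad f has_derivative (\<lambda>h. transpose (hessian f x) *v h)) (at x)"
  by (intro grad_has_derivative_hessian nondegenerate_C2)

lemma grad_homogeneous:
  assumes "t > 0" "x \<noteq> 0"
  shows "t *\<^sub>R grad f (t *\<^sub>R x) = (t powr d) *\<^sub>R grad f x"
proof -
  have "((\<lambda>y. f (t *\<^sub>R y)) has_derivative (\<lambda>h. grad f (t *\<^sub>R x) \<bullet> (t *\<^sub>R h))) (at x)"
    using assms by (intro has_derivative_compose[OF _ nondegenerate_has_derivative]) (auto intro!: derivative_eq_intros)
  moreover have "((\<lambda>y. t powr d * f y) has_derivative (\<lambda>h. t powr d * (grad f x \<bullet> h))) (at x)"
    using assms by (intro has_derivative_mult_right nondegenerate_has_derivative)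
  moreover have "(\<lambda>y. f (t *\<^sub>R y)) = (\<lambda>y. t powr d * f y)" using assms homogeneous_scaleR by auto
  ultimately have "(\<lambda>h. grad f (t *\<^sub>R x) \<bullet> (t *\<^sub>R h)) = (\<lambda>h. t powr d * (grad f x \<bullet> h))"
    by (auto intro: has_derivative_unique)
  then have "(t *\<^sub>R grad f (t *\<^sub>R x)) \<bullet> h = ((t powr d) *\<^sub>R grad f x) \<bullet> h" for h
    by (metis inner_commute inner_scaleR_left inner_scaleR_right)
  then show ?thesis by (metis vector_eq_rdot)
qed

text \<open>A quantitative inverse function theorem. Near \<open>x0\<close> the Jacobian differs
  from its value \<open>H x0\<close> by at most half of the lower bound \<open>b\<close> of
  \<open>H x0\<close>, so by the mean value inequality \<open>grad f\<close> differs from the linear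
  map \<open>H x0\<close> by a map with Lipschitz constant \<open>b / 2\<close>.\<close>

lemma grad_bilipschitz:
  assumes x0: "x0 \<noteq> 0"
  obtains \<rho> c M where "\<rho> > 0" "\<rho> < norm x0 / 2" "c > 0" 
    "\<forall>x\<in>ball x0 \<rho>. \<forall>y\<in>ball x0 \<rho>. c * norm (y - x) \<le> norm (grad f y - grad f x) \<and>
      norm (grad f y - grad f x) \<le> M * norm (y - x)"
proof -
  define H where "H x = transpose (hessian f x)" for x
  have "det (H x0) \<noteq> 0" using f x0 by (simp add: H_def nondegenerate_homogeneous_funs_def)
  then obtain A where A: "A ** H x0 = mat 1" using invertible_det_nz invertible_left_inverse by blast
  define b where "b = 1 / (onorm ((*v) A) + 1)"
  have A0: "onorm ((*v) A) \<ge> 0" by (rule onorm_pos_le[OF matrix_vector_mul_bounded_linear])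
  have b: "b > 0" "b * norm h \<le> norm (H x0 *v h)" for h
  proof -
    show "b > 0" using A0 by (simp add: b_def)
    have "norm h = norm (A *v (H x0 *v h))" by (simp add: matrix_vector_mul_assoc A)
    also have "\<dots> \<le> onorm ((*v) A) * norm (H x0 *v h)" by (rule onorm[OF matrix_vector_mul_bounded_linear])
    also have "\<dots> \<le> (onorm ((*v) A) + 1) * norm (H x0 *v h)" by (intro mult_right_mono) auto
    finally show "b * norm h \<le> norm (H x0 *v h)" using A0 by (simp add: b_def field_simps)
  qed
  \<comment> \<open>The operator norm is bounded by the sum of all entries in absolute value, hence
    the division by the number of entries.\<close>
  define \<eta> where "\<eta> = b / 2 / (real CARD('m) * real CARD('m))"
  have \<eta>: "\<eta> > 0" using b by (simp add: \<eta>_def)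
  have cont: "continuous (at x0) (\<lambda>x. H x $ i $ j)" for i j
  proof -
    have "(\<lambda>x. H x $ i $ j) = partial_deriv j (partial_deriv i f)"
      by (rule ext) (simp add: H_def transpose_def hessian_def)
    then show ?thesis using nondegenerate_C2(3)[of j i] x0 by (simp add: continuous_on_eq_continuous_at open_Compl)
  qed
  have "\<forall>\<^sub>F x in at x0. \<forall>i j. \<bar>H x $ i $ j - H x0 $ i $ j\<bar> < \<eta>"
    using cont \<eta> unfolding continuous_at tendsto_iff dist_real_def
    by (intro eventually_all_finite) blast
  then obtain \<rho>1 where \<rho>1: "\<rho>1 > 0" "\<And>x i j. x \<noteq> x0 \<Longrightarrow> dist x x0 < \<rho>1 \<Longrightarrow> \<bar>H x $ i $ j - H x0 $ i $ j\<bar> < \<eta>"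
    unfolding eventually_at by blast
  define \<rho> where "\<rho> = min \<rho>1 (norm x0 / 3)"
  have \<rho>: "\<rho> > 0" "\<rho> < norm x0 / 2" using \<rho>1 x0 by (auto simp: \<rho>_def min_def)
  have nz: "x \<noteq> 0" if "x \<in> ball x0 \<rho>" for x
    using that \<rho> by (auto simp: dist_norm)
  have close: "norm ((H x - H x0) *v h) \<le> b / 2 * norm h" if x: "x \<in> ball x0 \<rho>" for x h
  proof -
    have e: "\<bar>(H x - H x0) $ i $ j\<bar> \<le> \<eta>" for i j
    proof (cases "x = x0")
      case False
      then show ?thesis using x \<rho>1(2)[OF False, of i j] by (simp add: \<rho>_def dist_commute)
    qed (use \<eta> in simp)
    have "norm ((H x - H x0) *v h) \<le> (\<Sum>i\<in>UNIV. \<bar>((H x - H x0) *v h) $ i\<bar>)" by (rule norm_le_l1_cart)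
    also have "\<dots> \<le> (\<Sum>i\<in>(UNIV :: 'm set). \<Sum>j\<in>(UNIV :: 'm set). \<eta> * norm h)"
    proof (rule sum_mono)
      fix i
      have "\<bar>((H x - H x0) *v h) $ i\<bar> \<le> (\<Sum>j\<in>UNIV. \<bar>(H x - H x0) $ i $ j * h $ j\<bar>)"
        unfolding matrix_vector_mult_def by (simp only: vec_lambda_beta) (rule sum_abs)
      also have "\<dots> \<le> (\<Sum>j\<in>(UNIV :: 'm set). \<eta> * norm h)"
        unfolding abs_mult using e \<eta> by (intro sum_mono mult_mono component_le_norm_cart) auto
      finally show "\<bar>((H x - H x0) *v h) $ i\<bar> \<le> (\<Sum>j\<in>(UNIV :: 'm set). \<eta> * norm h)" .
    qed
    also have "\<dots> = b / 2 * norm h" by (simp add: \<eta>_def)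
    finally show ?thesis .
  qed
  have diff: "norm ((grad f y - grad f x) - H x0 *v (y - x)) \<le> b / 2 * norm (y - x)"
    if xy: "x \<in> ball x0 \<rho>" "y \<in> ball x0 \<rho>" for x y
  proof -
    have "norm ((grad f y - H x0 *v y) - (grad f x - H x0 *v x)) \<le> b / 2 * norm (y - x)"
    proof (rule differentiable_bound[where S = "ball x0 \<rho>" and f' = "\<lambda>z h. (H z - H x0) *v h"])
      fix z assume z: "z \<in> ball x0 \<rho>"
      have "((\<lambda>z. grad f z - H x0 *v z) has_derivative (\<lambda>h. H z *v h - H x0 *v h)) (at z)"
        using nondegenerate_grad_has_derivative[OF nz[OF z]] unfolding H_def
        by (intro has_derivative_diff bounded_linear.has_derivative[OF matrix_vector_mul_bounded_linear] has_derivative_ident)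
      then show "((\<lambda>z. grad f z - H x0 *v z) has_derivative (\<lambda>h. (H z - H x0) *v h)) (at z within ball x0 \<rho>)"
        by (simp add: matrix_vector_mult_diff_rdistrib has_derivative_at_withinI)
      show "onorm ((*v) (H z - H x0)) \<le> b / 2" using close[OF z] by (intro onorm_bound) (use b in auto)
    qed (use xy in auto)
    then show ?thesis by (simp add: matrix_vector_mult_diff_distrib algebra_simps)
  qed
  define M where "M = onorm ((*v) (H x0)) + b / 2"
  have low: "b / 2 * norm (y - x) \<le> norm (grad f y - grad f x)" if "x \<in> ball x0 \<rho>" "y \<in> ball x0 \<rho>" for x y
    using diff[OF that] b(2)[of "y - x"] norm_triangle_ineq2[of "H x0 *v (y - x)" "grad f y - grad f x"]
    by (simp add: norm_minus_commute)
  have up: "norm (grad f y - grad f x) \<le> M * norm (y - x)" if "x \<in> ball x0 \<rho>" "y \<in> ball x0 \<rho>" for x y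
  proof -
    have "norm (H x0 *v (y - x)) \<le> onorm ((*v) (H x0)) * norm (y - x)" by (rule onorm[OF matrix_vector_mul_bounded_linear])
    then show ?thesis
      using diff[OF that] norm_triangle_ineq2[of "grad f y - grad f x" "H x0 *v (y - x)"]
      by (simp add: M_def distrib_right)
  qed
  show ?thesis using that[of \<rho> "b / 2" M] \<rho> b(1) low up by simp
qed

text \<open>A zero of the gradient would persist along the ray through \<open>x0\<close> by
  homogeneity, against local injectivity; \<open>t\<close> is chosen so that
  \<open>t *\<^sub>R x0\<close> has distance \<open>\<rho> / 2\<close> from
  \<open>x0\<close>.\<close>

lemma grad_nonzero:
  assumes "x0 \<noteq> 0"
  shows "grad f x0 \<noteq> 0"
proof
  assume z: "grad f x0 = 0"
  obtain \<rho> c M where \<rho>: "\<rho> > 0" "\<rho> < norm x0 / 2" and c: "c > 0" 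
    and bl: "\<forall>x\<in>ball x0 \<rho>. \<forall>y\<in>ball x0 \<rho>. c * norm (y - x) \<le> norm (grad f y - grad f x) \<and>
      norm (grad f y - grad f x) \<le> M * norm (y - x)"
    by (rule grad_bilipschitz[OF assms])
  define t where "t = 1 + \<rho> / (2 * norm x0)"
  have t: "t > 0" "t \<noteq> 1" using \<rho> assms by (auto simp: t_def add_pos_nonneg)
  have "grad f (t *\<^sub>R x0) = 0" using grad_homogeneous[OF t(1) assms] z t by simp
  moreover have "x0 - t *\<^sub>R x0 = - (\<rho> / (2 * norm x0)) *\<^sub>R x0" by (simp add: t_def algebra_simps)
  then have n: "norm (x0 - t *\<^sub>R x0) = \<rho> / 2" using \<rho> assms by simp
  then have "t *\<^sub>R x0 \<in> ball x0 \<rho>" using \<rho> by (simp add: dist_norm)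
  ultimately have "c * norm (x0 - t *\<^sub>R x0) \<le> 0" using bl[rule_format, of "t *\<^sub>R x0" x0] \<rho> z by simp
  then show False unfolding n using c \<rho> by (simp add: mult_le_0_iff)
qed

text \<open>The radius is reduced until the gradient stays within a factor 2 of its length at
  \<open>x0\<close>. The mixed remainder bound in \<open>nondeg\<close> follows from the quadratic
  one: the lower Lipschitz bound trades one factor \<open>norm (y - x)\<close> for a difference of
  gradients.\<close>

lemma local_nondeg:
  assumes x0: "x0 \<noteq> 0"
  obtains \<rho> L where "\<rho> > 0" "nondeg L (ball x0 \<rho>) (\<lambda>x. x) f (grad f)"
proof -
  obtain \<rho>0 c M where \<rho>0: "\<rho>0 > 0" "\<rho>0 < norm x0 / 2" and c: "c > 0" 
    and bl: "\<forall>x\<in>ball x0 \<rho>0. \<forall>y\<in>ball x0 \<rho>0. c * norm (y - x) \<le> norm (grad f y - grad f x) \<and>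
      norm (grad f y - grad f x) \<le> M * norm (y - x)"
    by (rule grad_bilipschitz[OF x0])
  have low0: "c * norm (y - x) \<le> norm (grad f y - grad f x)"
    and up0: "norm (grad f y - grad f x) \<le> M * norm (y - x)" if "x \<in> ball x0 \<rho>0" "y \<in> ball x0 \<rho>0" for x y
    using bl that by blast+
  define g0 where "g0 = norm (grad f x0)"
  have g0: "g0 > 0" using grad_nonzero[OF x0] by (simp add: g0_def)
  define M' where "M' = max M 1"
  have M': "M' \<ge> 1" "M \<le> M'" by (auto simp: M'_def)
  define \<rho> where "\<rho> = min \<rho>0 (g0 / (2 * M'))"
  have \<rho>: "\<rho> > 0" "\<rho> \<le> \<rho>0" "M' * \<rho> \<le> g0 / 2"
  proof -
    show "\<rho> > 0" "\<rho> \<le> \<rho>0" using \<rho>0 g0 M' by (auto simp: \<rho>_def)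
    have "M' * \<rho> \<le> M' * (g0 / (2 * M'))" using M' by (intro mult_left_mono) (auto simp: \<rho>_def)
    then show "M' * \<rho> \<le> g0 / 2" using M' by simp
  qed
  have sub: "x \<in> ball x0 \<rho> \<Longrightarrow> x \<in> ball x0 \<rho>0" for x using \<rho> by auto
  note low = low0[OF sub sub]
  have up: "norm (grad f y - grad f x) \<le> M' * norm (y - x)" if "x \<in> ball x0 \<rho>" "y \<in> ball x0 \<rho>" for x y
    using up0[OF sub[OF that(1)] sub[OF that(2)]] mult_right_mono[OF M'(2), of "norm (y - x)"] by simp
  have nx: "norm x0 / 2 \<le> norm x \<and> norm x \<le> 2 * norm x0" if "x \<in> ball x0 \<rho>" for x
  proof -
    have "norm (x0 - x) < norm x0 / 2" using that \<rho> \<rho>0 by (simp add: dist_norm)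
    then show ?thesis using norm_triangle_ineq2[of x0 x] norm_triangle_ineq3[of x0 x] by (simp add: abs_le_iff)
  qed
  have ng: "g0 / 2 \<le> norm (grad f x) \<and> norm (grad f x) \<le> 2 * g0" if "x \<in> ball x0 \<rho>" for x
  proof -
    have "norm (grad f x0 - grad f x) \<le> M' * norm (x0 - x)" using up[OF that] \<rho> by simp
    also have "\<dots> \<le> M' * \<rho>" using that M' by (intro mult_left_mono) (auto simp: dist_norm)
    finally have "norm (grad f x0 - grad f x) \<le> g0 / 2" using \<rho> by linarith
    then show ?thesis using norm_triangle_ineq3[of "grad f x0" "grad f x"] g0 by (simp add: abs_le_iff g0_def[symmetric])
  qed
  have taylor: "\<bar>f y - f x - grad f x \<bullet> (y - x)\<bar> \<le> M' * norm (y - x) * norm (y - x)"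
    if xy: "x \<in> ball x0 \<rho>" "y \<in> ball x0 \<rho>" for x y
  proof -
    have seg: "closed_segment x y \<subseteq> ball x0 \<rho>" using xy by (meson convex_ball convex_contains_segment)
    \<comment> \<open>Mean value inequality on the segment for \<open>f\<close> minus its linear
      part at \<open>x\<close>, whose gradient there is at most
      \<open>M' * norm (y - x)\<close>.\<close>
    have "norm ((f y - grad f x \<bullet> y) - (f x - grad f x \<bullet> x)) \<le> (M' * norm (y - x)) * norm (y - x)"
    proof (rule differentiable_bound[where S = "closed_segment x y" and f' = "\<lambda>z h. grad f z \<bullet> h - grad f x \<bullet> h"])
      fix z assume z: "z \<in> closed_segment x y"
      then have zb: "z \<in> ball x0 \<rho>" using seg by blast
      then have "norm z > 0" using nx x0 by fastforce
      then have "z \<noteq> 0" by simp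
      then have "((\<lambda>z. f z - grad f x \<bullet> z) has_derivative (\<lambda>h. grad f z \<bullet> h - grad f x \<bullet> h)) (at z)"
        by (intro has_derivative_diff nondegenerate_has_derivative has_derivative_inner_right has_derivative_ident)
      then show "((\<lambda>z. f z - grad f x \<bullet> z) has_derivative (\<lambda>h. grad f z \<bullet> h - grad f x \<bullet> h)) (at z within closed_segment x y)"
        by (rule has_derivative_at_withinI)
      show "onorm (\<lambda>h. grad f z \<bullet> h - grad f x \<bullet> h) \<le> M' * norm (y - x)"
      proof (rule onorm_bound)
        fix h :: "real ^ 'm"
        have "norm (z - x) \<le> norm (y - x)" using z segment_bound1[of z x y] by (simp add: norm_minus_commute)
        then have "norm (grad f z - grad f x) \<le> M' * norm (y - x)"
          using up[OF xy(1) zb] M' by (meson mult_left_mono order_trans zero_le_one)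
        then have "norm (grad f z - grad f x) * norm h \<le> M' * norm (y - x) * norm h" by (intro mult_right_mono) auto
        then show "norm (grad f z \<bullet> h - grad f x \<bullet> h) \<le> M' * norm (y - x) * norm h"
          using Cauchy_Schwarz_ineq2[of "grad f z - grad f x" h] by (simp add: inner_diff_left)
      qed (use M' in auto)
    qed (auto simp: xy)
    then show ?thesis by (simp add: inner_diff_right algebra_simps)
  qed
  define L where "L = max 1 (max (2 * norm x0) (max (2 / norm x0) (max (2 * g0) (max (2 / g0) (max (1 / c) (max M' (M' / c)))))))"
  have L: "1 \<le> L" "2 * norm x0 \<le> L" "2 / norm x0 \<le> L" "2 * g0 \<le> L" "2 / g0 \<le> L" "1 / c \<le> L" "M' \<le> L" "M' / c \<le> L"
    unfolding L_def le_max_iff_disj by blast+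
  have inv: "norm (y - x) \<le> (1 / c) * norm (grad f y - grad f x)" if "x \<in> ball x0 \<rho>" "y \<in> ball x0 \<rho>" for x y
    using low[OF that] c by (simp add: pos_le_divide_eq mult.commute)
  have "nondeg L (ball x0 \<rho>) (\<lambda>x. x) f (grad f)"
    unfolding nondeg_def
  proof (intro conjI ballI)
    fix x assume x: "x \<in> ball x0 \<rho>"
    show "norm x \<le> L" using nx[OF x] L by linarith
    have "1 = 2 / norm x0 * (norm x0 / 2)" using x0 by simp
    also have "\<dots> \<le> L * norm x" using nx[OF x] L by (intro mult_mono) auto
    finally show "1 \<le> L * norm x" .
    show "norm (grad f x) \<le> L" using ng[OF x] L by linarith
    have "1 = 2 / g0 * (g0 / 2)" using g0 by simp
    also have "\<dots> \<le> L * norm (grad f x)" using ng[OF x] L g0 by (intro mult_mono) auto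
    finally show "1 \<le> L * norm (grad f x)" .
    fix y assume y: "y \<in> ball x0 \<rho>"
    have "M' * norm (y - x) * norm (y - x) \<le> M' * norm (y - x) * ((1 / c) * norm (grad f y - grad f x))"
      using inv[OF x y] M' by (intro mult_left_mono) auto
    also have "\<dots> = (M' / c) * (norm (y - x) * norm (grad f y - grad f x))" by simp
    also have "\<dots> \<le> L * (norm (y - x) * norm (grad f y - grad f x))" using L by (intro mult_right_mono) auto
    finally show "\<bar>f y - f x - grad f x \<bullet> (y - x)\<bar> \<le> L * norm (y - x) * norm (grad f y - grad f x)"
      using taylor[OF x y] by (simp add: mult.assoc)
    show "norm (grad f y - grad f x) \<le> L * norm (y - x)"
      using up[OF x y] mult_right_mono[OF L(7), of "norm (y - x)"] by simp
    show "norm (y - x) \<le> L * norm (grad f y - grad f x)"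
      using inv[OF x y] mult_right_mono[OF L(6), of "norm (grad f y - grad f x)"] by simp
  qed (rule L(1))
  then show ?thesis using that \<rho> by blast
qed

end

lemma nondeg_mono:
  assumes "nondeg L I X F G" "L \<le> L'"
  shows "nondeg L' I X F G"
proof -
  note n = nondegD[OF assms(1)]
  have L: "L \<ge> 1" by (rule n(1))
  have mono: "L * x \<le> L' * x" if "x \<ge> 0" for x :: real using assms(2) that by (rule mult_right_mono)
  show ?thesis
    unfolding nondeg_def
  proof (intro conjI ballI)
    show "1 \<le> L'" using L assms(2) by linarith
    fix c assume c: "c \<in> I"
    show "norm (X c) \<le> L'" "norm (G c) \<le> L'" using n(2,4)[OF c] assms(2) by linarith+
    show "1 \<le> L' * norm (X c)" "1 \<le> L' * norm (G c)"
      using n(3,5)[OF c] mono[of "norm (X c)"] mono[of "norm (G c)"] by simp_all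
    fix c' assume c': "c' \<in> I"
    have "L * norm (X c' - X c) * norm (G c' - G c) \<le> L' * norm (X c' - X c) * norm (G c' - G c)"
      by (intro mult_right_mono mono) auto
    then show "\<bar>F c' - F c - G c \<bullet> (X c' - X c)\<bar> \<le> L' * norm (X c' - X c) * norm (G c' - G c)"
      using n(6)[OF c c'] by linarith
    show "norm (G c' - G c) \<le> L' * norm (X c' - X c)" "norm (X c' - X c) \<le> L' * norm (G c' - G c)"
      using n(7,8)[OF c c'] mono[of "norm (X c' - X c)"] mono[of "norm (G c' - G c)"] by simp_all
  qed
qed

text \<open>\<open>nondeg\<close> contains injectivity of the gradient, which is available only
  locally; compactness leaves finitely many pieces, and the largest of their constants serves
  all.\<close>

lemma annulus_cover:
  fixes f :: "real ^ 'm \<Rightarrow> real"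
  assumes "f \<in> nondegenerate_homogeneous_funs d"
  obtains \<I> L where "finite \<I>" "L \<ge> 1" "\<forall>I\<in>\<I>. nondeg L I (\<lambda>x. x) f (grad f)"
    "\<forall>y. 1 / 2 \<le> norm y \<longrightarrow> norm y \<le> 1 \<longrightarrow> (\<exists>I\<in>\<I>. y \<in> I)"
proof -
  define K where "K = cball 0 1 - ball (0 :: real ^ 'm) (1 / 2)"
  have "compact K" unfolding K_def by (intro compact_diff) auto
  define \<U> where "\<U> = {U. open U \<and> (\<exists>L. nondeg L U (\<lambda>x. x) f (grad f))}"
  have "K \<subseteq> \<Union>\<U>"
  proof
    fix y assume "y \<in> K"
    then have "y \<noteq> 0" by (auto simp: K_def)
    then obtain \<rho> L where "\<rho> > 0" "nondeg L (ball y \<rho>) (\<lambda>x. x) f (grad f)" by (rule local_nondeg[OF assms])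
    then show "y \<in> \<Union>\<U>" unfolding \<U>_def by (intro UnionI[of "ball y \<rho>"]) auto
  qed
  moreover have "\<forall>U\<in>\<U>. open U" by (simp add: \<U>_def)
  ultimately obtain \<I> where \<I>: "\<I> \<subseteq> \<U>" "finite \<I>" "K \<subseteq> \<Union>\<I>"
    using compactE[OF \<open>compact K\<close>, of \<U>] by metis
  have "\<forall>I\<in>\<I>. \<exists>L. nondeg L I (\<lambda>x. x) f (grad f)" using \<I> by (auto simp: \<U>_def)
  then obtain l where l: "\<And>I. I \<in> \<I> \<Longrightarrow> nondeg (l I) I (\<lambda>x. x) f (grad f)" by metis
  define L where "L = Max (insert 1 (l ` \<I>))"
  have L1: "L \<ge> 1" unfolding L_def using \<I>(2) by (intro Max_ge) auto
  have "l I \<le> L" if "I \<in> \<I>" for I unfolding L_def using \<I>(2) that by (intro Max_ge) auto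
  then have "\<forall>I\<in>\<I>. nondeg L I (\<lambda>x. x) f (grad f)" using l nondeg_mono by blast
  moreover have "\<forall>y. 1 / 2 \<le> norm y \<longrightarrow> norm y \<le> 1 \<longrightarrow> (\<exists>I\<in>\<I>. y \<in> I)"
    using \<I>(3) by (auto simp: K_def subset_iff)
  ultimately show ?thesis using that \<I>(2) L1 by blast
qed

section \<open>Reduction of the count to annuli and a ball around the origin\<close>

lemma infdist_Ints_le_iff: "infdist t \<int> \<le> \<delta> \<longleftrightarrow> (\<exists>b :: int. \<bar>t - real_of_int b\<bar> \<le> \<delta>)"
proof
  assume le: "infdist t \<int> \<le> \<delta>"
  have "closed (\<int> :: real set)" "(\<int> :: real set) \<noteq> {}" by auto
  then obtain x where "x \<in> \<int>" "infdist t \<int> = dist t x" by (rule infdist_attains_inf)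
  then show "\<exists>b :: int. \<bar>t - real_of_int b\<bar> \<le> \<delta>" using le by (auto simp: dist_real_def elim!: Ints_cases)
next
  assume "\<exists>b :: int. \<bar>t - real_of_int b\<bar> \<le> \<delta>"
  then obtain b :: int where b: "\<bar>t - real_of_int b\<bar> \<le> \<delta>" ..
  have "infdist t \<int> \<le> dist t (real_of_int b)" by (intro infdist_le) auto
  then show "infdist t \<int> \<le> \<delta>" using b by (simp add: dist_real_def)
qed

lemma rational_point_eq: "rational_point q a = (1 / real_of_int q) *\<^sub>R real_vec a"
  by (simp add: vec_eq_iff rational_point_def)

definition N_set :: "(real ^ 'm \<Rightarrow> real) \<Rightarrow> real \<Rightarrow> real \<Rightarrow> (int \<times> (int ^ 'm)) set" where
  "N_set f \<delta> Q = {(q, a). Q \<le> real_of_int q \<and> real_of_int q < 2 * Q \<and> norm (real_vec a) < real_of_int q \<and>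
     (\<exists>b :: int. \<bar>real_of_int q * f (rational_point q a) - real_of_int b\<bar> \<le> \<delta>)}"

lemma N_count_eq:
  assumes "Q > 0"
  shows "N_count f \<delta> Q = card (N_set f \<delta> Q)"
proof -
  have "real_of_int q / Q \<in> {1..<2} \<and> norm (rational_point q a) < 1 \<longleftrightarrow>
     Q \<le> real_of_int q \<and> real_of_int q < 2 * Q \<and> norm (real_vec a) < real_of_int q" for q :: int and a :: "int ^ 'a"
  proof (cases "real_of_int q > 0")
    case True
    then show ?thesis using assms by (auto simp: rational_point_eq field_simps)
  next
    case False
    then have "real_of_int q / Q \<le> 0" using assms by (simp add: divide_le_0_iff)
    then show ?thesis using False assms by auto
  qed
  then show ?thesis
    unfolding N_count_def N_set_def infdist_Ints_le_iff by (intro arg_cong[where f = card]) blast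
qed

lemma finite_N_set: 
  assumes "Q > 0" shows "finite (N_set f \<delta> Q)"
proof -
  have "N_set f \<delta> Q \<subseteq> {q. \<bar>real_of_int q - 0\<bar> \<le> 2 * Q} \<times> {a. norm (1 *\<^sub>R real_vec a - 0) \<le> 2 * Q}"
    using assms by (auto simp: N_set_def)
  moreover have "finite \<dots>"
    using assms by (intro finite_cartesian_product card_int_interval(1) finite_lattice_ball) auto
  ultimately show ?thesis by (rule finite_subset)
qed

text \<open>With the scaled fraction \<open>z\<close> itself as base point the displacement
  vanishes, so the residual is \<sigma> times the original error and every nonnegative radius is
  possible; the radius named is the one that \<open>near_pts_bound\<close> treats.\<close>

lemma N_set_dyadic:
  fixes f :: "real ^ 'm \<Rightarrow> real"
  assumes f: "f \<in> nondegenerate_homogeneous_funs d" and pos: "Q > 0" "\<delta> > 0"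
    and y: "(q, a) \<in> N_set f \<delta> Q" "(1 / 2) ^ (l + 1) \<le> norm (rational_point q a)" "norm (rational_point q a) \<le> (1 / 2) ^ l"
    and \<I>: "\<forall>y. 1 / 2 \<le> norm y \<longrightarrow> norm y \<le> 1 \<longrightarrow> (\<exists>I\<in>\<I>. y \<in> I)"
  shows "\<exists>I\<in>\<I>. \<exists>b. (q, a, b) \<in> near_pts (2 ^ l) ((2 ^ l) powr d) I (\<lambda>x. x) f (grad f) Q (sqrt (Q * (2 ^ l) powr d * \<delta>)) \<delta>"
proof -
  define z where "z = (2 ^ l) *\<^sub>R rational_point q a"
  have q: "Q \<le> real_of_int q" "real_of_int q < 2 * Q" "real_of_int q > 0" using y(1) pos by (auto simp: N_set_def)
  obtain b :: int where b: "\<bar>real_of_int q * f (rational_point q a) - real_of_int b\<bar> \<le> \<delta>"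
    using y(1) by (auto simp: N_set_def)
  have "1 / 2 \<le> norm z" "norm z \<le> 1"
    using y(2,3) by (simp_all add: z_def power_one_over field_simps)
  then obtain I where I: "I \<in> \<I>" "z \<in> I" using \<I> by blast
  have fz: "f z = (2 ^ l) powr d * f (rational_point q a)" unfolding z_def by (rule homogeneous_scaleR[OF f]) simp
  have zero: "(2 ^ l) *\<^sub>R real_vec a - real_of_int q *\<^sub>R z = 0" using q by (simp add: z_def rational_point_eq)
  have "\<bar>(2 ^ l) powr d * real_of_int b - real_of_int q * f z\<bar> = (2 ^ l) powr d * \<bar>real_of_int q * f (rational_point q a) - real_of_int b\<bar>"
  proof -
    have "(2 ^ l) powr d * real_of_int b - real_of_int q * f z = - ((2 ^ l) powr d * (real_of_int q * f (rational_point q a) - real_of_int b))"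
      by (simp add: fz algebra_simps)
    then show ?thesis by (simp add: abs_mult)
  qed
  also have "\<dots> \<le> (2 ^ l) powr d * \<delta>" using b by (intro mult_left_mono) auto
  finally have "(q, a, b) \<in> pts (2 ^ l) ((2 ^ l) powr d) z (f z) (grad f z) (2 * Q) (sqrt (Q * (2 ^ l) powr d * \<delta>)) \<delta>"
    unfolding pts_def using q pos by (simp add: zero)
  then show ?thesis using I q unfolding near_pts_def by auto
qed

text \<open>The condition on \<open>f\<close> is dropped. For \<mu> of order (\<delta>/Q)^(1/d) the
  bound has the order of the second term of the theorem plus \<open>Q\<close>.\<close>

lemma N_set_small:
  fixes f :: "real ^ 'm \<Rightarrow> real"
  assumes Q: "Q \<ge> 1" and \<mu>: "\<mu> \<ge> 0"
  shows "real (card {(q, a) \<in> N_set f \<delta> Q. norm (rational_point q a) \<le> \<mu>}) \<le> 5 * Q * (2 ^ CARD('m) * (1 + (4 * Q * \<mu>) ^ CARD('m)))"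
proof -
  let ?A = "{q. \<bar>real_of_int q - 0\<bar> \<le> 2 * Q}" and ?B = "{a :: int ^ 'm. norm (1 *\<^sub>R real_vec a - 0) \<le> 2 * Q * \<mu>}"
  have sub: "{(q, a) \<in> N_set f \<delta> Q. norm (rational_point q a) \<le> \<mu>} \<subseteq> ?A \<times> ?B"
  proof safe
    fix q and a :: "int ^ 'm" assume a: "(q, a) \<in> N_set f \<delta> Q" "norm (rational_point q a) \<le> \<mu>"
    then have q: "0 < real_of_int q" "real_of_int q < 2 * Q" using Q by (auto simp: N_set_def)
    then show "\<bar>real_of_int q - 0\<bar> \<le> 2 * Q" by simp
    have "norm (real_vec a) \<le> real_of_int q * \<mu>" using a(2) q by (simp add: rational_point_eq field_simps)
    also have "\<dots> \<le> 2 * Q * \<mu>" using q \<mu> by (intro mult_right_mono) auto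
    finally show "norm (1 *\<^sub>R real_vec a - 0) \<le> 2 * Q * \<mu>" by simp
  qed
  have fin: "finite ?A" "finite ?B" using Q \<mu> by (intro card_int_interval(1) finite_lattice_ball; simp)+
  have "card {(q, a) \<in> N_set f \<delta> Q. norm (rational_point q a) \<le> \<mu>} \<le> card (?A \<times> ?B)"
    using fin by (intro card_mono sub) auto
  then have "real (card {(q, a) \<in> N_set f \<delta> Q. norm (rational_point q a) \<le> \<mu>}) \<le> real (card ?A) * real (card ?B)"
    unfolding card_cartesian_product of_nat_mult[symmetric] of_nat_le_iff .
  also have "\<dots> \<le> (5 * Q) * (2 ^ CARD('m) * (1 + (4 * Q * \<mu>) ^ CARD('m)))"
  proof (rule mult_mono)
    have "real (card ?A) \<le> 2 * (2 * Q) + 1" by (rule card_int_interval(2)) (use Q in simp)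
    then show "real (card ?A) \<le> 5 * Q" using Q by linarith
    have "real (card ?B) \<le> (2 * (2 * Q * \<mu>) / 1 + 1) ^ CARD('m)" using Q \<mu> by (intro card_lattice_ball_le) auto
    also have "\<dots> = (1 + 4 * Q * \<mu>) ^ CARD('m)" by (simp add: add.commute mult.assoc)
    also have "\<dots> \<le> 2 ^ CARD('m) * (1 + (4 * Q * \<mu>) ^ CARD('m))" using Q \<mu> by (intro one_plus_power_le) auto
    finally show "real (card ?B) \<le> 2 ^ CARD('m) * (1 + (4 * Q * \<mu>) ^ CARD('m))" .
  qed (use Q in auto)
  finally show ?thesis .
qed

lemma log_le_powr:
  assumes "\<epsilon> > 0"
  obtains E where "E \<ge> 0" "\<And>Q. Q \<ge> 1 \<Longrightarrow> 1 + log 2 (Q\<^sup>2) \<le> E * Q powr \<epsilon>"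
proof (rule that[of "2 * (1 + 1 / (\<epsilon> * ln 2))"])
  show "0 \<le> 2 * (1 + 1 / (\<epsilon> * ln 2))" using assms by simp
  fix Q :: real assume Q: "Q \<ge> 1"
  have "Q powr \<epsilon> * (Q powr - \<epsilon> * (1 + log 2 Q)) \<le> Q powr \<epsilon> * (1 + 1 / (\<epsilon> * ln 2))"
    using powr_neg_log_bound[OF Q assms] by (intro mult_left_mono) auto
  moreover have "Q powr \<epsilon> * (Q powr - \<epsilon> * (1 + log 2 Q)) = 1 + log 2 Q"
    using Q by (simp add: powr_minus)
  moreover have "log 2 (Q\<^sup>2) = 2 * log 2 Q" using Q by (simp add: log_nat_power)
  moreover have "2 * (1 + 1 / (\<epsilon> * ln 2)) * Q powr \<epsilon> = 2 * (Q powr \<epsilon> * (1 + 1 / (\<epsilon> * ln 2)))"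
    by (simp only: mult_ac)
  ultimately show "1 + log 2 (Q\<^sup>2) \<le> 2 * (1 + 1 / (\<epsilon> * ln 2)) * Q powr \<epsilon>" by linarith
qed

section \<open>The upper bound\<close>

lemma sum_half_powers_le: "finite A \<Longrightarrow> (\<Sum>l\<in>A. (1 / 2 :: real) ^ l) \<le> 2"
  using sum_le_suminf[of "\<lambda>l. (1 / 2 :: real) ^ l" A] suminf_geometric[of "1 / 2 :: real"]
  by (simp add: summable_geometric)

text \<open>Prepares the sum over the annuli. Two terms decay geometrically in \<open>l\<close>:
  \<open>d > 1\<close> gives \<open>\<sigma> \<ge> \<tau>\<close>, and \<open>m \<ge> 2\<close>
  gives \<open>sqrt \<sigma> ^ m \<ge> \<sigma>\<close>. The term
  \<open>\<omega> * sqrt \<sigma> / \<tau> ^ m\<close> is bounded by \<omega> unless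
  \<open>d > 2 * m\<close>; then it grows with \<open>l\<close>, and
  \<open>\<sigma> \<le> Q / \<delta>\<close> bounds it by its size at the innermost annulus.\<close>

lemma dyadic_term_bound:
  fixes d L Q \<delta> :: real and m l :: nat
  assumes m: "m \<ge> 2" and d: "d > 1" and L: "L \<ge> 1" and pos: "Q \<ge> 1" "\<delta> > 0"
    and l: "4 * L\<^sup>2 * \<delta> * (2 ^ l) powr d \<le> Q"
  defines "\<sigma> \<equiv> (2 ^ l) powr d" and "\<omega> \<equiv> sqrt (1 / (Q * \<delta>))"
  shows "1 / (2 ^ l) ^ m + 1 / sqrt \<sigma> ^ m + \<omega> * weight m (2 ^ l) \<sigma> \<le>
    2 * (1 / 2) ^ l + \<omega> + (if d \<le> 2 * real m then \<omega> else 1 / \<delta> * (\<delta> / Q) powr (real m / d))"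
proof -
  define \<tau> :: real where "\<tau> = 2 ^ l"
  have \<tau>: "\<tau> \<ge> 1" by (simp add: \<tau>_def)
  have \<sigma>\<tau>: "\<sigma> = \<tau> powr d" by (simp add: \<sigma>_def \<tau>_def)
  have "\<tau> powr 1 \<le> \<tau> powr d" using \<tau> d by (intro powr_mono) auto
  then have \<sigma>: "\<sigma> \<ge> \<tau>" "\<sigma> \<ge> 1" using \<tau> by (auto simp: \<sigma>\<tau>)
  define v where "v = sqrt \<sigma>"
  have v: "v \<ge> 1" "v\<^sup>2 = \<sigma>" using \<sigma> by (auto simp: v_def)
  have \<omega>: "\<omega> \<ge> 0" using pos by (simp add: \<omega>_def)
  have half: "1 / \<tau> = (1 / 2) ^ l" by (simp add: \<tau>_def power_one_over)
  have "\<tau> ^ 1 \<le> \<tau> ^ m" using \<tau> m by (intro power_increasing) auto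
  then have t1: "1 / \<tau> ^ m \<le> (1 / 2) ^ l" unfolding half[symmetric] using \<tau> by (intro divide_left_mono) auto
  have "v\<^sup>2 \<le> v ^ m" using v m by (intro power_increasing) auto
  then have "\<tau> \<le> v ^ m" using v \<sigma> by linarith
  then have t2: "1 / v ^ m \<le> (1 / 2) ^ l" unfolding half[symmetric] using \<tau> by (intro divide_left_mono) auto
  have "v ^ 1 \<le> v ^ m" using v m by (intro power_increasing) auto
  then have "v / v ^ m \<le> 1" using v by simp
  then have t3: "\<omega> * (v / v ^ m) \<le> \<omega>" using \<omega> by (rule mult_left_le)
  have t4: "\<omega> * (v / \<tau> ^ m) \<le> (if d \<le> 2 * real m then \<omega> else 1 / \<delta> * (\<delta> / Q) powr (real m / d))"
  proof (cases "d \<le> 2 * real m")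
    case True
    have "v = \<tau> powr (d / 2)" using \<tau> by (simp add: v_def \<sigma>\<tau> powr_half_sqrt[symmetric] powr_powr)
    also have "\<dots> \<le> \<tau> powr real m" using \<tau> True by (intro powr_mono) auto
    also have "\<dots> = \<tau> ^ m" using \<tau> by (simp add: powr_realpow)
    finally have "v / \<tau> ^ m \<le> 1" using \<tau> by simp
    then have "\<omega> * (v / \<tau> ^ m) \<le> \<omega>" using \<omega> by (rule mult_left_le)
    then show ?thesis using True by simp
  next
    case False
    \<comment> \<open>Since \<open>\<tau> ^ m = \<sigma> powr (m / d)\<close>, this is the exponent
      of \<sigma> in \<open>sqrt \<sigma> / \<tau> ^ m\<close>.\<close>
    define e where "e = 1 / 2 - real m / d"
    have e: "e \<ge> 0" using False d by (simp add: e_def field_simps)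
    have "\<tau> ^ m = \<sigma> powr (real m / d)"
      using \<tau> d by (simp add: \<sigma>\<tau> powr_powr powr_realpow)
    then have "v / \<tau> ^ m = \<sigma> powr e"
      using \<sigma> by (simp add: v_def e_def powr_diff powr_half_sqrt)
    also have "\<dots> \<le> (Q / \<delta>) powr e"
    proof (rule powr_mono2)
      have "1 \<le> L\<^sup>2" using L by simp
      then have "1 \<le> 4 * L\<^sup>2" by linarith
      then have "1 * (\<delta> * \<sigma>) \<le> 4 * L\<^sup>2 * (\<delta> * \<sigma>)" using pos \<sigma> by (intro mult_right_mono) auto
      then have "\<delta> * \<sigma> \<le> Q" using l by (simp add: \<sigma>_def mult.assoc)
      then show "\<sigma> \<le> Q / \<delta>" using pos by (simp add: field_simps)
    qed (use e \<sigma> in auto)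
    finally have "\<omega> * (v / \<tau> ^ m) \<le> \<omega> * (Q / \<delta>) powr e" using \<omega> by (intro mult_left_mono)
    also have "(Q / \<delta>) powr e = sqrt (Q / \<delta>) * (\<delta> / Q) powr (real m / d)"
    proof -
      have "(\<delta> / Q) powr (real m / d) = (Q / \<delta>) powr - (real m / d)"
      proof -
        have "\<delta> / Q = inverse (Q / \<delta>)" by simp
        then show ?thesis using pos by (simp only: inverse_powr powr_minus)
      qed
      moreover have "sqrt (Q / \<delta>) = (Q / \<delta>) powr (1 / 2)" using pos by (simp add: powr_half_sqrt)
      moreover have "e = 1 / 2 + - (real m / d)" by (simp add: e_def)
      ultimately show ?thesis by (simp only: powr_add)
    qed
    also have "\<omega> * (sqrt (Q / \<delta>) * (\<delta> / Q) powr (real m / d)) = 1 / \<delta> * (\<delta> / Q) powr (real m / d)"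
    proof -
      have "\<omega> * sqrt (Q / \<delta>) = sqrt (1 / (Q * \<delta>) * (Q / \<delta>))" unfolding \<omega>_def by (rule real_sqrt_mult[symmetric])
      also have "1 / (Q * \<delta>) * (Q / \<delta>) = (1 / \<delta>)\<^sup>2" using pos by (simp add: power2_eq_square)
      also have "sqrt ((1 / \<delta>)\<^sup>2) = 1 / \<delta>" using pos by simp
      finally show ?thesis by (simp flip: mult.assoc)
    qed
    finally show ?thesis using False by simp
  qed
  have "\<omega> * weight m \<tau> \<sigma> = \<omega> * (v / \<tau> ^ m) + \<omega> * (v / v ^ m)"
    by (simp add: weight_def v_def algebra_simps)
  then show ?thesis using t1 t2 t3 t4 unfolding \<tau>_def[symmetric] v_def[symmetric] by linarith
qed

text \<open>The annuli in \<Lambda> are those that \<open>near_pts_bound\<close> can handle; all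
  others lie in the ball of radius \<mu> and are counted trivially as \<open>Res\<close>.\<close>

lemma N_set_upper_bound:
  fixes f :: "real ^ 'm \<Rightarrow> real"
  assumes m: "CARD('m) \<ge> 2" and d: "d > 1" and f: "f \<in> nondegenerate_homogeneous_funs d" and \<epsilon>: "\<epsilon> > 0"
  obtains C where "C \<ge> 0"
    "\<forall>\<delta> Q. (\<delta>, Q) \<in> admissible \<epsilon> \<longrightarrow> real (card (N_set f \<delta> Q)) \<le>
      C * (\<delta> * Q ^ (CARD('m) + 1) +
        (\<delta> / Q) powr (real CARD('m) / d) * Q ^ (CARD('m) + 1) * (if d \<le> 2 * real CARD('m) then 1 else Q powr \<epsilon>))"
proof -
  let ?m = "CARD('m)"
  obtain \<I> L where \<I>: "finite \<I>" and L: "L \<ge> 1" and nd: "\<forall>I\<in>\<I>. nondeg L I (\<lambda>x. x) f (grad f)"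
    and cover: "\<forall>y. 1 / 2 \<le> norm y \<longrightarrow> norm y \<le> 1 \<longrightarrow> (\<exists>I\<in>\<I>. y \<in> I)"
    by (rule annulus_cover[OF f])
  obtain C1 where C1: "C1 \<ge> 0" and bound: "\<And>(I :: (real ^ 'm) set) X F (G :: real ^ 'm \<Rightarrow> real ^ 'm) \<tau> \<sigma> Q \<delta>.
      nondeg L I X F G \<Longrightarrow> \<tau> > 0 \<Longrightarrow> \<sigma> \<ge> 1 \<Longrightarrow> Q \<ge> 1 \<Longrightarrow> Q powr (\<epsilon> - 1) \<le> \<delta> \<Longrightarrow> \<delta> \<le> 1 \<Longrightarrow>
      2 * L * sqrt (Q * \<sigma> * \<delta>) \<le> Q \<Longrightarrow>
      real (card (near_pts \<tau> \<sigma> I X F G Q (sqrt (Q * \<sigma> * \<delta>)) \<delta>)) \<le>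
        C1 * (\<delta> * Q ^ (?m + 1)) * (1 / \<tau> ^ ?m + 1 / sqrt \<sigma> ^ ?m + sqrt (1 / (Q * \<delta>)) * weight ?m \<tau> \<sigma>)"
    by (rule near_pts_bound[OF m L \<epsilon>]) blast
  have "\<epsilon> / 2 > 0" using \<epsilon> by simp
  then obtain E where E: "E \<ge> 0" and logE: "\<And>Q. Q \<ge> 1 \<Longrightarrow> 1 + log 2 (Q\<^sup>2) \<le> E * Q powr (\<epsilon> / 2)"
    by (rule log_le_powr) blast
  define c4 where "c4 = 4 ^ ?m * (4 * L\<^sup>2) powr (real ?m / d)"
  have c4: "c4 \<ge> 0" by (simp add: c4_def)
  define C where "C = C1 * real (card \<I>) * (4 + 2 * E) + 5 * 2 ^ ?m * (1 + c4)"
  have C0: "C \<ge> 0" using C1 E c4 by (simp add: C_def)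
  show ?thesis
  proof (rule that[OF C0], intro allI impI)
    fix \<delta> Q assume adm: "(\<delta>, Q) \<in> admissible \<epsilon>"
    then have a: "Q \<ge> 1" "Q powr (\<epsilon> - 1) < \<delta>" "\<delta> < 1 / 2" by (auto simp: admissible_def)
    have Q0: "Q > 0" using a by simp
    have "0 < Q powr (\<epsilon> - 1)" using Q0 by simp
    then have \<delta>: "\<delta> > 0" using a by linarith
    have Qe: "Q powr \<epsilon> \<le> Q * \<delta>"
    proof -
      have "Q powr \<epsilon> = Q * Q powr (\<epsilon> - 1)" using Q0 by (simp add: powr_diff)
      also have "\<dots> \<le> Q * \<delta>" using Q0 a by (intro mult_left_mono) auto
      finally show ?thesis .
    qed
    have Qe1: "1 \<le> Q powr \<epsilon>" using a \<epsilon> by (simp add: ge_one_powr_ge_zero)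
    then have Q\<delta>: "1 \<le> Q * \<delta>" using Qe by linarith
    define \<omega> where "\<omega> = sqrt (1 / (Q * \<delta>))"
    have \<omega>0: "\<omega> \<ge> 0" using Q0 \<delta> by (simp add: \<omega>_def)
    have \<omega>: "\<omega> \<le> Q powr - (\<epsilon> / 2)"
    proof -
      have "1 / (Q * \<delta>) \<le> 1 / Q powr \<epsilon>" using Qe Q0 \<delta> by (intro divide_left_mono) auto
      also have "\<dots> = Q powr - \<epsilon>" by (simp add: powr_minus divide_inverse)
      finally have "\<omega> \<le> sqrt (Q powr - \<epsilon>)" unfolding \<omega>_def by (rule real_sqrt_le_mono)
      also have "\<dots> = Q powr - (\<epsilon> / 2)" using Q0 by (simp add: powr_half_sqrt[symmetric] powr_powr)
      finally show ?thesis .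
    qed
    \<comment> \<open>This is \<open>2 * L * sqrt (Q * \<sigma> * \<delta>) \<le> Q\<close> squared,
      for \<open>\<sigma> = (2 ^ l) powr d\<close>.\<close>
    define \<Lambda> where "\<Lambda> = {l :: nat. 4 * L\<^sup>2 * \<delta> * (2 ^ l) powr d \<le> Q}"
    have L2: "1 \<le> L\<^sup>2" using L by simp
    have "\<Lambda> \<subseteq> {l :: nat. 2 ^ l * 1 \<le> Q\<^sup>2}"
    proof
      fix l :: nat assume "l \<in> \<Lambda>"
      then have l: "4 * L\<^sup>2 * \<delta> * (2 ^ l) powr d \<le> Q" by (simp add: \<Lambda>_def)
      have "(2 ^ l :: real) powr 1 \<le> (2 ^ l) powr d" using d by (intro powr_mono) auto
      then have "(2 ^ l :: real) \<le> (2 ^ l) powr d" by simp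
      then have "\<delta> * 2 ^ l \<le> \<delta> * (2 ^ l) powr d" using \<delta> by (intro mult_left_mono) auto
      moreover have "1 * (\<delta> * (2 ^ l) powr d) \<le> 4 * L\<^sup>2 * (\<delta> * (2 ^ l) powr d)"
        using L2 \<delta> by (intro mult_right_mono) auto
      moreover have "4 * L\<^sup>2 * (\<delta> * (2 ^ l) powr d) \<le> Q" using l by (simp only: mult.assoc)
      ultimately have "\<delta> * 2 ^ l \<le> Q" by linarith
      then have "Q * (\<delta> * 2 ^ l) \<le> Q * Q" using Q0 by (intro mult_left_mono) auto
      moreover have "1 * 2 ^ l \<le> Q * \<delta> * 2 ^ l" using Q\<delta> by (intro mult_right_mono) auto
      moreover have "Q * \<delta> * 2 ^ l = Q * (\<delta> * 2 ^ l)" by simp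
      ultimately have "2 ^ l \<le> Q * Q" by linarith
      then show "l \<in> {l. 2 ^ l * 1 \<le> Q\<^sup>2}" by (simp add: power2_eq_square)
    qed
    moreover have dy: "finite {l :: nat. 2 ^ l * 1 \<le> Q\<^sup>2}" "real (card {l :: nat. 2 ^ l * 1 \<le> Q\<^sup>2}) \<le> 1 + log 2 (Q\<^sup>2)"
      using card_dyadic_le[of "Q\<^sup>2" 1] a by auto
    ultimately have fin\<Lambda>: "finite \<Lambda>" and "card \<Lambda> \<le> card {l :: nat. 2 ^ l * 1 \<le> Q\<^sup>2}"
      by (auto intro: finite_subset card_mono)
    then have c\<Lambda>: "real (card \<Lambda>) \<le> E * Q powr (\<epsilon> / 2)"
      using dy(2) logE[OF a(1)] by linarith
    \<comment> \<open>Outside \<Lambda> one has \<open>(1 / 2) ^ l \<le> \<mu>\<close>: the same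
      inequality solved for the radius of the annulus.\<close>
    define \<mu> where "\<mu> = (4 * L\<^sup>2 * \<delta> / Q) powr (1 / d)"
    have \<mu>0: "\<mu> \<ge> 0" by (simp add: \<mu>_def)
    define Res where "Res = {(q, a) \<in> N_set f \<delta> Q. norm (rational_point q a) \<le> \<mu>}"
    define \<sigma> where "\<sigma> l = ((2 :: real) ^ l) powr d" for l :: nat
    have \<sigma>1: "\<sigma> l \<ge> 1" for l unfolding \<sigma>_def using d by (intro ge_one_powr_ge_zero) auto
    define NP where "NP l I = near_pts (2 ^ l) (\<sigma> l) I (\<lambda>x. x) f (grad f) Q (sqrt (Q * \<sigma> l * \<delta>)) \<delta>" for l I
    have LB: "2 * L * sqrt (Q * \<sigma> l * \<delta>) \<le> Q" if "l \<in> \<Lambda>" for l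
    proof -
      have "2 * L * sqrt (Q * \<sigma> l * \<delta>) = sqrt ((2 * L)\<^sup>2 * (Q * \<sigma> l * \<delta>))" using L by (simp add: real_sqrt_mult)
      also have "\<dots> \<le> sqrt (Q\<^sup>2)"
      proof (rule real_sqrt_le_mono)
        have "4 * L\<^sup>2 * \<delta> * \<sigma> l \<le> Q" using that by (simp add: \<Lambda>_def \<sigma>_def)
        then have "Q * (4 * L\<^sup>2 * \<delta> * \<sigma> l) \<le> Q * Q" using Q0 by (intro mult_left_mono) auto
        then show "(2 * L)\<^sup>2 * (Q * \<sigma> l * \<delta>) \<le> Q\<^sup>2" by (simp add: power2_eq_square mult_ac)
      qed
      also have "\<dots> = Q" using Q0 by simp
      finally show ?thesis .
    qed
    have finNP: "finite (NP l I)" if "l \<in> \<Lambda>" "I \<in> \<I>" for l I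
      unfolding NP_def
    proof (rule near_pts_trivial(1))
      show "nondeg L I (\<lambda>x. x) f (grad f)" using nd that by blast
      show "0 < \<sigma> l" using \<sigma>1[of l] by linarith
      then show "0 < sqrt (Q * \<sigma> l * \<delta>)" "(sqrt (Q * \<sigma> l * \<delta>))\<^sup>2 \<le> Q * \<sigma> l * \<delta>" using Q0 \<delta> by simp_all
      show "2 * L * sqrt (Q * \<sigma> l * \<delta>) \<le> Q" by (rule LB[OF that(1)])
    qed (use a \<delta> in auto)
    have sub: "N_set f \<delta> Q \<subseteq> (\<Union>l\<in>\<Lambda>. \<Union>I\<in>\<I>. (\<lambda>(q, a, b). (q, a)) ` NP l I) \<union> Res"
    proof
      fix p assume p: "p \<in> N_set f \<delta> Q"
      obtain q b where pe: "p = (q, b)" by (cases p)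
      define y where "y = norm (rational_point q b)"
      show "p \<in> (\<Union>l\<in>\<Lambda>. \<Union>I\<in>\<I>. (\<lambda>(q, a, b). (q, a)) ` NP l I) \<union> Res"
      proof (cases "y = 0")
        case True
        then show ?thesis using p \<mu>0 by (auto simp: pe Res_def y_def)
      next
        case False
        then have y0: "y > 0" by (simp add: y_def)
        have "y < 1" using p Q0 by (auto simp: pe N_set_def y_def rational_point_eq)
        then have "1 / y \<ge> 1" using y0 by simp
        then obtain l where l: "2 ^ l \<le> 1 / y" "1 / y < 2 ^ (l + 1)" by (rule exists_dyadic)
        have ly: "y \<le> (1 / 2) ^ l" "(1 / 2) ^ (l + 1) \<le> y"
          using l y0 by (simp_all add: power_one_over field_simps)
        show ?thesis
        proof (cases "l \<in> \<Lambda>")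
          case True
          have "\<exists>I\<in>\<I>. \<exists>c. (q, b, c) \<in> NP l I"
            unfolding NP_def \<sigma>_def using p ly unfolding pe y_def by (intro N_set_dyadic[OF f Q0 \<delta> _ _ _ cover])
          then show ?thesis using True unfolding pe by force
        next
          case False
          then have "Q < 4 * L\<^sup>2 * \<delta> * (2 ^ l) powr d" by (simp add: \<Lambda>_def)
          then have "1 / (2 ^ l) powr d \<le> 4 * L\<^sup>2 * \<delta> / Q" using Q0 by (simp add: field_simps)
          then have "((1 / 2) ^ l) powr d \<le> 4 * L\<^sup>2 * \<delta> / Q" by (simp add: power_one_over powr_divide)
          then have "(((1 / 2) ^ l) powr d) powr (1 / d) \<le> \<mu>" unfolding \<mu>_def using d by (intro powr_mono2) auto
          then have "(1 / 2) ^ l \<le> \<mu>" using d by (simp add: powr_powr)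
          then have "y \<le> \<mu>" using ly by linarith
          then show ?thesis using p by (auto simp: pe Res_def y_def)
        qed
      qed
    qed
    have finRes: "finite Res" unfolding Res_def by (rule finite_subset[OF _ finite_N_set[OF Q0]]) auto
    have "card (N_set f \<delta> Q) \<le> card ((\<Union>l\<in>\<Lambda>. \<Union>I\<in>\<I>. (\<lambda>(q, a, b). (q, a)) ` NP l I) \<union> Res)"
      using fin\<Lambda> \<I> finNP finRes by (intro card_mono sub) auto
    also have "\<dots> \<le> card (\<Union>l\<in>\<Lambda>. \<Union>I\<in>\<I>. (\<lambda>(q, a, b). (q, a)) ` NP l I) + card Res" by (rule card_Un_le)
    finally have "card (N_set f \<delta> Q) \<le> card (\<Union>l\<in>\<Lambda>. \<Union>I\<in>\<I>. (\<lambda>(q, a, b). (q, a)) ` NP l I) + card Res" .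
    moreover have "card (\<Union>l\<in>\<Lambda>. \<Union>I\<in>\<I>. (\<lambda>(q, a, b). (q, a)) ` NP l I) \<le> (\<Sum>l\<in>\<Lambda>. \<Sum>I\<in>\<I>. card (NP l I))"
    proof -
      have "card (\<Union>l\<in>\<Lambda>. \<Union>I\<in>\<I>. (\<lambda>(q, a, b). (q, a)) ` NP l I) \<le> (\<Sum>l\<in>\<Lambda>. card (\<Union>I\<in>\<I>. (\<lambda>(q, a, b). (q, a)) ` NP l I))"
        by (rule card_UN_le[OF fin\<Lambda>])
      also have "\<dots> \<le> (\<Sum>l\<in>\<Lambda>. \<Sum>I\<in>\<I>. card ((\<lambda>(q, a, b). (q, a)) ` NP l I))"
        by (intro sum_mono card_UN_le[OF \<I>])
      also have "\<dots> \<le> (\<Sum>l\<in>\<Lambda>. \<Sum>I\<in>\<I>. card (NP l I))"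
        by (intro sum_mono card_image_le finNP)
      finally show ?thesis .
    qed
    ultimately have "card (N_set f \<delta> Q) \<le> (\<Sum>l\<in>\<Lambda>. \<Sum>I\<in>\<I>. card (NP l I)) + card Res" by linarith
    then have split: "real (card (N_set f \<delta> Q)) \<le> (\<Sum>l\<in>\<Lambda>. \<Sum>I\<in>\<I>. real (card (NP l I))) + real (card Res)"
      by (simp flip: of_nat_sum of_nat_add)
    define P where "P = (\<delta> / Q) powr (real ?m / d)"
    have P0: "P \<ge> 0" by (simp add: P_def)
    define \<Phi> where "\<Phi> = (if d \<le> 2 * real ?m then 1 else Q powr \<epsilon>)"
    have \<Phi>: "\<Phi> \<ge> 1" using Qe1 by (simp add: \<Phi>_def)
    define A where "A = \<delta> * Q ^ (?m + 1)"
    have A0: "A \<ge> 0" using \<delta> Q0 by (simp add: A_def)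
    define Y where "Y = (if d \<le> 2 * real ?m then \<omega> else 1 / \<delta> * P)"
    have Y0: "Y \<ge> 0" using \<omega>0 \<delta> P0 by (simp add: Y_def)
    have "(\<Sum>l\<in>\<Lambda>. \<Sum>I\<in>\<I>. real (card (NP l I))) \<le> (\<Sum>l\<in>\<Lambda>. real (card \<I>) * (C1 * A * (2 * (1 / 2) ^ l + (\<omega> + Y))))"
    proof (rule sum_mono)
      fix l assume l: "l \<in> \<Lambda>"
      show "(\<Sum>I\<in>\<I>. real (card (NP l I))) \<le> real (card \<I>) * (C1 * A * (2 * (1 / 2) ^ l + (\<omega> + Y)))"
      proof (rule sum_real_le_card)
        fix I assume I: "I \<in> \<I>"
        have "real (card (NP l I)) \<le> C1 * A * (1 / (2 ^ l) ^ ?m + 1 / sqrt (\<sigma> l) ^ ?m + \<omega> * weight ?m (2 ^ l) (\<sigma> l))"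
          unfolding NP_def A_def \<omega>_def using a I nd \<sigma>1 LB[OF l] by (intro bound) auto
        also have "\<dots> \<le> C1 * A * (2 * (1 / 2) ^ l + \<omega> + Y)"
          using dyadic_term_bound[OF m d L a(1) \<delta>, of l] l C1 A0
          unfolding \<sigma>_def \<omega>_def Y_def P_def \<Lambda>_def by (intro mult_left_mono) auto
        finally show "real (card (NP l I)) \<le> C1 * A * (2 * (1 / 2) ^ l + (\<omega> + Y))" by (simp add: add.assoc)
      qed
    qed
    also have "\<dots> = real (card \<I>) * (C1 * A) * (2 * (\<Sum>l\<in>\<Lambda>. (1 / 2) ^ l) + real (card \<Lambda>) * (\<omega> + Y))"
      by (simp add: sum_distrib_left[symmetric] sum.distrib distrib_left mult.assoc)
    also have "\<dots> \<le> real (card \<I>) * (C1 * A) * (4 + real (card \<Lambda>) * (\<omega> + Y))"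
      using sum_half_powers_le[OF fin\<Lambda>] C1 A0 by (intro mult_left_mono) auto
    also have "\<dots> \<le> real (card \<I>) * (C1 * A) * (4 + (2 * E + E * (\<Phi> * (P / \<delta>))))"
    proof (intro mult_left_mono add_left_mono)
      \<comment> \<open>The number of annuli is at most a constant times
        \<open>Q powr (\<epsilon> / 2)\<close>, and \<omega> gains exactly that power.\<close>
      have 1: "real (card \<Lambda>) * \<omega> \<le> E"
      proof -
        have "real (card \<Lambda>) * \<omega> \<le> (E * Q powr (\<epsilon> / 2)) * Q powr - (\<epsilon> / 2)"
          using c\<Lambda> \<omega> \<omega>0 E by (intro mult_mono) auto
        also have "\<dots> = E" using Q0 by (simp add: powr_minus)
        finally show ?thesis .
      qed
      have 2: "real (card \<Lambda>) * Y \<le> E + E * (\<Phi> * (P / \<delta>))"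
      proof (cases "d \<le> 2 * real ?m")
        case True
        have "0 \<le> E * (\<Phi> * (P / \<delta>))" using E \<Phi> P0 \<delta> by simp
        then show ?thesis using 1 True by (simp add: Y_def)
      next
        \<comment> \<open>Here no gain compensates the number of annuli: this is the source of the
          extra power of \<open>Q\<close> in part (b).\<close>
        case False
        have "Q powr (\<epsilon> / 2) \<le> Q powr \<epsilon>" using a \<epsilon> by (intro powr_mono) auto
        then have "E * Q powr (\<epsilon> / 2) \<le> E * Q powr \<epsilon>" using E by (intro mult_left_mono) auto
        then have "real (card \<Lambda>) \<le> E * Q powr \<epsilon>" using c\<Lambda> by linarith
        then have "real (card \<Lambda>) * (P / \<delta>) \<le> E * Q powr \<epsilon> * (P / \<delta>)" using P0 \<delta> by (intro mult_right_mono) auto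
        then show ?thesis using False E by (simp add: Y_def \<Phi>_def mult.assoc)
      qed
      show "real (card \<Lambda>) * (\<omega> + Y) \<le> 2 * E + E * (\<Phi> * (P / \<delta>))" using 1 2 by (simp add: distrib_left)
    qed (use C1 A0 in auto)
    also have "\<dots> \<le> C1 * real (card \<I>) * (4 + 2 * E) * (A + P * Q ^ (?m + 1) * \<Phi>)"
    proof -
      have AP: "A * (P / \<delta>) = P * Q ^ (?m + 1)" using \<delta> by (simp add: A_def)
      have "A * (4 + (2 * E + E * (\<Phi> * x))) = (4 + 2 * E) * A + E * (A * x * \<Phi>)" for x
        by (simp add: algebra_simps)
      from this[of "P / \<delta>"] have "A * (4 + (2 * E + E * (\<Phi> * (P / \<delta>)))) = (4 + 2 * E) * A + E * (P * Q ^ (?m + 1) * \<Phi>)"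
        unfolding AP .
      also have "\<dots> \<le> (4 + 2 * E) * A + (4 + 2 * E) * (P * Q ^ (?m + 1) * \<Phi>)"
        using E P0 Q0 \<Phi> by (intro add_left_mono mult_right_mono) auto
      finally have "A * (4 + (2 * E + E * (\<Phi> * (P / \<delta>)))) \<le> (4 + 2 * E) * (A + P * Q ^ (?m + 1) * \<Phi>)"
        by (simp add: distrib_left)
      then have "(C1 * real (card \<I>)) * (A * (4 + (2 * E + E * (\<Phi> * (P / \<delta>))))) \<le> (C1 * real (card \<I>)) * ((4 + 2 * E) * (A + P * Q ^ (?m + 1) * \<Phi>))"
        using C1 by (intro mult_left_mono) auto
      then show ?thesis by (simp only: mult_ac)
    qed
    finally have part1: "(\<Sum>l\<in>\<Lambda>. \<Sum>I\<in>\<I>. real (card (NP l I))) \<le> C1 * real (card \<I>) * (4 + 2 * E) * (A + P * Q ^ (?m + 1) * \<Phi>)" .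
    have part2: "real (card Res) \<le> 5 * 2 ^ ?m * (1 + c4) * (A + P * Q ^ (?m + 1) * \<Phi>)"
    proof -
      have "\<mu> ^ ?m = (4 * L\<^sup>2 * \<delta> / Q) powr (real ?m / d)"
      proof -
        have "\<mu> > 0" using L \<delta> Q0 by (simp add: \<mu>_def)
        then have "\<mu> ^ ?m = \<mu> powr real ?m" by (simp add: powr_realpow)
        then show ?thesis by (simp add: \<mu>_def powr_powr)
      qed
      also have "\<dots> = (4 * L\<^sup>2) powr (real ?m / d) * P"
        using L2 \<delta> Q0 by (simp add: P_def powr_mult[symmetric])
      finally have "(4 * Q * \<mu>) ^ ?m = c4 * (P * Q ^ ?m)" by (simp add: c4_def power_mult_distrib)
      then have e1: "Q * (1 + (4 * Q * \<mu>) ^ ?m) = Q + c4 * (P * Q ^ (?m + 1))" by (simp add: distrib_left)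
      have e2: "Q \<le> A"
      proof -
        have "1 \<le> Q ^ (?m - 1)" using a by simp
        then have "1 * 1 \<le> (Q * \<delta>) * Q ^ (?m - 1)" using Q\<delta> by (intro mult_mono) auto
        then have "Q * 1 \<le> Q * ((Q * \<delta>) * Q ^ (?m - 1))" using Q0 by (intro mult_left_mono) auto
        also have "\<dots> = \<delta> * (Q * (Q * Q ^ (?m - 1)))" by simp
        also have "Q * Q ^ (?m - 1) = Q ^ ?m" using m by (simp flip: power_Suc)
        finally show ?thesis by (simp add: A_def)
      qed
      have e3: "c4 * (P * Q ^ (?m + 1)) \<le> c4 * (P * Q ^ (?m + 1) * \<Phi>)"
        using \<Phi> P0 Q0 c4 mult_left_mono[of 1 \<Phi> "P * Q ^ (?m + 1)"] by (intro mult_left_mono) auto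
      have e4: "A + c4 * (P * Q ^ (?m + 1) * \<Phi>) \<le> (1 + c4) * (A + P * Q ^ (?m + 1) * \<Phi>)"
        using c4 A0 P0 Q0 \<Phi> by (simp add: distrib_left distrib_right)
      have "Q * (1 + (4 * Q * \<mu>) ^ ?m) \<le> (1 + c4) * (A + P * Q ^ (?m + 1) * \<Phi>)"
        using e1 e2 e3 e4 by linarith
      then have "5 * 2 ^ ?m * (Q * (1 + (4 * Q * \<mu>) ^ ?m)) \<le> 5 * 2 ^ ?m * ((1 + c4) * (A + P * Q ^ (?m + 1) * \<Phi>))"
        by (intro mult_left_mono) auto
      moreover have "real (card Res) \<le> 5 * 2 ^ ?m * (Q * (1 + (4 * Q * \<mu>) ^ ?m))"
        using N_set_small[OF a(1) \<mu>0, of f \<delta>] unfolding Res_def by (simp only: mult_ac)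
      ultimately show ?thesis by (simp only: mult.assoc)
    qed
    have "real (card (N_set f \<delta> Q)) \<le> C * (A + P * Q ^ (?m + 1) * \<Phi>)"
      using split part1 part2 unfolding C_def distrib_right[of _ _ "A + P * Q ^ (?m + 1) * \<Phi>"] by linarith
    then show "real (card (N_set f \<delta> Q)) \<le> C * (\<delta> * Q ^ (?m + 1) + (\<delta> / Q) powr (real ?m / d) * Q ^ (?m + 1) * (if d \<le> 2 * real ?m then 1 else Q powr \<epsilon>))"
      unfolding A_def P_def \<Phi>_def .
  qed
qed

section \<open>The lower bound\<close>

text \<open>By pigeonhole every body has at least \<open>2 * c1 * V\<close> triples. Those with
  \<open>|q| \<le> \<eta> * Q\<close> lie in a body of volume smaller by the factor \<eta>; by
  transference and \<open>sum_pts_le\<close> for the dual they number on average at most a constant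
  times \<open>\<eta> * V\<close>, and \<eta>c makes this at most half of the pigeonhole bound. The
  hypothesis \<open>small\<close> says that the error in the dual sum is at most one point per
  body.\<close>

lemma sum_large_pts_ge:
  fixes X :: "real ^ 'm \<Rightarrow> real ^ 'm"
  assumes nd: "nondeg L I X F G" and R: "R \<subseteq> I" "sparse_net \<Lambda> r R X" and r: "r > 0" and \<Lambda>: "\<Lambda> \<ge> 0"
    and hyp: "near_bound TYPE('m) L \<theta> K" "K \<ge> 0" "0 \<le> \<theta>" "\<theta> \<le> 1"
    and \<eta>: "0 < \<eta>" "\<eta> \<le> 1" "1 \<le> \<eta> * Q" and \<delta>: "0 < \<delta>" "\<delta> \<le> 1" "1 / \<delta> \<le> \<eta> * Q"
    and B: "B = r * Q" "B\<^sup>2 = Q * \<delta>" "B \<ge> 4 * real CARD('m)"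
    and small: "\<Lambda> * (2 * L) ^ CARD('m) * (1 / \<delta>) ^ CARD('m) * K * weight CARD('m) 1 1 *
        (1 / (\<delta> * (\<eta> * Q)) + (1 / \<delta>) powr (1 - \<theta>)) * (1 + log 2 (1 / \<delta>)) \<le> real (card R)"
    and \<eta>c: "2 * 24 ^ (CARD('m) + 2) * real CARD('m) ^ CARD('m) * \<eta> * ((4 * L + 1) * (3 ^ CARD('m) * 3) + 1)
        \<le> 1 / 8 * (1 / (2 * real CARD('m))) ^ CARD('m)"
  shows "real (card R) * (1 / 8 * (1 / (2 * real CARD('m))) ^ CARD('m) * (Q * B ^ CARD('m) * \<delta>)) \<le>
    (\<Sum>c\<in>R. real (card {p \<in> pts 1 1 (X c) (F c) (G c) Q B \<delta>. \<eta> * Q < \<bar>real_of_int (fst p)\<bar>}))"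
proof -
  let ?m = "CARD('m)"
  have m: "real ?m \<ge> 1" using one_le_card_finite[where 'a = 'm] by linarith
  have L: "L \<ge> 1" by (rule nondegD(1)[OF nd])
  have Q1: "Q \<ge> 1"
  proof -
    have "0 < \<eta> * Q" using \<eta> by linarith
    then have "Q > 0" using \<eta> by (simp add: zero_less_mult_iff)
    then have "\<eta> * Q \<le> 1 * Q" using \<eta> by (intro mult_right_mono) auto
    then show ?thesis using \<eta> by linarith
  qed
  have B1: "B \<ge> 1" using B(3) m by linarith
  define C0 where "C0 = 2 * 24 ^ (?m + 2) * real ?m ^ ?m"
  have C0: "C0 \<ge> 0" by (simp add: C0_def)
  define c1 where "c1 = 1 / 8 * (1 / (2 * real ?m)) ^ ?m"
  define V where "V = Q * B ^ ?m * \<delta>"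
  have V0: "V \<ge> 0" using Q1 B1 \<delta> by (simp add: V_def)
  define F' where "F' c = X c \<bullet> G c - F c" for c
  define P where "P c = pts 1 1 (X c) (F c) (G c) Q B \<delta>" for c
  define S where "S c = pts 1 1 (X c) (F c) (G c) (\<eta> * Q) B \<delta>" for c
  define D where "D c = pts 1 1 (G c) (F' c) (X c) (1 / \<delta>) (1 / B) (1 / (\<eta> * Q))" for c
  define T where "T c = {p \<in> P c. \<eta> * Q < \<bar>real_of_int (fst p)\<bar>}" for c
  have finP: "finite (P c)" for c unfolding P_def using Q1 B1 \<delta> by (intro finite_pts) auto
  have finS: "finite (S c)" for c unfolding S_def using Q1 \<eta> B1 \<delta> by (intro finite_pts) auto
  have large: "2 * c1 * V \<le> real (card (P c))" for c
  proof -
    have "Q / 2 * (B / (2 * real ?m * 1)) ^ ?m * (\<delta> / 2) \<le> real (card (P c))"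
      unfolding P_def using Q1 B \<delta> by (intro card_pts_pigeonhole) auto
    moreover have "Q / 2 * (B / (2 * real ?m * 1)) ^ ?m * (\<delta> / 2) = 2 * c1 * V"
      by (simp add: c1_def V_def power_divide)
    ultimately show ?thesis by (simp only:)
  qed
  have "(\<Sum>c\<in>R. real (card (D c))) \<le>
     real (card R) * ((4 * L * (1 / B) + 1) * ((2 * (1 / B) / 1 + 1) ^ ?m * (2 * (1 / (\<eta> * Q)) + 1))) +
     \<Lambda> * (2 * L) ^ ?m * (1 / \<delta>) ^ ?m * K * weight ?m 1 1 * (1 / (\<delta> * (\<eta> * Q)) + (1 / \<delta>) powr (1 - \<theta>)) * (1 + log 2 (1 / \<delta>))"
    unfolding D_def
  proof (rule sum_pts_le[OF _ R r \<Lambda> _ _ _ _ _ hyp])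
    show "nondeg L I G F' X" using nondeg_dual[OF nd] unfolding F'_def .
    have "Q * \<delta> = B * B" using B(2) by (simp add: power2_eq_square)
    also have "\<dots> = (r * Q) * B" by (rule arg_cong[OF B(1)])
    finally have "Q * \<delta> = Q * (r * B)" by (simp only: mult_ac)
    then have "\<delta> = r * B" using Q1 by simp
    then show "1 / B = r * (1 / \<delta>)" using B1 r by (simp add: field_simps)
    have "(1 / B)\<^sup>2 = 1 / (Q * \<delta>)" by (simp add: power_divide B(2))
    also have "\<dots> \<le> 1 / (\<delta> * (\<eta> * Q))" using Q1 \<delta> \<eta> by (intro divide_left_mono) (auto simp: mult.commute mult_le_cancel_left_pos)
    finally show "(1 / B)\<^sup>2 \<le> 1 / (\<delta> * (\<eta> * Q)) * 1" by simp
    show "1 / (\<eta> * Q) \<le> 1 / (\<delta> * (\<eta> * Q)) / (1 / \<delta>)" using \<delta> by simp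
    show "1 / (\<delta> * (\<eta> * Q)) \<le> 1" using \<delta> \<eta> by (simp add: field_simps)
    show "0 < 1 / (\<eta> * Q)" using \<eta> Q1 by simp
  qed (use \<delta> in auto)
  also have "\<dots> \<le> real (card R) * ((4 * L + 1) * (3 ^ ?m * 3)) + real (card R)"
  proof -
    have b: "1 / B \<le> 1" "0 \<le> 1 / B" using B1 by simp_all
    have 1: "4 * L * (1 / B) + 1 \<le> 4 * L + 1" using L mult_left_mono[OF b(1), of "4 * L"] by simp
    have "2 * (1 / B) / 1 + 1 \<le> 3" using b by linarith
    then have 2: "(2 * (1 / B) / 1 + 1) ^ ?m \<le> 3 ^ ?m" using b by (intro power_mono) auto
    have "1 / (\<eta> * Q) \<le> 1" using \<eta> by simp
    then have 3: "2 * (1 / (\<eta> * Q)) + 1 \<le> 3" by linarith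
    have "(4 * L * (1 / B) + 1) * ((2 * (1 / B) / 1 + 1) ^ ?m * (2 * (1 / (\<eta> * Q)) + 1)) \<le> (4 * L + 1) * (3 ^ ?m * 3)"
      using 1 2 3 L b \<eta> Q1 by (intro mult_mono[OF 1] mult_mono[OF 2]) auto
    then have "real (card R) * ((4 * L * (1 / B) + 1) * ((2 * (1 / B) / 1 + 1) ^ ?m * (2 * (1 / (\<eta> * Q)) + 1))) \<le> real (card R) * ((4 * L + 1) * (3 ^ ?m * 3))"
      by (intro mult_left_mono) auto
    then show ?thesis using small by (rule add_mono)
  qed
  finally have D: "(\<Sum>c\<in>R. real (card (D c))) \<le> real (card R) * ((4 * L + 1) * (3 ^ ?m * 3) + 1)"
    by (simp add: distrib_left)
  have "(\<Sum>c\<in>R. real (card (S c))) \<le> (\<Sum>c\<in>R. C0 * \<eta> * V * real (card (D c)))"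
  proof (rule sum_mono)
    fix c
    have "real (card (S c)) \<le> C0 * (\<eta> * Q * B ^ ?m * \<delta> / 1 ^ ?m) * real (card (pts (1 / 1) 1 (G c) (X c \<bullet> G c - F c) (X c) (1 / \<delta>) (1 / B) (1 / (\<eta> * Q))))"
      unfolding S_def C0_def using Q1 \<eta> B1 \<delta> by (intro pts_transference) auto
    then show "real (card (S c)) \<le> C0 * \<eta> * V * real (card (D c))" by (simp add: D_def F'_def V_def mult_ac)
  qed
  also have "\<dots> = C0 * \<eta> * V * (\<Sum>c\<in>R. real (card (D c)))" by (simp add: sum_distrib_left)
  also have "\<dots> \<le> C0 * \<eta> * V * (real (card R) * ((4 * L + 1) * (3 ^ ?m * 3) + 1))"
    using D C0 \<eta> V0 by (intro mult_left_mono) auto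
  also have "\<dots> = C0 * \<eta> * ((4 * L + 1) * (3 ^ ?m * 3) + 1) * (real (card R) * V)" by simp
  also have "\<dots> \<le> c1 * (real (card R) * V)"
    using \<eta>c V0 unfolding C0_def c1_def by (intro mult_right_mono) auto
  finally have S: "(\<Sum>c\<in>R. real (card (S c))) \<le> c1 * (real (card R) * V)" .
  have "2 * c1 * V - real (card (S c)) \<le> real (card (T c))" for c
  proof -
    have "P c \<subseteq> S c \<union> T c" unfolding P_def S_def T_def pts_def by auto
    moreover have "finite (T c)" unfolding T_def using finP by simp
    ultimately have "card (P c) \<le> card (S c \<union> T c)" using finS by (intro card_mono) auto
    also have "\<dots> \<le> card (S c) + card (T c)" by (rule card_Un_le)
    finally show ?thesis using large[of c] by linarith
  qed
  then have "(\<Sum>c\<in>R. 2 * c1 * V - real (card (S c))) \<le> (\<Sum>c\<in>R. real (card (T c)))" by (intro sum_mono)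
  then have "real (card R) * (2 * c1 * V) - (\<Sum>c\<in>R. real (card (S c))) \<le> (\<Sum>c\<in>R. real (card (T c)))"
    by (simp add: sum_subtractf)
  moreover have "real (card R) * (2 * c1 * V) = 2 * (c1 * (real (card R) * V))" by simp
  ultimately have "c1 * (real (card R) * V) \<le> (\<Sum>c\<in>R. real (card (T c)))" using S by linarith
  then show ?thesis unfolding c1_def V_def T_def P_def by (simp only: mult_ac)
qed

text \<open>A triple becomes a point of \<open>N_set\<close> after multiplication by
  \<open>\<lceil>Q / |q|\<rceil>\<close> and by the sign of \<open>q\<close>. The condition
  \<open>|q| > \<eta> * Q\<close> keeps the multiplier at most \<open>2 / \<eta>\<close> and puts
  all base points of one triple within \<open>r / \<eta>\<close> of \<open>a / q\<close>, so few
  bodies share it. Passing from the base point to \<open>a / q\<close> gives an error of at most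
  \<open>3 * L^2 / \<eta>^2 * \<delta>1\<close>, and the multiplier costs another
  \<open>2 / \<eta>\<close>; hence the factor in front of \<delta>1.\<close>

lemma sum_large_pts_le:
  fixes f :: "real ^ 'm \<Rightarrow> real"
  assumes nd: "nondeg L (ball x0 \<rho>) (\<lambda>x. x) f (grad f)" and ball: "\<And>y. y \<in> ball x0 \<rho> \<Longrightarrow> norm y < 1"
    and R: "R \<subseteq> ball x0 (\<rho> / 2)" "sparse_net \<Lambda> r R (\<lambda>x. x)" and r: "r > 0" "r / \<eta> \<le> \<rho> / 2" and \<Lambda>: "\<Lambda> \<ge> 0"
    and \<eta>: "0 < \<eta>" "\<eta> \<le> 1" and Q: "Q \<ge> 1" and B: "B = r * Q" "B\<^sup>2 = Q * \<delta>1"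
    and \<delta>: "0 < \<delta>1" "6 * L\<^sup>2 / \<eta> ^ 3 * \<delta>1 \<le> \<delta>" "\<delta> < 1 / 2"
  shows "(\<Sum>c\<in>R. real (card {p \<in> pts 1 1 c (f c) (grad f c) Q B \<delta>1. \<eta> * Q < \<bar>real_of_int (fst p)\<bar>}))
    \<le> \<Lambda> * (1 / \<eta>) ^ CARD('m) * (4 / \<eta>) * real (card (N_set f \<delta> Q))"
proof -
  have L: "L \<ge> 1" by (rule nondegD(1)[OF nd])
  have B0: "B > 0" using B(1) r Q by simp
  have \<rho>: "\<rho> > 0"
  proof -
    have "r / \<eta> > 0" using r \<eta> by simp
    then show ?thesis using r(2) by linarith
  qed
  have finR: "finite R" using R(2) by (simp add: sparse_net_def)
  define P where "P c = pts 1 1 c (f c) (grad f c) Q B \<delta>1" for c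
  define U where "U = (\<Union>c\<in>R. {p \<in> P c. \<eta> * Q < \<bar>real_of_int (fst p)\<bar>})"
  have finP: "finite (P c)" for c unfolding P_def using Q B0 \<delta> by (intro finite_pts) auto
  have finU: "finite U" unfolding U_def using finR finP by auto
  have rB: "r * B = \<delta>1"
  proof -
    have "Q * \<delta>1 = B * B" using B(2) by (simp add: power2_eq_square)
    also have "\<dots> = (r * Q) * B" by (rule arg_cong[OF B(1)])
    finally have "Q * \<delta>1 = Q * (r * B)" by (simp only: mult_ac)
    then show ?thesis using Q by simp
  qed
  have Qr: "Q * r\<^sup>2 = \<delta>1" using rB B(1) by (simp add: power2_eq_square mult_ac)
  define t where "t = 3 * L\<^sup>2 / \<eta>\<^sup>2 * \<delta>1"
  have near: "norm (c - rational_point q a) \<le> r / \<eta> \<and> rational_point q a \<in> ball x0 \<rho> \<and>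
     \<bar>real_of_int b - real_of_int q * f (rational_point q a)\<bar> \<le> t"
    if c: "c \<in> R" "(q, a, b) \<in> P c" "\<eta> * Q < \<bar>real_of_int q\<bar>" for c q a b
  proof -
    define y where "y = rational_point q a"
    have "0 < \<eta> * Q" using \<eta> Q by simp
    then have q: "\<bar>real_of_int q\<bar> > 0" "real_of_int q \<noteq> 0" using c(3) by auto
    have p: "\<bar>real_of_int q\<bar> \<le> Q" "norm (real_vec a - real_of_int q *\<^sub>R c) \<le> B"
      "\<bar>real_of_int b - real_of_int q * f c - grad f c \<bullet> (real_vec a - real_of_int q *\<^sub>R c)\<bar> \<le> \<delta>1"
      using c(2) unfolding P_def pts_def by auto
    have ay: "real_vec a = real_of_int q *\<^sub>R y" using q by (simp add: y_def rational_point_eq)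
    have "real_vec a - real_of_int q *\<^sub>R c = real_of_int q *\<^sub>R (y - c)" unfolding ay by (simp add: algebra_simps)
    then have "\<bar>real_of_int q\<bar> * norm (y - c) \<le> B" using p(2) by simp
    moreover have "\<eta> * Q * norm (y - c) \<le> \<bar>real_of_int q\<bar> * norm (y - c)" using c(3) by (intro mult_right_mono) auto
    ultimately have "\<eta> * Q * norm (y - c) \<le> r * Q" using B(1) by linarith
    then have "Q * (\<eta> * norm (y - c)) \<le> Q * r" by (simp add: mult_ac)
    then have "\<eta> * norm (y - c) \<le> r" using Q by simp
    then have yc: "norm (y - c) \<le> r / \<eta>" using \<eta> by (simp add: pos_le_divide_eq mult.commute)
    have cb: "dist x0 c < \<rho> / 2" using c(1) R(1) by auto
    have "dist c y \<le> r / \<eta>" using yc by (simp add: dist_norm norm_minus_commute)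
    then have "dist x0 y < \<rho>" using dist_triangle[of x0 y c] cb r(2) by linarith
    then have yb: "y \<in> ball x0 \<rho>" by simp
    have cI: "c \<in> ball x0 \<rho>" using cb \<rho> by simp
    have "\<bar>(real_of_int b - real_of_int q * f y - grad f y \<bullet> (real_vec a - real_of_int q *\<^sub>R y)) -
       (real_of_int b - real_of_int q * f c - grad f c \<bullet> (real_vec a - real_of_int q *\<^sub>R c))\<bar>
       \<le> Q * L\<^sup>2 * (r / \<eta>)\<^sup>2 + L * (r / \<eta>) * B"
      by (rule residual_change[OF nd cI yb yc p(2,1)])
    also have "\<dots> = (L\<^sup>2 / \<eta>\<^sup>2) * (Q * r\<^sup>2) + (L / \<eta>) * (r * B)" by (simp add: power_divide mult_ac)
    also have "\<dots> = (L\<^sup>2 / \<eta>\<^sup>2 + L / \<eta>) * \<delta>1" unfolding Qr rB by (simp add: distrib_right)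
    finally have "\<bar>real_of_int b - real_of_int q * f y\<bar> \<le> (L\<^sup>2 / \<eta>\<^sup>2 + L / \<eta> + 1) * \<delta>1"
      using p(3) unfolding ay by (simp add: distrib_right)
    also have "\<dots> \<le> t"
    proof -
      have x: "1 \<le> L / \<eta>" using L \<eta> by simp
      then have "L / \<eta> \<le> (L / \<eta>)\<^sup>2" using power_increasing[of 1 2 "L / \<eta>"] by simp
      then have "L\<^sup>2 / \<eta>\<^sup>2 + L / \<eta> + 1 \<le> 3 * L\<^sup>2 / \<eta>\<^sup>2" using x by (simp add: power_divide)
      then show ?thesis unfolding t_def using \<delta> by (intro mult_right_mono) auto
    qed
    finally show ?thesis using yc yb unfolding y_def by (simp add: norm_minus_commute)
  qed
  have t: "t > 0" "2 / \<eta> * t \<le> \<delta>" "t < 1 / 2"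
  proof -
    show "t > 0" unfolding t_def using L \<eta> \<delta> by simp
    have "2 / \<eta> * t = 6 * L\<^sup>2 / \<eta> ^ 3 * \<delta>1" by (simp add: t_def power2_eq_square power3_eq_cube)
    then show 1: "2 / \<eta> * t \<le> \<delta>" using \<delta> by simp
    have "1 * t \<le> 2 / \<eta> * t" using \<eta> \<open>t > 0\<close> by (intro mult_right_mono) auto
    then show "t < 1 / 2" using 1 \<delta> by linarith
  qed
  have "(\<Sum>c\<in>R. real (card {p \<in> P c. \<eta> * Q < \<bar>real_of_int (fst p)\<bar>})) = (\<Sum>c\<in>R. real (card {p \<in> U. p \<in> P c}))"
    by (intro sum.cong refl arg_cong[where f = "\<lambda>x. real (card x)"]) (auto simp: U_def)
  also have "\<dots> = (\<Sum>p\<in>U. real (card {c \<in> R. p \<in> P c}))"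
    using sum_card_swap[OF finR finU, of "\<lambda>c p. p \<in> P c"] by (simp flip: of_nat_sum)
  also have "\<dots> \<le> real (card U) * (\<Lambda> * (1 / \<eta>) ^ CARD('m))"
  proof (rule sum_real_le_card)
    fix p assume p: "p \<in> U"
    obtain q a b where pe: "p = (q, a, b)" by (cases p)
    have q: "\<eta> * Q < \<bar>real_of_int q\<bar>" using p by (auto simp: U_def pe)
    have "{c \<in> R. p \<in> P c} \<subseteq> {c \<in> R. norm (c - rational_point q a) \<le> r / \<eta>}"
      using near q unfolding pe by blast
    then have "card {c \<in> R. p \<in> P c} \<le> card {c \<in> R. norm (c - rational_point q a) \<le> r / \<eta>}"
      using finR by (intro card_mono) auto
    moreover have "r \<le> r / \<eta>" using r \<eta> by (simp add: pos_le_divide_eq mult_left_le)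
    then have "real (card {c \<in> R. norm (c - rational_point q a) \<le> r / \<eta>}) \<le> \<Lambda> * (r / \<eta> / r) ^ CARD('m)"
      using R(2) unfolding sparse_net_def by blast
    moreover have "r / \<eta> / r = 1 / \<eta>" using r by simp
    ultimately show "real (card {c \<in> R. p \<in> P c}) \<le> \<Lambda> * (1 / \<eta>) ^ CARD('m)" by simp
  qed
  also have "real (card U) \<le> (4 / \<eta>) * real (card (N_set f \<delta> Q))"
  proof -
    define k where "k p = \<lceil>Q / \<bar>real_of_int (fst p)\<bar>\<rceil>" for p :: "int \<times> (int ^ 'm) \<times> int"
    \<comment> \<open>Multiplier and sign are recorded so that \<open>(q, a)\<close> can be
      recovered; \<open>b\<close> is then determined because its error is below 1/2.\<close>
    define h where "h = (\<lambda>p. ((k p * \<bar>fst p\<bar>, \<chi> i. k p * (sgn (fst p) * fst (snd p) $ i)), k p, sgn (fst p)))"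
    define M where "M = {k :: int. 1 \<le> k \<and> real_of_int k \<le> 2 / \<eta>}"
    have U_facts: "\<bar>real_of_int q\<bar> \<le> Q \<and> \<eta> * Q < \<bar>real_of_int q\<bar> \<and> q \<noteq> 0 \<and> rational_point q a \<in> ball x0 \<rho> \<and>
       \<bar>real_of_int b - real_of_int q * f (rational_point q a)\<bar> \<le> t"
      if "(q, a, b) \<in> U" for q a b
    proof -
      obtain c where c: "c \<in> R" "(q, a, b) \<in> P c" "\<eta> * Q < \<bar>real_of_int q\<bar>" using \<open>(q, a, b) \<in> U\<close> by (auto simp: U_def)
      have "0 < \<eta> * Q" using \<eta> Q by simp
      then have "q \<noteq> 0" using c(3) by auto
      moreover have "\<bar>real_of_int q\<bar> \<le> Q" using c(2) unfolding P_def pts_def by auto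
      ultimately show ?thesis using near[OF c] c(3) by blast
    qed
    have h_mem: "h p \<in> N_set f \<delta> Q \<times> (M \<times> {-1, 1})" if p: "p \<in> U" for p
    proof -
      obtain q a b where pe: "p = (q, a, b)" by (cases p)
      note u = U_facts[OF p[unfolded pe]]
      define q' where "q' = \<bar>real_of_int q\<bar>"
      have q': "q' > 0" "q' \<le> Q" "\<eta> * Q < q'" using u by (auto simp: q'_def)
      \<comment> \<open>The ceiling yields \<open>Q \<le> kk * q'\<close> and
        \<open>kk * q' < Q + q' \<le> 2 * Q\<close>, the range of denominators in
        \<open>N_set\<close>.\<close>
      define kk where "kk = k p"
      have kk: "Q / q' \<le> real_of_int kk" "real_of_int kk < Q / q' + 1"
        unfolding kk_def k_def pe q'_def by (simp_all add: ceiling_correct) linarith+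
      have "Q / q' \<ge> 1" using q' by simp
      then have kk1: "1 \<le> kk" using kk(1) by linarith
      have "Q / q' \<le> 1 / \<eta>" using q' \<eta> by (simp add: field_simps)
      then have "real_of_int kk \<le> 1 / \<eta> + 1" using kk(2) by linarith
      moreover have "1 \<le> 1 / \<eta>" using \<eta> by simp
      ultimately have kk2: "real_of_int kk \<le> 2 / \<eta>" by linarith
      have q1: "Q \<le> real_of_int kk * q'" using kk(1) q' by (simp add: pos_divide_le_eq)
      have "real_of_int kk * q' < (Q / q' + 1) * q'" using kk(2) q' by (intro mult_strict_right_mono) auto
      also have "\<dots> \<le> 2 * Q" using q' by (simp add: distrib_right)
      finally have q2: "real_of_int kk * q' < 2 * Q" .
      define s where "s = sgn q"
      have s: "s \<in> {-1, 1}" "s * q = \<bar>q\<bar>" "s * s = 1" using u by (auto simp: s_def sgn_if)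
      define a' where "a' = (\<chi> i. kk * (s * a $ i))"
      have ra: "real_vec a' = (real_of_int kk * real_of_int s) *\<^sub>R real_vec a" by (simp add: vec_eq_iff a'_def)
      have qs: "real_of_int (kk * \<bar>q\<bar>) = real_of_int kk * real_of_int s * real_of_int q"
        using s(2) by (metis mult.assoc of_int_mult)
      have nz: "real_of_int kk * real_of_int s \<noteq> 0" "real_of_int q \<noteq> 0" using kk1 s u by auto
      have rp: "rational_point (kk * \<bar>q\<bar>) a' = rational_point q a"
        unfolding rational_point_eq ra qs using nz by simp
      have qq: "real_of_int (kk * \<bar>q\<bar>) = real_of_int kk * q'" by (simp add: q'_def)
      have "norm (rational_point q a) < 1" using ball u by blast
      then have "norm (rational_point (kk * \<bar>q\<bar>) a') < 1" unfolding rp .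
      moreover have "real_of_int (kk * \<bar>q\<bar>) > 0" unfolding qq using kk1 q' by simp
      ultimately have n: "norm (real_vec a') < real_of_int (kk * \<bar>q\<bar>)" by (simp add: rational_point_eq field_simps)
      have "\<bar>real_of_int (kk * \<bar>q\<bar>) * f (rational_point (kk * \<bar>q\<bar>) a') - real_of_int (kk * s * b)\<bar>
         = \<bar>real_of_int kk * real_of_int s\<bar> * \<bar>real_of_int b - real_of_int q * f (rational_point q a)\<bar>"
      proof -
        have "real_of_int (kk * \<bar>q\<bar>) * f (rational_point (kk * \<bar>q\<bar>) a') - real_of_int (kk * s * b)
           = - (real_of_int kk * real_of_int s * (real_of_int b - real_of_int q * f (rational_point q a)))"
          unfolding rp qs by (simp add: algebra_simps)
        then show ?thesis by (simp add: abs_mult)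
      qed
      also have "\<dots> \<le> (2 / \<eta>) * t"
        using u kk1 kk2 s t \<eta> by (intro mult_mono) (auto simp: abs_mult)
      also have "\<dots> \<le> \<delta>" by (rule t(2))
      finally have "\<exists>b :: int. \<bar>real_of_int (kk * \<bar>q\<bar>) * f (rational_point (kk * \<bar>q\<bar>) a') - real_of_int b\<bar> \<le> \<delta>" by blast
      then have "(kk * \<bar>q\<bar>, a') \<in> N_set f \<delta> Q"
        unfolding N_set_def mem_Collect_eq split qq using n q1 q2 unfolding qq by blast
      then show ?thesis using kk1 kk2 s(1) unfolding h_def pe kk_def s_def a'_def M_def by simp
    qed
    have inj: "inj_on h U"
    proof (rule inj_onI)
      fix p p' assume p: "p \<in> U" "p' \<in> U" "h p = h p'"
      obtain q a b where pe: "p = (q, a, b)" by (cases p)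
      obtain q1 a1 b1 where pe1: "p' = (q1, a1, b1)" by (cases p')
      note u = U_facts[OF p(1)[unfolded pe]] and u1 = U_facts[OF p(2)[unfolded pe1]]
      have k1: "k p \<ge> 1" using h_mem[OF p(1)] by (auto simp: h_def M_def)
      have e: "k p = k p'" "sgn q = sgn q1" "k p * \<bar>q\<bar> = k p' * \<bar>q1\<bar>"
        "\<And>i. k p * (sgn q * a $ i) = k p' * (sgn q1 * a1 $ i)"
        using p(3) unfolding h_def pe pe1 by (auto simp: vec_eq_iff)
      have "\<bar>q\<bar> = \<bar>q1\<bar>" using e(1,3) k1 by simp
      then have q: "q = q1" using e(2) by (metis mult_sgn_abs)
      have sq: "sgn q \<noteq> 0" using u by (simp add: sgn_eq_0_iff)
      then have a: "a = a1" using e(1,4) k1 q by (simp add: vec_eq_iff)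
      have "\<bar>real_of_int b - real_of_int b1\<bar> < 1" using u u1 t(3) unfolding q a by linarith
      then have "b = b1" by linarith
      then show "p = p'" by (simp add: pe pe1 q a)
    qed
    have M: "finite M \<and> real (card M) \<le> 2 / \<eta>"
    proof -
      have "M = {1..\<lfloor>2 / \<eta>\<rfloor>}" by (auto simp: M_def le_floor_iff)
      then show ?thesis using \<eta> by simp
    qed
    have "finite (N_set f \<delta> Q)" using Q by (intro finite_N_set) simp
    then have fin: "finite (N_set f \<delta> Q \<times> (M \<times> {-1, 1 :: int}))" using M by simp
    have "h ` U \<subseteq> N_set f \<delta> Q \<times> (M \<times> {-1, 1})" by (rule image_subsetI) (rule h_mem)
    from card_mono[OF fin this] have "card U \<le> card (N_set f \<delta> Q) * (card M * 2)"
      using card_image[OF inj] by (simp add: card_cartesian_product mult_2_right)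
    then have "real (card U) \<le> real (card (N_set f \<delta> Q) * (card M * 2))" by (simp only: of_nat_le_iff)
    then have "real (card U) \<le> real (card (N_set f \<delta> Q)) * (real (card M) * 2)" by simp
    also have "\<dots> \<le> real (card (N_set f \<delta> Q)) * (2 / \<eta> * 2)"
      using M by (intro mult_left_mono mult_right_mono) auto
    finally show ?thesis by (simp add: mult.commute)
  qed
  then have "real (card U) * (\<Lambda> * (1 / \<eta>) ^ CARD('m)) \<le> (4 / \<eta>) * real (card (N_set f \<delta> Q)) * (\<Lambda> * (1 / \<eta>) ^ CARD('m))"
    using \<Lambda> \<eta> by (intro mult_right_mono) auto
  finally show ?thesis unfolding P_def by (simp add: mult_ac)
qed

lemma nondeg_subset: "nondeg L I X F G \<Longrightarrow> J \<subseteq> I \<Longrightarrow> nondeg L J X F G"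
  unfolding nondeg_def by blast

lemma homogeneous_zero:
  assumes "f \<in> nondegenerate_homogeneous_funs d"
  shows "f 0 = 0"
  using homogeneous_scaleR[OF assms, of 0 0] by simp

text \<open>The witness is \<open>a = 0\<close>, where \<open>f\<close> vanishes. It settles the
  lower bound for bounded \<open>Q\<close>.\<close>

lemma N_set_nonempty:
  fixes f :: "real ^ 'm \<Rightarrow> real"
  assumes f: "f \<in> nondegenerate_homogeneous_funs d" and Q: "Q \<ge> 1" "\<delta> \<ge> 0"
  shows "1 \<le> real (card (N_set f \<delta> Q))"
proof -
  have z: "real_vec (0 :: int ^ 'm) = 0" by (simp add: vec_eq_iff)
  have "(\<lceil>Q\<rceil>, 0) \<in> N_set f \<delta> Q"
    unfolding N_set_def mem_Collect_eq split rational_point_eq z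
    using Q homogeneous_zero[OF f] by (auto intro!: exI[of _ 0]) linarith+
  then have "N_set f \<delta> Q \<noteq> {}" by blast
  then have "0 < card (N_set f \<delta> Q)" using Q finite_N_set[of Q f \<delta>] by (simp add: card_gt_0_iff)
  then show ?thesis by simp
qed

lemma homogeneous_bound:
  fixes f :: "real ^ 'm \<Rightarrow> real"
  assumes f: "f \<in> nondegenerate_homogeneous_funs d"
  obtains M where "M \<ge> 1" "\<And>y. \<bar>f y\<bar> \<le> M * norm y powr d"
proof -
  have "f differentiable_on sphere 0 1"
    by (auto simp: differentiable_on_def intro!: differentiable_at_withinI nondegenerate_C2(1)[OF f])
  then have "continuous_on (sphere 0 1) f" by (rule differentiable_imp_continuous_on)
  then have "bounded (f ` sphere 0 1)" by (intro compact_imp_bounded compact_continuous_image) auto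
  then obtain b where b: "\<forall>x\<in>sphere 0 1. \<bar>f x\<bar> \<le> b" by (auto simp: bounded_iff)
  show ?thesis
  proof (rule that[of "max b 1"])
    fix y
    show "\<bar>f y\<bar> \<le> max b 1 * norm y powr d"
    proof (cases "y = 0")
      case False
      have "f y = f (norm y *\<^sub>R ((1 / norm y) *\<^sub>R y))" using False by simp
      also have "\<dots> = norm y powr d * f ((1 / norm y) *\<^sub>R y)" by (rule homogeneous_scaleR[OF f]) simp
      finally have "\<bar>f y\<bar> = norm y powr d * \<bar>f ((1 / norm y) *\<^sub>R y)\<bar>" by (simp add: abs_mult)
      moreover have "\<bar>f ((1 / norm y) *\<^sub>R y)\<bar> \<le> max b 1" using b False by (intro max.coboundedI1) auto
      then have "norm y powr d * \<bar>f ((1 / norm y) *\<^sub>R y)\<bar> \<le> norm y powr d * max b 1" by (intro mult_left_mono) auto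
      ultimately show ?thesis by (simp only: mult.commute)
    qed (simp add: homogeneous_zero[OF f])
  qed simp
qed

text \<open>The second term comes from the origin alone: \<nu> solves
  \<open>2 * Q * M * \<nu> powr d = \<delta>\<close>, so every fraction within \<nu> of 0 satisfies
  the condition with the nearest integer replaced by 0.\<close>

lemma N_set_lower_zero:
  fixes f :: "real ^ 'm \<Rightarrow> real"
  assumes f: "f \<in> nondegenerate_homogeneous_funs d" and d: "d > 0"
  obtains c where "c > 0" "\<forall>\<delta> Q. 1 \<le> Q \<longrightarrow> 0 < \<delta> \<longrightarrow> \<delta> < 1 / 2 \<longrightarrow>
    c * ((\<delta> / Q) powr (real CARD('m) / d) * Q ^ (CARD('m) + 1)) \<le> real (card (N_set f \<delta> Q))"
proof -
  let ?m = "CARD('m)"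
  have m: "real ?m \<ge> 1" using one_le_card_finite[where 'a = 'm] by linarith
  obtain M where M: "M \<ge> 1" and fM: "\<And>y. \<bar>f y\<bar> \<le> M * norm y powr d" by (rule homogeneous_bound[OF f]) blast
  define c where "c = 1 / 2 * (1 / real ?m) ^ ?m * (1 / (2 * M)) powr (real ?m / d)"
  have c: "c > 0" using m M by (simp add: c_def)
  show ?thesis
  proof (rule that[OF c], intro allI impI)
    fix \<delta> Q :: real assume Q: "1 \<le> Q" and \<delta>: "0 < \<delta>" "\<delta> < 1 / 2"
    define \<nu> where "\<nu> = (\<delta> / (2 * Q * M)) powr (1 / d)"
    have base: "0 < \<delta> / (2 * Q * M)" "\<delta> / (2 * Q * M) < 1"
    proof -
      show "0 < \<delta> / (2 * Q * M)" using \<delta> Q M by simp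
      have "1 * 1 \<le> Q * M" using Q M by (intro mult_mono) auto
      then show "\<delta> / (2 * Q * M) < 1" using \<delta> Q M by (simp add: pos_divide_less_eq)
    qed
    have \<nu>: "\<nu> > 0" "\<nu> < 1" "\<nu> powr d = \<delta> / (2 * Q * M)"
    proof -
      define z where "z = \<delta> / (2 * Q * M)"
      have "0 < z" "z < 1" using base by (simp_all add: z_def)
      then have "z powr (1 / d) > 0" "z powr (1 / d) < 1" "(z powr (1 / d)) powr d = z"
        using d powr_less_mono2[of "1 / d" z 1] by (auto simp: powr_powr)
      then show "\<nu> > 0" "\<nu> < 1" "\<nu> powr d = \<delta> / (2 * Q * M)" by (simp_all only: \<nu>_def z_def)
    qed
    define A where "A = {\<lceil>Q\<rceil>..<\<lceil>2 * Q\<rceil>}"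
    define S where "S = {a :: int ^ 'm. norm (1 *\<^sub>R real_vec a - 0) \<le> Q * \<nu>}"
    have finS: "finite S" unfolding S_def using Q \<nu> by (intro finite_lattice_ball) auto
    have sub: "A \<times> S \<subseteq> N_set f \<delta> Q"
    proof safe
      fix q a assume q: "q \<in> A" and a: "a \<in> S"
      have q1: "Q \<le> real_of_int q" "real_of_int q < 2 * Q" using q by (auto simp: A_def ceiling_le_iff less_ceiling_iff)
      have qpos: "real_of_int q > 0" using q1 Q by linarith
      have "norm (real_vec a) \<le> Q * \<nu>" using a by (simp add: S_def)
      also have "\<dots> \<le> real_of_int q * \<nu>" using q1 \<nu> by (intro mult_right_mono) auto
      finally have n: "norm (real_vec a) \<le> real_of_int q * \<nu>" .
      also have "\<dots> < real_of_int q * 1" using \<nu> qpos by (intro mult_strict_left_mono) auto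
      finally have n1: "norm (real_vec a) < real_of_int q" by simp
      have "norm (rational_point q a) \<le> \<nu>" using n qpos by (simp add: rational_point_eq field_simps)
      then have "norm (rational_point q a) powr d \<le> \<nu> powr d" using d by (intro powr_mono2) auto
      then have "M * norm (rational_point q a) powr d \<le> M * \<nu> powr d" using M by (intro mult_left_mono) auto
      then have "\<bar>f (rational_point q a)\<bar> \<le> M * \<nu> powr d" using fM order_trans by blast
      then have "\<bar>real_of_int q * f (rational_point q a)\<bar> \<le> (2 * Q) * (M * \<nu> powr d)"
        unfolding abs_mult using q1 Q qpos by (intro mult_mono) auto
      also have "\<dots> = \<delta>" unfolding \<nu>(3) using Q M by simp
      finally have "\<bar>real_of_int q * f (rational_point q a) - real_of_int 0\<bar> \<le> \<delta>" by simp
      then show "(q, a) \<in> N_set f \<delta> Q" unfolding N_set_def using q1 n1 by blast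
    qed
    have "card (A \<times> S) \<le> card (N_set f \<delta> Q)" using Q by (intro card_mono finite_N_set sub) auto
    then have le: "real (card A) * real (card S) \<le> real (card (N_set f \<delta> Q))"
      by (simp only: card_cartesian_product of_nat_mult[symmetric] of_nat_le_iff)
    have cA: "Q / 2 \<le> real (card A)"
    proof -
      have "\<lceil>Q\<rceil> < \<lceil>2 * Q\<rceil>" unfolding less_ceiling_iff using Q by linarith
      then have 1: "real (card A) = real_of_int \<lceil>2 * Q\<rceil> - real_of_int \<lceil>Q\<rceil>" "1 \<le> \<lceil>2 * Q\<rceil> - \<lceil>Q\<rceil>"
        by (simp_all add: A_def)
      then show ?thesis by linarith
    qed
    have cS: "(Q * \<nu> / real ?m) ^ ?m \<le> real (card S)"
    proof (cases "Q * \<nu> \<ge> real ?m")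
      case True
      then have "(Q * \<nu> / (real ?m * 1)) ^ ?m \<le> real (card S)"
        unfolding S_def using Q \<nu> by (intro card_lattice_ball_ge) auto
      then show ?thesis by simp
    \<comment> \<open>If the ball is too small for the lattice count, the single point
      \<open>a = 0\<close> is enough.\<close>
    next
      case False
      then have "(Q * \<nu> / real ?m) ^ ?m \<le> 1" using Q \<nu> m by (intro power_le_one) auto
      moreover have "0 \<in> S" using Q \<nu> by (simp add: S_def real_vec_def zero_vec_def[symmetric])
      then have "0 < card S" using finS by (auto simp: card_gt_0_iff)
      ultimately show ?thesis by linarith
    qed
    have "\<nu> ^ ?m = \<nu> powr real ?m" using \<nu> by (simp add: powr_realpow)
    also have "\<dots> = (\<delta> / (2 * Q * M)) powr (real ?m / d)" by (simp add: \<nu>_def powr_powr)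
    also have "\<delta> / (2 * Q * M) = (\<delta> / Q) * (1 / (2 * M))" by simp
    also have "\<dots> powr (real ?m / d) = (\<delta> / Q) powr (real ?m / d) * (1 / (2 * M)) powr (real ?m / d)"
      using \<delta> Q M by (intro powr_mult)
    finally have \<nu>m: "\<nu> ^ ?m = \<dots>" .
    have "c * ((\<delta> / Q) powr (real ?m / d) * Q ^ (?m + 1)) = Q / 2 * (Q * \<nu> / real ?m) ^ ?m"
      unfolding power_divide power_mult_distrib \<nu>m by (simp add: c_def power_divide)
    also have "\<dots> \<le> real (card A) * real (card S)" using cA cS Q \<nu> by (intro mult_mono) auto
    finally show "c * ((\<delta> / Q) powr (real ?m / d) * Q ^ (?m + 1)) \<le> real (card (N_set f \<delta> Q))" using le by linarith
  qed
qed

text \<open>Net points within \<open>r\<close> of two distinct points of a lattice of spacing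
  \<open>3 * r\<close> are distinct. The radius \<open>\<rho> / 4\<close> keeps that lattice
  strictly inside the covered ball, and 12 = 3 * 4.\<close>

lemma net_card_ge:
  fixes x0 :: "real ^ 'm"
  assumes r: "r > 0" "12 * real CARD('m) * r \<le> \<rho>" and R: "finite R"
    "\<And>c. c \<in> ball x0 (\<rho> / 2) \<Longrightarrow> \<exists>c'\<in>R. norm (c' - c) \<le> r"
  shows "(\<rho> / (12 * real CARD('m) * r)) ^ CARD('m) \<le> real (card R)"
proof -
  let ?m = "CARD('m)"
  have m: "real ?m \<ge> 1" using one_le_card_finite[where 'a = 'm] by linarith
  have \<rho>: "\<rho> > 0" using r m by (smt (verit) mult_pos_pos)
  define S where "S = {k :: int ^ 'm. norm ((3 * r) *\<^sub>R real_vec k - 0) \<le> \<rho> / 4}"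
  define g where "g k = x0 + (3 * r) *\<^sub>R real_vec k" for k :: "int ^ 'm"
  have gb: "g k \<in> ball x0 (\<rho> / 2)" if "k \<in> S" for k
  proof -
    have "dist x0 (g k) = norm ((3 * r) *\<^sub>R real_vec k)" by (simp add: g_def dist_norm)
    then show ?thesis using that \<rho> by (simp add: S_def)
  qed
  have "\<forall>k\<in>S. \<exists>c\<in>R. norm (c - g k) \<le> r" using R(2) gb by blast
  then obtain h where h: "\<And>k. k \<in> S \<Longrightarrow> h k \<in> R \<and> norm (h k - g k) \<le> r" by metis
  have "inj_on h S"
  proof (rule inj_onI, rule ccontr)
    fix k k' assume k: "k \<in> S" "k' \<in> S" "h k = h k'" "k \<noteq> k'"
    have eq: "g k - g k' = (3 * r) *\<^sub>R real_vec (k - k')" by (simp add: g_def real_vec_diff algebra_simps)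
    have "norm (real_vec (k - k')) \<ge> 1" using k(4) by (intro norm_real_vec_ge_1) simp
    then have "3 * r \<le> norm (g k - g k')" unfolding eq using r by simp
    moreover have "norm (g k - g k') \<le> norm (h k' - g k') + norm (h k - g k)"
      using norm_triangle_ineq4[of "h k' - g k'" "h k - g k"] k(3) by simp
    ultimately show False using h[OF k(1)] h[OF k(2)] r by linarith
  qed
  then have "card S \<le> card R" using h R(1) by (intro card_inj_on_le[of h]) auto
  moreover have "(\<rho> / 4 / (real ?m * (3 * r))) ^ ?m \<le> real (card S)"
    unfolding S_def using r \<rho> m by (intro card_lattice_ball_ge) auto
  moreover have "\<rho> / 4 / (real ?m * (3 * r)) = \<rho> / (12 * real ?m * r)" by simp
  ultimately show ?thesis by (simp only: of_nat_le_iff[symmetric, where 'a = real])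
qed

text \<open>The first term already comes from a neighbourhood of one point of norm 1/2, without
  rescaling; radius at most 1/4 keeps it in the unit ball. One sum over a net is bounded from both
  sides by the two preceding estimates, at a tolerance
  \<open>\<delta>1 = \<kappa> * \<delta>\<close> that leaves room for taking multiples.\<close>

lemma N_set_lower_main:
  fixes f :: "real ^ 'm \<Rightarrow> real"
  assumes m: "CARD('m) \<ge> 2" and f: "f \<in> nondegenerate_homogeneous_funs d" and \<epsilon>: "\<epsilon> > 0"
  obtains c where "c > 0" "\<forall>\<delta> Q. (\<delta>, Q) \<in> admissible \<epsilon> \<longrightarrow> c * (\<delta> * Q ^ (CARD('m) + 1)) \<le> real (card (N_set f \<delta> Q))"
proof -
  let ?m = "CARD('m)"
  have m1: "real ?m \<ge> 2" using m by simp
  obtain x0 :: "real ^ 'm" where x0: "norm x0 = 1 / 2" using vector_choose_size[of "1 / 2"] by auto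
  then have "x0 \<noteq> 0" by auto
  then obtain \<rho>0 L where \<rho>0: "\<rho>0 > 0" and nd0: "nondeg L (ball x0 \<rho>0) (\<lambda>x. x) f (grad f)" by (rule local_nondeg[OF f])
  define \<rho> where "\<rho> = min \<rho>0 (1 / 4)"
  have \<rho>: "\<rho> > 0" "\<rho> \<le> \<rho>0" "\<rho> \<le> 1 / 4" using \<rho>0 by (auto simp: \<rho>_def)
  have nd: "nondeg L (ball x0 \<rho>) (\<lambda>x. x) f (grad f)" by (rule nondeg_subset[OF nd0]) (use \<rho> in auto)
  have nd2: "nondeg L (ball x0 (\<rho> / 2)) (\<lambda>x. x) f (grad f)" by (rule nondeg_subset[OF nd]) (use \<rho> in auto)
  have ball1: "norm y < 1" if "y \<in> ball x0 \<rho>" for y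
  proof -
    have "norm (y - x0) < 1 / 4" using that \<rho> by (simp add: dist_norm norm_minus_commute)
    then show ?thesis using norm_triangle_ineq2[of y x0] x0 by linarith
  qed
  have L: "L \<ge> 1" by (rule nondegD(1)[OF nd])
  define e where "e = min \<epsilon> 1"
  have e: "0 < e" "e \<le> 1" "e \<le> \<epsilon>" using \<epsilon> by (auto simp: e_def)
  define \<theta> where "\<theta> = 1 - e / 2"
  have \<theta>: "0 \<le> \<theta>" "\<theta> < 1" "\<theta> \<le> 1" using e by (auto simp: \<theta>_def)
  obtain K where K: "K \<ge> 0" "near_bound TYPE('m) L \<theta> K" using near_bound_exists[OF m L \<theta>(2)] by blast
  define \<Lambda> where "\<Lambda> = (2 * real ?m + 3) ^ ?m"
  have \<Lambda>: "\<Lambda> > 0" using m1 by (simp add: \<Lambda>_def)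
  define C0 where "C0 = 2 * 24 ^ (?m + 2) * real ?m ^ ?m"
  define Z where "Z = (4 * L + 1) * (3 ^ ?m * 3) + 1"
  define c1 where "c1 = 1 / 8 * (1 / (2 * real ?m)) ^ ?m"
  have pos: "C0 > 0" "Z > 0" "c1 > 0" using m1 L by (auto simp: C0_def Z_def c1_def intro!: add_nonneg_pos)
  \<comment> \<open>Small enough for the triples with \<open>|q| \<le> \<eta> * Q\<close> to make up
    at most half of the pigeonhole bound.\<close>
  define \<eta> where "\<eta> = min 1 (c1 / (C0 * Z))"
  have \<eta>: "0 < \<eta>" "\<eta> \<le> 1" "C0 * \<eta> * Z \<le> c1"
  proof -
    show "0 < \<eta>" "\<eta> \<le> 1" using pos by (auto simp: \<eta>_def)
    have "\<eta> \<le> c1 / (C0 * Z)" by (simp add: \<eta>_def)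
    then show "C0 * \<eta> * Z \<le> c1" using pos by (simp add: pos_le_divide_eq mult_ac)
  qed
  \<comment> \<open>Cancels the factor \<open>6 * L^2 / \<eta>^3\<close> lost in
    \<open>sum_large_pts_le\<close>.\<close>
  define \<kappa> where "\<kappa> = \<eta> ^ 3 / (6 * L\<^sup>2)"
  have \<kappa>: "\<kappa> > 0" "\<kappa> \<le> 1" "6 * L\<^sup>2 / \<eta> ^ 3 * \<kappa> = 1"
  proof -
    show "\<kappa> > 0" "6 * L\<^sup>2 / \<eta> ^ 3 * \<kappa> = 1" using \<eta> L by (auto simp: \<kappa>_def)
    have "1 \<le> L\<^sup>2" using L by simp
    moreover have "\<eta> ^ 3 \<le> 1" using \<eta> by (intro power_le_one) auto
    ultimately show "\<kappa> \<le> 1" unfolding \<kappa>_def by (subst pos_divide_le_eq) linarith+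
  qed
  define c2 where "c2 = (\<rho> / (12 * real ?m)) ^ ?m"
  have c2: "c2 > 0" using \<rho> m1 by (simp add: c2_def)
  define D where "D = \<Lambda> * (2 * L) ^ ?m * K * weight ?m 1 1"
  have D: "D \<ge> 0" unfolding D_def using \<Lambda> L K weight_nonneg[of 1 1 ?m] by (intro mult_nonneg_nonneg) auto
  define E where "E = 1 + 1 / (e / 4 * ln 2)"
  have E: "E \<ge> 0" using e by (simp add: E_def)
  \<comment> \<open>\<open>T\<close> collects all the conditions on \<open>Q\<close>; for \<open>Q powr (e / 4) < T\<close> a single point suffices.\<close>
  define T where "T = max 1 (max (16 * (real ?m)\<^sup>2 / \<kappa>) (max (1 / (\<eta> * \<kappa>)) (max (1 / \<eta>) (max ((12 * real ?m / (\<rho> * \<eta>))\<^sup>2) (2 * D * E / (\<kappa> * c2))))))"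
  have T: "1 \<le> T" "16 * (real ?m)\<^sup>2 / \<kappa> \<le> T" "1 / (\<eta> * \<kappa>) \<le> T" "1 / \<eta> \<le> T" "(12 * real ?m / (\<rho> * \<eta>))\<^sup>2 \<le> T" "2 * D * E / (\<kappa> * c2) \<le> T"
    unfolding T_def le_max_iff_disj by blast+
  define Q0 where "Q0 = T powr (4 / e)"
  have Q0: "Q0 > 0" using T by (simp add: Q0_def)
  define w where "w = \<Lambda> * (1 / \<eta>) ^ ?m * (4 / \<eta>)"
  have w: "w > 0" using \<Lambda> \<eta> by (simp add: w_def)
  define c where "c = min (1 / Q0 ^ (?m + 1)) (c1 * c2 * \<kappa> / w)"
  have c: "c > 0" using Q0 pos c2 \<kappa> w by (simp add: c_def)
  show ?thesis
  proof (rule that[OF c], intro allI impI)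
    fix \<delta> Q assume adm: "(\<delta>, Q) \<in> admissible \<epsilon>"
    then have a: "Q \<ge> 1" "Q powr (\<epsilon> - 1) < \<delta>" "\<delta> < 1 / 2" by (auto simp: admissible_def)
    have Qpos: "Q > 0" using a by simp
    have "0 < Q powr (\<epsilon> - 1)" using Qpos by simp
    then have \<delta>: "\<delta> > 0" using a by linarith
    have cle: "c \<le> 1 / Q0 ^ (?m + 1)" "c \<le> c1 * c2 * \<kappa> / w" by (auto simp: c_def)
    show "c * (\<delta> * Q ^ (?m + 1)) \<le> real (card (N_set f \<delta> Q))"
    proof (cases "T \<le> Q powr (e / 4)")
      case False
      then have "(Q powr (e / 4)) powr (4 / e) \<le> T powr (4 / e)" using e by (intro powr_mono2) auto
      then have QQ0: "Q \<le> Q0" using e Qpos by (simp add: powr_powr Q0_def)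
      have X: "\<delta> * Q ^ (?m + 1) \<le> 1 * Q0 ^ (?m + 1)"
        using QQ0 a \<delta> by (intro mult_mono power_mono) auto
      have "c * (\<delta> * Q ^ (?m + 1)) \<le> (1 / Q0 ^ (?m + 1)) * (1 * Q0 ^ (?m + 1))"
        by (rule mult_mono[OF cle(1) X]) (use \<delta> Qpos Q0 in auto)
      also have "\<dots> = 1" using Q0 by simp
      also have "1 \<le> real (card (N_set f \<delta> Q))" using a \<delta> by (intro N_set_nonempty[OF f]) auto
      finally show ?thesis .
    next
      case True
      have Q4e: "Q powr (e / 4) \<le> Q powr e" using a e by (intro powr_mono) auto
      have "Q powr (e / 4) \<le> Q powr 1" using a e by (intro powr_mono) auto
      then have Q4: "Q powr (e / 4) \<le> Q" using Qpos by simp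
      have "Q powr (e - 1) \<le> Q powr (\<epsilon> - 1)" using a e by (intro powr_mono) auto
      then have "Q powr (e - 1) \<le> \<delta>" using a by linarith
      then have "Q * Q powr (e - 1) \<le> Q * \<delta>" using Qpos by (intro mult_left_mono) auto
      then have Qe: "Q powr e \<le> Q * \<delta>" using Qpos by (simp add: powr_diff)
      define \<delta>1 where "\<delta>1 = \<kappa> * \<delta>"
      have \<delta>1: "\<delta>1 > 0" "\<delta>1 \<le> 1"
      proof -
        show "\<delta>1 > 0" using \<kappa> \<delta> by (simp add: \<delta>1_def)
        have "\<kappa> * \<delta> \<le> 1 * 1" using \<kappa> \<delta> a by (intro mult_mono) auto
        then show "\<delta>1 \<le> 1" by (simp add: \<delta>1_def)
      qed
      have Q\<delta>1: "\<kappa> * Q powr e \<le> Q * \<delta>1" using Qe \<kappa> by (simp add: \<delta>1_def mult.left_commute)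
      have big: "\<kappa> * T \<le> Q * \<delta>1"
      proof -
        have "T \<le> Q powr e" using True Q4e by linarith
        then have "\<kappa> * T \<le> \<kappa> * Q powr e" using \<kappa> by (intro mult_left_mono) auto
        then show ?thesis using Q\<delta>1 by linarith
      qed
      have big1: "16 * (real ?m)\<^sup>2 \<le> Q * \<delta>1" "1 / \<eta> \<le> Q * \<delta>1"
      proof -
        have "16 * (real ?m)\<^sup>2 \<le> \<kappa> * T" using T(2) \<kappa> by (simp add: pos_divide_le_eq mult.commute)
        then show "16 * (real ?m)\<^sup>2 \<le> Q * \<delta>1" using big by linarith
        have "1 / \<eta> = \<kappa> * (1 / (\<eta> * \<kappa>))" using \<kappa> by simp
        also have "\<dots> \<le> \<kappa> * T" using T(3) \<kappa> by (intro mult_left_mono) auto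
        finally show "1 / \<eta> \<le> Q * \<delta>1" using big by linarith
      qed
      define B where "B = sqrt (Q * \<delta>1)"
      have B2: "B\<^sup>2 = Q * \<delta>1" using Qpos \<delta>1 by (simp add: B_def)
      have B4: "4 * real ?m \<le> B" unfolding B_def by (rule real_le_rsqrt) (use big1 in \<open>simp add: power_mult_distrib\<close>)
      have B1: "B \<ge> 1" using B4 m1 by linarith
      define r where "r = B / Q"
      have r0: "r > 0" using B1 Qpos by (simp add: r_def)
      have BrQ: "B = r * Q" using Qpos by (simp add: r_def)
      have \<eta>Q: "1 \<le> \<eta> * Q" "1 / \<delta>1 \<le> \<eta> * Q"
      proof -
        have "1 / \<eta> \<le> Q" using T(4) True Q4 by linarith
        then show "1 \<le> \<eta> * Q" using \<eta> by (simp add: pos_divide_le_eq mult.commute)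
        show "1 / \<delta>1 \<le> \<eta> * Q" using big1(2) \<eta> \<delta>1 by (simp add: pos_divide_le_eq mult_ac)
      qed
      have r1: "12 * real ?m * r \<le> \<rho> * \<eta>"
      proof -
        have "r\<^sup>2 = \<delta>1 / Q" using B2 Qpos by (simp add: r_def power_divide power2_eq_square)
        also have "\<dots> \<le> 1 / Q" using \<delta>1 Qpos by (intro divide_right_mono) auto
        also have "\<dots> \<le> 1 / (12 * real ?m / (\<rho> * \<eta>))\<^sup>2"
          using T(5) True Q4 Qpos \<rho> \<eta> m1 by (intro divide_left_mono) auto
        also have "\<dots> = (\<rho> * \<eta> / (12 * real ?m))\<^sup>2" using \<rho> \<eta> m1 by (simp add: power_divide)
        finally have "r \<le> \<rho> * \<eta> / (12 * real ?m)" by (rule power2_le_imp_le) (use \<rho> \<eta> in auto)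
        then show ?thesis using m1 by (simp add: pos_le_divide_eq mult.commute)
      qed
      have r2: "12 * real ?m * r \<le> \<rho>"
      proof -
        have "\<rho> * \<eta> \<le> \<rho> * 1" using \<rho> \<eta> by (intro mult_left_mono) auto
        then show ?thesis using r1 by linarith
      qed
      have r3: "r / \<eta> \<le> \<rho> / 2"
      proof -
        have "2 * r \<le> 12 * real ?m * r" using m1 r0 by (intro mult_right_mono) auto
        then have "2 * r \<le> \<rho> * \<eta>" using r1 by linarith
        then show ?thesis using \<eta> by (simp add: pos_divide_le_eq)
      qed
      have "\<exists>R. R \<subseteq> ball x0 (\<rho> / 2) \<and> sparse_net \<Lambda> r R (\<lambda>x. x) \<and> (\<forall>c\<in>ball x0 (\<rho> / 2). \<exists>c'\<in>R. norm (c' - c) \<le> r)"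
      proof (rule exists_sparse_net[OF r0 nondegD(2)[OF nd2]])
        fix R assume "R \<subseteq> ball x0 (\<rho> / 2)" "sparse_net ((2 * real ?m + 3) ^ ?m) r R (\<lambda>x :: real ^ 'm. x)"
          "\<And>c. c \<in> ball x0 (\<rho> / 2) \<Longrightarrow> \<exists>c'\<in>R. norm (c' - c) \<le> r"
        then show ?thesis unfolding \<Lambda>_def by (intro exI[of _ R]) simp
      qed
      then obtain R where R: "R \<subseteq> ball x0 (\<rho> / 2)" "sparse_net \<Lambda> r R (\<lambda>x. x)"
        and cov: "\<forall>c\<in>ball x0 (\<rho> / 2). \<exists>c'\<in>R. norm (c' - c) \<le> r" by blast
      have finR: "finite R" using R(2) by (simp add: sparse_net_def)
      have "(\<rho> / (12 * real ?m * r)) ^ ?m \<le> real (card R)"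
        using cov by (intro net_card_ge[OF r0 r2 finR]) blast
      then have cR: "c2 / r ^ ?m \<le> real (card R)" by (simp add: c2_def power_divide power_mult_distrib)
      define J where "J = 1 / \<delta>1"
      have J: "J \<ge> 1" "J \<le> Q"
      proof -
        show "J \<ge> 1" using \<delta>1 by (simp add: J_def)
        have "\<eta> * Q \<le> 1 * Q" using \<eta> Qpos by (intro mult_right_mono) auto
        then show "J \<le> Q" using \<eta>Q by (simp add: J_def)
      qed
      have rJ: "J * r = 1 / B" using B2 B1 Qpos \<delta>1 by (simp add: J_def r_def field_simps power2_eq_square)
      \<comment> \<open>As \<open>J * r = 1 / B\<close>, the claim reduces to
        \<open>D * (1 / B) ^ m * Y \<le> c2\<close>. Here \<open>Y\<close> is at most
        \<open>2 * Q powr (e / 2)\<close> times a logarithm, while \<open>m \<ge> 2\<close> gives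
        \<open>(1 / B) ^ m \<le> Q powr - e / \<kappa>\<close>. Half of the surplus
        \<open>Q powr - (e / 2)\<close> absorbs the logarithm, and the lower bound \<open>T\<close>
        on \<open>Q powr (e / 4)\<close> takes care of the constants.\<close>
      have small: "\<Lambda> * (2 * L) ^ ?m * (1 / \<delta>1) ^ ?m * K * weight ?m 1 1 *
        (1 / (\<delta>1 * (\<eta> * Q)) + (1 / \<delta>1) powr (1 - \<theta>)) * (1 + log 2 (1 / \<delta>1)) \<le> real (card R)"
      proof -
        define Y where "Y = (1 / (\<delta>1 * (\<eta> * Q)) + J powr (1 - \<theta>)) * (1 + log 2 J)"
        have "1 / (\<delta>1 * (\<eta> * Q)) \<le> 1" using \<eta>Q \<delta>1 by (simp add: field_simps)
        moreover have J1: "1 \<le> J powr (1 - \<theta>)" using J \<theta> by (simp add: ge_one_powr_ge_zero)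
        ultimately have "1 / (\<delta>1 * (\<eta> * Q)) + J powr (1 - \<theta>) \<le> 2 * J powr (1 - \<theta>)" by linarith
        also have "\<dots> \<le> 2 * Q powr (e / 2)" using J e by (simp add: \<theta>_def powr_mono2)
        finally have y1: "1 / (\<delta>1 * (\<eta> * Q)) + J powr (1 - \<theta>) \<le> 2 * Q powr (e / 2)" .
        have y2: "1 + log 2 J \<le> 1 + log 2 Q" using J by simp
        have "Y \<le> (2 * Q powr (e / 2)) * (1 + log 2 Q)"
          unfolding Y_def using y1 y2 J by (intro mult_mono) auto
        moreover have "(1 / B) ^ ?m \<le> Q powr - e / \<kappa>"
        proof -
          have "(1 / B) ^ ?m \<le> (1 / B)\<^sup>2" using B1 m by (intro power_decreasing) auto
          also have "\<dots> = 1 / (Q * \<delta>1)" by (simp add: power_divide B2)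
          also have "\<dots> \<le> 1 / (\<kappa> * Q powr e)" using Q\<delta>1 \<kappa> Qpos \<delta>1 by (intro divide_left_mono) auto
          also have "\<dots> = Q powr - e / \<kappa>" by (simp add: powr_minus field_simps)
          finally show ?thesis .
        qed
        moreover have Y0: "Y \<ge> 0" unfolding Y_def using J \<delta>1 \<eta> Qpos by (intro mult_nonneg_nonneg add_nonneg_nonneg) auto
        ultimately have "(1 / B) ^ ?m * Y \<le> (Q powr - e / \<kappa>) * ((2 * Q powr (e / 2)) * (1 + log 2 Q))"
          using \<kappa> by (intro mult_mono) auto
        also have "\<dots> = 2 / \<kappa> * ((Q powr - e * Q powr (e / 2)) * (1 + log 2 Q))" by simp
        also have "Q powr - e * Q powr (e / 2) = Q powr - (e / 4) * Q powr - (e / 4)"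
          by (simp add: powr_add[symmetric])
        also have "2 / \<kappa> * (Q powr - (e / 4) * Q powr - (e / 4) * (1 + log 2 Q)) = 2 / \<kappa> * Q powr - (e / 4) * (Q powr - (e / 4) * (1 + log 2 Q))"
          by (simp only: mult.assoc)
        also have "\<dots> \<le> 2 / \<kappa> * Q powr - (e / 4) * E"
          using powr_neg_log_bound[OF a(1), of "e / 4"] e \<kappa> unfolding E_def by (intro mult_left_mono) auto
        finally have "D * ((1 / B) ^ ?m * Y) \<le> D * (2 / \<kappa> * Q powr - (e / 4) * E)" using D by (intro mult_left_mono) auto
        also have "\<dots> = (2 * D * E / \<kappa>) / Q powr (e / 4)" by (simp add: powr_minus field_simps)
        also have "\<dots> \<le> c2"
        proof -
          have "2 * D * E / (\<kappa> * c2) \<le> Q powr (e / 4)" using T(6) True by linarith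
          then have "2 * D * E / \<kappa> \<le> c2 * Q powr (e / 4)" using \<kappa> c2 by (simp add: field_simps)
          moreover have "Q powr (e / 4) > 0" using Qpos by simp
          ultimately show ?thesis by (simp only: pos_divide_le_eq)
        qed
        finally have fin: "D * ((1 / B) ^ ?m * Y) \<le> c2" .
        have "(1 / B) ^ ?m = J ^ ?m * r ^ ?m" unfolding rJ[symmetric] by (rule power_mult_distrib)
        then have "(D * (J ^ ?m * Y)) * r ^ ?m \<le> c2" using fin by (simp add: mult_ac)
        then have "D * (J ^ ?m * Y) \<le> c2 / r ^ ?m" using r0 by (simp add: pos_le_divide_eq)
        then have "D * (J ^ ?m * Y) \<le> real (card R)" using cR by linarith
        then show ?thesis unfolding D_def Y_def J_def by (simp only: mult_ac)
      qed
      have \<eta>c: "2 * 24 ^ (?m + 2) * real ?m ^ ?m * \<eta> * ((4 * L + 1) * (3 ^ ?m * 3) + 1) \<le> 1 / 8 * (1 / (2 * real ?m)) ^ ?m"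
        using \<eta>(3) unfolding C0_def Z_def c1_def .
      have lower: "real (card R) * (c1 * (Q * B ^ ?m * \<delta>1)) \<le>
         (\<Sum>c\<in>R. real (card {p \<in> pts 1 1 c (f c) (grad f c) Q B \<delta>1. \<eta> * Q < \<bar>real_of_int (fst p)\<bar>}))"
        unfolding c1_def
        by (rule sum_large_pts_ge[OF nd2 R r0 less_imp_le[OF \<Lambda>] K(2,1) \<theta>(1,3) \<eta>(1,2) \<eta>Q(1) \<delta>1 \<eta>Q(2) BrQ B2 B4 small \<eta>c])
      have upper: "(\<Sum>c\<in>R. real (card {p \<in> pts 1 1 c (f c) (grad f c) Q B \<delta>1. \<eta> * Q < \<bar>real_of_int (fst p)\<bar>}))
         \<le> w * real (card (N_set f \<delta> Q))"
        unfolding w_def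
      proof (rule sum_large_pts_le[OF nd ball1 R r0 r3 less_imp_le[OF \<Lambda>] \<eta>(1,2) a(1) BrQ B2 \<delta>1(1) _ a(3)])
        have "6 * L\<^sup>2 / \<eta> ^ 3 * \<delta>1 = (6 * L\<^sup>2 / \<eta> ^ 3 * \<kappa>) * \<delta>" unfolding \<delta>1_def by (simp only: mult.assoc)
        then show "6 * L\<^sup>2 / \<eta> ^ 3 * \<delta>1 \<le> \<delta>" unfolding \<kappa>(3) by simp
      qed
      \<comment> \<open>Since \<open>B = r * Q\<close>, the powers of \<open>r\<close> cancel
        between the size of the net and the volume of a body.\<close>
      have "c1 * c2 * \<kappa> * (\<delta> * Q ^ (?m + 1)) = c2 / r ^ ?m * (c1 * (Q * B ^ ?m * \<delta>1))"
        using r0 by (simp add: BrQ power_mult_distrib \<delta>1_def)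
      also have "\<dots> \<le> real (card R) * (c1 * (Q * B ^ ?m * \<delta>1))"
        using cR pos Qpos B1 \<delta>1 by (intro mult_right_mono) auto
      also have "\<dots> \<le> w * real (card (N_set f \<delta> Q))" using lower upper by linarith
      finally have "c1 * c2 * \<kappa> / w * (\<delta> * Q ^ (?m + 1)) \<le> real (card (N_set f \<delta> Q))"
        using w by (simp add: pos_divide_le_eq mult.commute)
      moreover have "c * (\<delta> * Q ^ (?m + 1)) \<le> c1 * c2 * \<kappa> / w * (\<delta> * Q ^ (?m + 1))"
        using cle(2) \<delta> Qpos by (intro mult_right_mono) auto
      ultimately show ?thesis by linarith
    qed
  qed
qed

section \<open>Conclusion: both bounds in Landau notation\<close>

lemma N_count_bounds:
  fixes f :: "real ^ 'm \<Rightarrow> real"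
  assumes m: "CARD('m) \<ge> 2" and d: "d > 1" and f: "f \<in> nondegenerate_homogeneous_funs d" and \<epsilon>: "\<epsilon> > 0"
  shows "(\<lambda>(\<delta>, Q). \<delta> * Q ^ (CARD('m) + 1) + (\<delta> / Q) powr (real CARD('m) / d) * Q ^ (CARD('m) + 1))
      \<in> O[principal (admissible \<epsilon>)](\<lambda>(\<delta>, Q). real (N_count f \<delta> Q))"
    and "(\<lambda>(\<delta>, Q). real (N_count f \<delta> Q)) \<in> O[principal (admissible \<epsilon>)](\<lambda>(\<delta>, Q). \<delta> * Q ^ (CARD('m) + 1) +
      (\<delta> / Q) powr (real CARD('m) / d) * Q ^ (CARD('m) + 1) * (if d \<le> 2 * real CARD('m) then 1 else Q powr \<epsilon>))"
proof -
  let ?m = "CARD('m)"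
  have adm: "Q \<ge> 1 \<and> \<delta> > 0 \<and> \<delta> < 1 / 2" if "(\<delta>, Q) \<in> admissible \<epsilon>" for \<delta> Q
  proof -
    have a: "Q \<ge> 1" "Q powr (\<epsilon> - 1) < \<delta>" "\<delta> < 1 / 2" using that by (auto simp: admissible_def)
    have "0 \<le> Q powr (\<epsilon> - 1)" by simp
    then show ?thesis using a by linarith
  qed
  obtain c1 where c1: "c1 > 0" "\<forall>\<delta> Q. (\<delta>, Q) \<in> admissible \<epsilon> \<longrightarrow> c1 * (\<delta> * Q ^ (?m + 1)) \<le> real (card (N_set f \<delta> Q))"
    by (rule N_set_lower_main[OF m f \<epsilon>])
  have "d > 0" using d by simp
  from N_set_lower_zero[OF f this] obtain c2 where c2: "c2 > 0" "\<forall>\<delta> Q. 1 \<le> Q \<longrightarrow> 0 < \<delta> \<longrightarrow> \<delta> < 1 / 2 \<longrightarrow>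
    c2 * ((\<delta> / Q) powr (real ?m / d) * Q ^ (?m + 1)) \<le> real (card (N_set f \<delta> Q))" by blast
  show "(\<lambda>(\<delta>, Q). \<delta> * Q ^ (?m + 1) + (\<delta> / Q) powr (real ?m / d) * Q ^ (?m + 1))
      \<in> O[principal (admissible \<epsilon>)](\<lambda>(\<delta>, Q). real (N_count f \<delta> Q))"
  proof (rule bigoI[where c = "1 / c1 + 1 / c2"], unfold eventually_principal, safe)
    fix \<delta> Q assume a: "(\<delta>, Q) \<in> admissible \<epsilon>"
    note a' = adm[OF a]
    define N where "N = real (card (N_set f \<delta> Q))"
    have "c1 * (\<delta> * Q ^ (?m + 1)) \<le> N" "c2 * ((\<delta> / Q) powr (real ?m / d) * Q ^ (?m + 1)) \<le> N"
      using c1(2) c2(2) a a' unfolding N_def by blast+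
    then have "\<delta> * Q ^ (?m + 1) \<le> N / c1" "(\<delta> / Q) powr (real ?m / d) * Q ^ (?m + 1) \<le> N / c2"
      using c1(1) c2(1) by (simp_all only: pos_le_divide_eq mult.commute)
    then have "\<delta> * Q ^ (?m + 1) + (\<delta> / Q) powr (real ?m / d) * Q ^ (?m + 1) \<le> (1 / c1 + 1 / c2) * N"
      by (simp add: distrib_right)
    moreover have "0 \<le> \<delta> * Q ^ (?m + 1) + (\<delta> / Q) powr (real ?m / d) * Q ^ (?m + 1)" using a' by auto
    moreover have "N = real (N_count f \<delta> Q)" unfolding N_def using a' by (simp add: N_count_eq)
    ultimately show "norm (\<delta> * Q ^ (?m + 1) + (\<delta> / Q) powr (real ?m / d) * Q ^ (?m + 1)) \<le> (1 / c1 + 1 / c2) * norm (real (N_count f \<delta> Q))"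
      by simp
  qed
  obtain C where C: "C \<ge> 0" "\<forall>\<delta> Q. (\<delta>, Q) \<in> admissible \<epsilon> \<longrightarrow> real (card (N_set f \<delta> Q)) \<le>
      C * (\<delta> * Q ^ (?m + 1) + (\<delta> / Q) powr (real ?m / d) * Q ^ (?m + 1) * (if d \<le> 2 * real ?m then 1 else Q powr \<epsilon>))"
    by (rule N_set_upper_bound[OF m d f \<epsilon>])
  show "(\<lambda>(\<delta>, Q). real (N_count f \<delta> Q)) \<in> O[principal (admissible \<epsilon>)](\<lambda>(\<delta>, Q). \<delta> * Q ^ (?m + 1) +
      (\<delta> / Q) powr (real ?m / d) * Q ^ (?m + 1) * (if d \<le> 2 * real ?m then 1 else Q powr \<epsilon>))"
  proof (rule bigoI[where c = C], unfold eventually_principal, safe)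
    fix \<delta> Q assume a: "(\<delta>, Q) \<in> admissible \<epsilon>"
    note a' = adm[OF a]
    define R where "R = \<delta> * Q ^ (?m + 1) + (\<delta> / Q) powr (real ?m / d) * Q ^ (?m + 1) * (if d \<le> 2 * real ?m then 1 else Q powr \<epsilon>)"
    have "real (card (N_set f \<delta> Q)) \<le> C * R" using C(2) a unfolding R_def by blast
    moreover have "R \<ge> 0" unfolding R_def using a' by (auto intro!: add_nonneg_nonneg mult_nonneg_nonneg)
    moreover have "N_count f \<delta> Q = card (N_set f \<delta> Q)" using a' by (simp add: N_count_eq)
    ultimately show "norm (real (N_count f \<delta> Q)) \<le> C * norm (\<delta> * Q ^ (?m + 1) +
      (\<delta> / Q) powr (real ?m / d) * Q ^ (?m + 1) * (if d \<le> 2 * real ?m then 1 else Q powr \<epsilon>))"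
      unfolding R_def[symmetric] by simp
  qed
qed

theorem theorem1p5:
  fixes n :: nat
  assumes "n \<ge> 3" and "CARD('m::finite) = n - 1"
  shows "\<exists>k::real. k > 0 \<and>
    (\<forall>(d::real) (\<epsilon>::real) (f :: real ^ 'm \<Rightarrow> real).
       d > 2 * (real n - 1) / (2 * real n - 3) \<longrightarrow> \<epsilon> > 0 \<longrightarrow>
       f \<in> nondegenerate_homogeneous_funs d \<longrightarrow>
       (d < real n - 1 \<longrightarrow>
          (\<lambda>(\<delta>, Q). real (N_count f \<delta> Q))
            \<in> \<Theta>[principal (admissible \<epsilon>)](\<lambda>(\<delta>, Q). \<delta> * Q ^ n + (\<delta> / Q) powr ((real n - 1) / d) * Q ^ n)) \<and>
       (d \<ge> real n - 1 \<longrightarrow>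
          (\<lambda>(\<delta>, Q). \<delta> * Q ^ n + (\<delta> / Q) powr ((real n - 1) / d) * Q ^ n)
            \<in> O[principal (admissible \<epsilon>)](\<lambda>(\<delta>, Q). real (N_count f \<delta> Q)) \<and>
          (\<lambda>(\<delta>, Q). real (N_count f \<delta> Q))
            \<in> O[principal (admissible \<epsilon>)](\<lambda>(\<delta>, Q). \<delta> * Q ^ n
                  + (\<delta> / Q) powr ((real n - 1) / d) * Q powr (real n + k * \<epsilon>))))"
proof (intro exI[of _ "1 :: real"] conjI allI impI)
  fix d \<epsilon> :: real and f :: "real ^ 'm \<Rightarrow> real"
  assume d: "d > 2 * (real n - 1) / (2 * real n - 3)" and \<epsilon>: "\<epsilon> > 0" and f: "f \<in> nondegenerate_homogeneous_funs d"
  have n: "n = CARD('m) + 1" "real n - 1 = real CARD('m)" using assms by auto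
  have m: "CARD('m) \<ge> 2" using assms by simp
  \<comment> \<open>The threshold is 1 + 1/(2n - 3).\<close>
  have d1: "d > 1"
  proof -
    have "1 < 2 * (real n - 1) / (2 * real n - 3)" using assms(1) by (simp add: field_simps)
    then show ?thesis using d by linarith
  qed
  note bounds = N_count_bounds[OF m d1 f \<epsilon>, folded n]
  show lower: "(\<lambda>(\<delta>, Q). \<delta> * Q ^ n + (\<delta> / Q) powr ((real n - 1) / d) * Q ^ n)
      \<in> O[principal (admissible \<epsilon>)](\<lambda>(\<delta>, Q). real (N_count f \<delta> Q))"
    by (rule bounds(1))
  show "(\<lambda>(\<delta>, Q). real (N_count f \<delta> Q))
      \<in> \<Theta>[principal (admissible \<epsilon>)](\<lambda>(\<delta>, Q). \<delta> * Q ^ n + (\<delta> / Q) powr ((real n - 1) / d) * Q ^ n)"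
    if "d < real n - 1"
  proof -
    \<comment> \<open>Part (a) lies in the range \<open>d \<le> 2 * (n - 1)\<close>, where the upper
      bound has no extra power of \<open>Q\<close>.\<close>
    have "real n - 1 \<le> 2 * (real n - 1)" using assms(1) by simp
    then have "d \<le> 2 * (real n - 1)" by (rule order_trans[OF less_imp_le[OF that]])
    then have "(\<lambda>(\<delta>, Q). real (N_count f \<delta> Q))
      \<in> O[principal (admissible \<epsilon>)](\<lambda>(\<delta>, Q). \<delta> * Q ^ n + (\<delta> / Q) powr ((real n - 1) / d) * Q ^ n)"
      using bounds(2) by simp
    then show ?thesis using lower by (simp add: bigtheta_def bigomega_iff_bigo)
  qed
  show "(\<lambda>(\<delta>, Q). real (N_count f \<delta> Q)) \<in> O[principal (admissible \<epsilon>)](\<lambda>(\<delta>, Q). \<delta> * Q ^ n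
      + (\<delta> / Q) powr ((real n - 1) / d) * Q powr (real n + 1 * \<epsilon>))"
  \<comment> \<open>\<open>k = 1\<close> is enough: the upper bound loses at most one factor
    \<open>Q powr \<epsilon>\<close>.\<close>
  proof (rule landau_o.big_trans[OF bounds(2)], rule bigoI[where c = 1], unfold eventually_principal, safe)
    fix \<delta> Q assume "(\<delta>, Q) \<in> admissible \<epsilon>"
    then have a: "Q \<ge> 1" "Q powr (\<epsilon> - 1) < \<delta>" by (auto simp: admissible_def)
    have "0 \<le> Q powr (\<epsilon> - 1)" by simp
    then have \<delta>: "\<delta> > 0" using a by linarith
    have Qn: "Q powr (real n + 1 * \<epsilon>) = Q ^ n * Q powr \<epsilon>" using a by (simp add: powr_add powr_realpow)
    have "1 \<le> Q powr \<epsilon>" using a \<epsilon> by (simp add: ge_one_powr_ge_zero)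
    then have "(\<delta> / Q) powr ((real n - 1) / d) * Q ^ n * (if d \<le> 2 * (real n - 1) then 1 else Q powr \<epsilon>)
       \<le> (\<delta> / Q) powr ((real n - 1) / d) * Q ^ n * Q powr \<epsilon>"
      using a by (intro mult_left_mono) auto
    moreover have "0 \<le> (\<delta> / Q) powr ((real n - 1) / d) * Q ^ n * (if d \<le> 2 * (real n - 1) then 1 else Q powr \<epsilon>)" "0 \<le> \<delta> * Q ^ n"
      using a \<delta> by auto
    ultimately show "norm (\<delta> * Q ^ n + (\<delta> / Q) powr ((real n - 1) / d) * Q ^ n * (if d \<le> 2 * (real n - 1) then 1 else Q powr \<epsilon>))
       \<le> 1 * norm (\<delta> * Q ^ n + (\<delta> / Q) powr ((real n - 1) / d) * Q powr (real n + 1 * \<epsilon>))"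
      unfolding Qn by (simp add: mult.assoc del: mult_1_right)
  qed
qed simp

end
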